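(* Let $n\ge3$, $0<2s<n$, and $g=\varphi^{\frac4{n-2s}}g_{\mathbb{S}^n}$ with $\varphi\in C^\infty(\mathbb{S}^n)$ positive. Let $P_s=\frac{\Gamma(B+\frac12+s)}{\Gamma(B+\frac12-s)}$, $B=\sqrt{-\Delta_{g_{\mathbb{S}^n}}+(\frac{n-1}2)^2}$, $P^g_s(u)=\varphi^{-\frac{n+2s}{n-2s}}P_s(\varphi u)$, $R^g_s=P^g_s(1)$, $c_{n,s}=\frac{\Gamma(\frac n2-s)}{\pi^{n/2}2^{2s}\Gamma(s)}$ and $\mathcal K(\zeta,\omega)=\varphi(\zeta)\varphi(\omega)|\zeta-\omega|^{n-2s}$ ($|\cdot|$ Euclidean in $\mathbb{R}^{n+1}$). Let $f:\mathbb{R}\to\mathbb{R}$ be continuous and consider $$P^g_su-R^g_su=f(u)\ \text{ on }\mathbb{S}^n,\qquad(D)$$ $$u(\zeta)=c_{n,s}\int_{\mathbb{S}^n}\frac{f(u)(\omega)+R^g_s(\omega)u(\omega)}{\mathcal K(\zeta,\omega)}d\upsilon_g^{(\omega)},\ \zeta\in\mathbb{S}^n.\qquad(I)$$ Then: (i) any continuous nonnegative solution of $(I)$ is also a solution of $(D)$; (ii) if $f(t)+R^g_s(\zeta)t\ge0$ for all $\zeta\in\mathbb{S}^n$ and $t\ge0$, then any nonnegative smooth solution of $(D)$ is also a solution of $(I)$. *)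

theory Defs
  imports "HOL-Analysis.Analysis"
begin

text \<open>The unit sphere S^n inside R^(n+1); here R^(n+1) is an abstract Euclidean
space 'a with DIM('a) = n + 1.\<close>
definition Sn :: "'a::euclidean_space set" where
  "Sn = sphere 0 1"

definition radext :: "('a::euclidean_space \<Rightarrow> real) \<Rightarrow> 'a \<Rightarrow> real" where
  "radext u x = u (x /\<^sub>R norm x)"

fun dpart :: "'a list \<Rightarrow> ('a::real_normed_vector \<Rightarrow> real) \<Rightarrow> 'a \<Rightarrow> real" where
  "dpart [] F = F"
| "dpart (v # vs) F = (\<lambda>x. deriv (\<lambda>t. dpart vs F (x + t *\<^sub>R v)) 0)"

definition smooth_on_open :: "'a::euclidean_space set \<Rightarrow> ('a \<Rightarrow> real) \<Rightarrow> bool" where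
  "smooth_on_open U F \<longleftrightarrow>
     (\<forall>vs. set vs \<subseteq> Basis \<longrightarrow>
        continuous_on U (dpart vs F) \<and>
        (\<forall>v\<in>Basis. \<forall>x\<in>U. (\<lambda>t. dpart vs F (x + t *\<^sub>R v)) differentiable (at 0)))"

definition sphere_smooth :: "('a::euclidean_space \<Rightarrow> real) \<Rightarrow> bool" where
  "sphere_smooth u \<longleftrightarrow> smooth_on_open (- {0}) (radext u)"

definition lap :: "('a::euclidean_space \<Rightarrow> real) \<Rightarrow> 'a \<Rightarrow> real" where
  "lap F x = (\<Sum>i\<in>Basis. dpart [i, i] F x)"

text \<open>Laplace-Beltrami operator of the round sphere (Euclidean Laplacian of the
0-homogeneous extension, evaluated on the sphere).\<close>
definition sph_lap :: "('a::euclidean_space \<Rightarrow> real) \<Rightarrow> 'a \<Rightarrow> real" where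
  "sph_lap u \<zeta> = lap (radext u) \<zeta>"

text \<open>Integral over S^n w.r.t. the standard surface measure (cone construction:
integral over S^n of h = (n+1) times integral over the unit ball of h(x/|x|)).\<close>
definition sint :: "('a::euclidean_space \<Rightarrow> real) \<Rightarrow> real" where
  "sint h = real DIM('a) * (LINT x : ball 0 1 | lborel. h (x /\<^sub>R norm x))"

definition harm_space :: "nat \<Rightarrow> ('a::euclidean_space \<Rightarrow> real) set" where
  "harm_space k = {Y. sphere_smooth Y \<and> (\<forall>x. x \<notin> (Sn :: 'a set) \<longrightarrow> Y x = 0) \<and>
      (\<forall>\<zeta>\<in>Sn. - sph_lap Y \<zeta> = real k * (real k + real DIM('a) - 2) * Y \<zeta>)}"

definition harm_proj :: "nat \<Rightarrow> ('a::euclidean_space \<Rightarrow> real) \<Rightarrow> 'a \<Rightarrow> real" where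
  "harm_proj k u = (THE Y. Y \<in> harm_space k \<and>
      (\<forall>Z\<in>harm_space k. sint (\<lambda>\<omega>. (u \<omega> - Y \<omega>) * Z \<omega>) = 0))"

text \<open>Spectral calculus: P_s = Gamma(B+1/2+s)/Gamma(B+1/2-s),
B = sqrt(-Delta + ((n-1)/2)^2), acting on the eigenspace of eigenvalue k(k+n-1).\<close>
definition Bk :: "'a::euclidean_space itself \<Rightarrow> nat \<Rightarrow> real" where
  "Bk T k = (let n = real DIM('a) - 1 in sqrt (real k * (real k + n - 1) + ((n - 1) / 2)\<^sup>2))"

definition Ps :: "real \<Rightarrow> ('a::euclidean_space \<Rightarrow> real) \<Rightarrow> 'a \<Rightarrow> real" where
  "Ps s u \<zeta> = (\<Sum>k. Gamma (Bk TYPE('a) k + 1/2 + s) / Gamma (Bk TYPE('a) k + 1/2 - s)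
                      * harm_proj k u \<zeta>)"

definition Pg :: "real \<Rightarrow> ('a::euclidean_space \<Rightarrow> real) \<Rightarrow> ('a \<Rightarrow> real) \<Rightarrow> 'a \<Rightarrow> real" where
  "Pg s \<phi> u \<zeta> = (let n = real DIM('a) - 1 in
      \<phi> \<zeta> powr (- (n + 2 * s) / (n - 2 * s)) * Ps s (\<lambda>\<omega>. \<phi> \<omega> * u \<omega>) \<zeta>)"

definition Rg :: "real \<Rightarrow> ('a::euclidean_space \<Rightarrow> real) \<Rightarrow> 'a \<Rightarrow> real" where
  "Rg s \<phi> = Pg s \<phi> (\<lambda>_. 1)"

text \<open>Integral w.r.t. the volume measure of g: d vol_g = phi^(2n/(n-2s)) d sigma.\<close>
definition vint :: "real \<Rightarrow> ('a::euclidean_space \<Rightarrow> real) \<Rightarrow> ('a \<Rightarrow> real) \<Rightarrow> real" where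
  "vint s \<phi> h = (let n = real DIM('a) - 1 in
      sint (\<lambda>\<omega>. \<phi> \<omega> powr (2 * n / (n - 2 * s)) * h \<omega>))"

definition cns :: "real \<Rightarrow> real \<Rightarrow> real" where
  "cns n s = Gamma (n / 2 - s) / (pi powr (n / 2) * 2 powr (2 * s) * Gamma s)"

definition Kern :: "real \<Rightarrow> ('a::euclidean_space \<Rightarrow> real) \<Rightarrow> 'a \<Rightarrow> 'a \<Rightarrow> real" where
  "Kern s \<phi> \<zeta> \<omega> = (let n = real DIM('a) - 1 in \<phi> \<zeta> * \<phi> \<omega> * norm (\<zeta> - \<omega>) powr (n - 2 * s))"

definition solD :: "real \<Rightarrow> ('a::euclidean_space \<Rightarrow> real) \<Rightarrow> (real \<Rightarrow> real) \<Rightarrow> ('a \<Rightarrow> real) \<Rightarrow> bool" where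
  "solD s \<phi> f u \<longleftrightarrow> (\<forall>\<zeta>\<in>Sn. Pg s \<phi> u \<zeta> - Rg s \<phi> \<zeta> * u \<zeta> = f (u \<zeta>))"

text \<open>(D) in the weak (distributional) sense, using the formal self-adjointness of
P^g_s with respect to vol_g.\<close>
definition weak_solD :: "real \<Rightarrow> ('a::euclidean_space \<Rightarrow> real) \<Rightarrow> (real \<Rightarrow> real) \<Rightarrow> ('a \<Rightarrow> real) \<Rightarrow> bool" where
  "weak_solD s \<phi> f u \<longleftrightarrow> (\<forall>\<psi>. sphere_smooth \<psi> \<longrightarrow>
      vint s \<phi> (\<lambda>\<omega>. u \<omega> * Pg s \<phi> \<psi> \<omega>) = vint s \<phi> (\<lambda>\<omega>. (f (u \<omega>) + Rg s \<phi> \<omega> * u \<omega>) * \<psi> \<omega>))"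

definition solI :: "real \<Rightarrow> ('a::euclidean_space \<Rightarrow> real) \<Rightarrow> (real \<Rightarrow> real) \<Rightarrow> ('a \<Rightarrow> real) \<Rightarrow> bool" where
  "solI s \<phi> f u \<longleftrightarrow> (\<forall>\<zeta>\<in>Sn. u \<zeta> = cns (real DIM('a) - 1) s *
      vint s \<phi> (\<lambda>\<omega>. (f (u \<omega>) + Rg s \<phi> \<omega> * u \<omega>) / Kern s \<phi> \<zeta> \<omega>))"

end

theory Submission
  imports Defs
begin

text \<open>
  Everything reduces to one identity: for smooth \<open>v\<close>, the potential with kernel
  \<open>c\<^sub>n\<^sub>,\<^sub>s |\<zeta> - \<omega>|\<^bsup>2s-n\<^esup>\<close> recovers \<open>v\<close> from \<open>P\<^sub>s v\<close>. Part (ii) is this identity for \<open>v = \<phi> u\<close>; part (i)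
  follows from it, for \<open>v = \<phi> \<psi>\<close>, by the symmetry of the kernel.

  The identity comes from subordination to the Poisson kernel
  \<open>p\<^sub>r(t) = (1 - r\<^sup>2) (1 - 2 r t + r\<^sup>2)\<^bsup>-(n+1)/2\<^esup>\<close>. On the one hand \<open>p\<^sub>r(t) = \<Sum>\<^sub>k r\<^sup>k Z\<^sub>k(t)\<close> with Gegenbauer
  polynomials \<open>Z\<^sub>k\<close>; Green's identity on the sphere and the approximate-identity property of \<open>p\<^sub>r\<close> show that
  \<open>Z\<^sub>k(\<zeta> \<bullet> \<omega>)\<close> is, up to normalisation, the kernel of the projection to the \<open>k\<close>-th eigenspace, and that a
  smooth function is the absolutely convergent sum of its projections. On the other hand, integrating
  against the Beta weight \<open>r\<^bsup>n/2-s-1\<^esup> (1 - r)\<^bsup>2s-1\<^esup>\<close> over \<open>0 < r < 1\<close> turns \<open>p\<^sub>r(\<zeta> \<bullet> \<omega>)\<close> into a multiple of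
  \<open>|\<zeta> - \<omega>|\<^bsup>2s-n\<^esup>\<close> and \<open>r\<^sup>k\<close> into \<open>\<Gamma>(2s)\<close> divided by the \<open>k\<close>-th eigenvalue of \<open>P\<^sub>s\<close>.

  Green's identity needs no polar coordinates: a surface integral is the integral of a 0-homogeneous
  function over the ball, and directional derivatives of compactly supported functions integrate to zero.
\<close>

section \<open>Partial derivatives and smooth functions\<close>

text \<open>The kernel |\<zeta> - \<omega>|^(2s-n) is singular on the diagonal, so its zonal series
  admits no uniform bound there; for r < 1 the Poisson series converges geometrically, and the
  positivity and constant mass of the Poisson kernel justify exchanging the two integrals. The Beta
  weight is forced: with b = n/2 - s the k-th eigenvalue of P_s is Gamma(b+k+2s) / Gamma(b+k) =
  Gamma(2s) / Beta(b+k, 2s), and Beta(b+k, 2s) is the integral of r^k against r^(b-1) (1-r)^(2s-1).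
  The definitions shape the work. \<open>harm_proj\<close> is a definite description, of which
  nothing is known before existence and uniqueness are shown; the integral operator
  \<open>hproj\<close> stands in until then. \<open>Ps\<close> is a pointwise infinite sum,
  controlled by rapid decay of the projections of smooth functions against polynomial growth of
  eigenvalues. A merely continuous u offers no such decay, hence in (i) the operator acts on the
  test function. Smoothness is given by coordinate partial derivatives, while Euler's relation is
  radial, so the total derivative has to be recovered.\<close>

definition has_partial :: "('a::real_normed_vector \<Rightarrow> real) \<Rightarrow> 'a \<Rightarrow> real \<Rightarrow> 'a \<Rightarrow> bool" where
  "has_partial F v d x \<longleftrightarrow> ((\<lambda>t. F (x + t *\<^sub>R v)) has_real_derivative d) (at 0)"

declare dpart.simps(2) [simp del]

lemma has_partial_imp_dpart: "has_partial F v d x \<Longrightarrow> dpart [v] F x = d"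
  by (simp add: has_partial_def DERIV_imp_deriv dpart.simps(2))

lemma has_partial_const: "has_partial (\<lambda>_. c) v 0 x"
  by (simp add: has_partial_def)

lemma has_partial_add:
  "has_partial F v d x \<Longrightarrow> has_partial G v e x \<Longrightarrow> has_partial (\<lambda>x. F x + G x) v (d + e) x"
  unfolding has_partial_def by (rule DERIV_add)

lemma has_partial_mult:
  assumes "has_partial F v d x" "has_partial G v e x"
  shows "has_partial (\<lambda>x. F x * G x) v (d * G x + F x * e) x"
  using DERIV_mult[OF assms[unfolded has_partial_def]]
  by (simp add: has_partial_def mult.commute add.commute)

lemma has_partial_cmult:
  "has_partial F v d x \<Longrightarrow> has_partial (\<lambda>x. c * F x) v (c * d) x"
  unfolding has_partial_def by (rule DERIV_cmult)

lemma has_partial_inner: "has_partial (\<lambda>x. x \<bullet> w) v (v \<bullet> w) x"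
  unfolding has_partial_def inner_add_left inner_scaleR_left
  by (auto intro!: derivative_eq_intros)

lemma has_partial_chain:
  assumes "has_partial F v d x" "(g has_real_derivative e) (at (F x))"
  shows "has_partial (\<lambda>x. g (F x)) v (e * d) x"
  using DERIV_chain2[of g e "\<lambda>t. F (x + t *\<^sub>R v)" 0 d UNIV] assms
  by (simp add: has_partial_def)

lemma has_partial_inner_self: "has_partial (\<lambda>x. x \<bullet> x) v (2 * (x \<bullet> v)) x"
proof -
  have eq: "(x + t *\<^sub>R v) \<bullet> (x + t *\<^sub>R v) = x \<bullet> x + 2 * t * (x \<bullet> v) + t\<^sup>2 * (v \<bullet> v)" for t
    by (simp add: inner_add_left inner_add_right inner_commute power2_eq_square)
  show ?thesis unfolding has_partial_def eq by (auto intro!: derivative_eq_intros)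
qed

lemma has_partial_inner_self_powr:
  assumes "x \<noteq> 0"
  shows "has_partial (\<lambda>x. (x \<bullet> x) powr a) v (2 * a * (x \<bullet> v) * (x \<bullet> x) powr (a - 1)) x"
proof -
  have "((\<lambda>y. y powr a) has_real_derivative a * (x \<bullet> x) powr (a - 1)) (at (x \<bullet> x))"
    using assms by (intro has_real_derivative_powr) simp
  from has_partial_chain[OF has_partial_inner_self this, of v]
  show ?thesis by (simp add: mult_ac)
qed

lemma has_partial_cong_open:
  assumes "open U" "x \<in> U" "\<And>y. y \<in> U \<Longrightarrow> F y = G y" "has_partial F v d x"
  shows "has_partial G v d x"
proof -
  have "continuous_on UNIV (\<lambda>t. x + t *\<^sub>R v)" by (intro continuous_intros)
  then have "open ((\<lambda>t. x + t *\<^sub>R v) -` U)"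
    using assms(1) by (simp add: open_vimage)
  then have "\<forall>\<^sub>F t in nhds 0. t \<in> (\<lambda>t. x + t *\<^sub>R v) -` U"
    using assms(2) by (intro eventually_nhds_in_open) auto
  then have "\<forall>\<^sub>F t in nhds 0. F (x + t *\<^sub>R v) = G (x + t *\<^sub>R v)"
    by eventually_elim (use assms(3) in auto)
  from DERIV_cong_ev[OF refl this refl] show ?thesis
    using assms(4) by (simp add: has_partial_def)
qed

lemma has_partial_shift:
  assumes "has_partial F v d (x + t *\<^sub>R v)"
  shows "((\<lambda>t. F (x + t *\<^sub>R v)) has_real_derivative d) (at t)"
proof -
  have "((\<lambda>r. F (x + (t + r) *\<^sub>R v)) has_real_derivative d) (at 0)"
    using assms by (simp add: has_partial_def algebra_simps)
  then show ?thesis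
    using DERIV_shift[of "\<lambda>t. F (x + t *\<^sub>R v)" d 0 t] by (simp add: add.commute)
qed

lemma dpart_append: "dpart (vs @ ws) F = dpart vs (dpart ws F)"
  by (induction vs) (auto simp: dpart.simps(2))

lemma dpart_cong_open:
  assumes "open U" "\<And>y. y \<in> U \<Longrightarrow> F y = G y" "x \<in> U"
  shows "dpart vs F x = dpart vs G x"
  using assms(3)
proof (induction vs arbitrary: x)
  case (Cons v vs)
  have "continuous_on UNIV (\<lambda>t. x + t *\<^sub>R v)" by (intro continuous_intros)
  then have "open ((\<lambda>t. x + t *\<^sub>R v) -` U)"
    using assms(1) by (simp add: open_vimage)
  then have "\<forall>\<^sub>F t in nhds 0. t \<in> (\<lambda>t. x + t *\<^sub>R v) -` U"
    using Cons.prems by (intro eventually_nhds_in_open) auto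
  then have "\<forall>\<^sub>F t in nhds 0. dpart vs F (x + t *\<^sub>R v) = dpart vs G (x + t *\<^sub>R v)"
    by eventually_elim (use Cons.IH in auto)
  then show ?case by (simp add: deriv_cong_ev dpart.simps(2))
qed (use assms(2) in simp)

text \<open>\<open>smooth_on_open\<close> quantifies over all lists of directions at once, which
  gives no induction for products. Counting the order and peeling off the innermost derivative does:
  the Leibniz rule leaves terms of one order less.\<close>

fun smooth_upto :: "nat \<Rightarrow> 'a::euclidean_space set \<Rightarrow> ('a \<Rightarrow> real) \<Rightarrow> bool" where
  "smooth_upto 0 U F \<longleftrightarrow> continuous_on U F \<and>
     (\<forall>v\<in>Basis. \<forall>x\<in>U. (\<lambda>t. F (x + t *\<^sub>R v)) differentiable (at 0))"
| "smooth_upto (Suc m) U F \<longleftrightarrow> smooth_upto 0 U F \<and> (\<forall>v\<in>Basis. smooth_upto m U (dpart [v] F))"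

lemma smooth_upto_dpart:
  "set vs \<subseteq> Basis \<Longrightarrow> smooth_upto (length vs + m) U F \<Longrightarrow> smooth_upto m U (dpart vs F)"
proof (induction vs arbitrary: F rule: rev_induct)
  case (snoc v vs)
  then show ?case by (simp add: dpart_append)
qed simp

lemma smooth_on_open_dpart:
  assumes "smooth_on_open U F" "set ws \<subseteq> Basis"
  shows "smooth_on_open U (dpart ws F)"
  unfolding smooth_on_open_def dpart_append[symmetric]
  using assms unfolding smooth_on_open_def by (metis Un_least set_append)

lemma smooth_on_open_iff: "smooth_on_open U F \<longleftrightarrow> (\<forall>m. smooth_upto m U F)"
proof
  assume "smooth_on_open U F"
  then show "\<forall>m. smooth_upto m U F"
  proof (intro allI)
    fix m show "smooth_on_open U F \<Longrightarrow> smooth_upto m U F"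
    proof (induction m arbitrary: F)
      case 0
      then show ?case unfolding smooth_on_open_def
        by (metis bot_least dpart.simps(1) list.set(1) smooth_upto.simps(1))
    next
      case (Suc m)
      then have "smooth_upto 0 U F"
        unfolding smooth_on_open_def
        by (metis bot_least dpart.simps(1) list.set(1) smooth_upto.simps(1))
      moreover have "smooth_upto m U (dpart [v] F)" if "v \<in> Basis" for v
        using Suc.IH[OF smooth_on_open_dpart[OF Suc.prems, of "[v]"]] that by simp
      ultimately show ?case by simp
    qed
  qed
next
  assume *: "\<forall>m. smooth_upto m U F"
  show "smooth_on_open U F"
    unfolding smooth_on_open_def
    using smooth_upto_dpart[of _ 0 U F] * by auto
qed

lemma smooth_upto_0: "smooth_upto m U F \<Longrightarrow> smooth_upto 0 U F"
  by (cases m) auto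

lemma smooth_upto_Suc_imp: "smooth_upto (Suc m) U F \<Longrightarrow> smooth_upto m U F"
  by (induction m arbitrary: F) auto

lemma smooth_upto_0_has_partial:
  assumes "smooth_upto 0 U F" "v \<in> Basis" "x \<in> U"
  shows "has_partial F v (dpart [v] F x) x"
proof -
  from assms have "(\<lambda>t. F (x + t *\<^sub>R v)) differentiable (at 0)" by simp
  then obtain d where "has_partial F v d x" by (auto simp: has_partial_def real_differentiable_def)
  then show ?thesis using has_partial_imp_dpart by blast
qed

lemma smooth_on_open_has_partial:
  assumes "smooth_on_open U F" "v \<in> Basis" "x \<in> U"
  shows "has_partial F v (dpart [v] F x) x"
  using assms smooth_upto_0_has_partial smooth_on_open_iff by blast

lemma smooth_on_open_continuous: "smooth_on_open U F \<Longrightarrow> continuous_on U F"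
  using smooth_on_open_iff smooth_upto.simps(1) by blast

lemma smooth_upto_cong:
  assumes "open U" "\<And>x. x \<in> U \<Longrightarrow> F x = G x" "smooth_upto m U F"
  shows "smooth_upto m U G"
  using assms(2,3)
proof (induction m arbitrary: F G)
  case 0
  have "(\<lambda>t. G (x + t *\<^sub>R v)) differentiable (at 0)" if "v \<in> Basis" "x \<in> U" for v x
    using has_partial_cong_open[OF assms(1) that(2) 0(1) smooth_upto_0_has_partial[OF 0(2) that]]
    by (auto simp: has_partial_def real_differentiable_def)
  then show ?case using 0 by (simp cong: continuous_on_cong)
next
  case (Suc m)
  have "(\<lambda>t. G (x + t *\<^sub>R v)) differentiable (at 0)" if "v \<in> Basis" "x \<in> U" for v x
    using has_partial_cong_open[OF assms(1) that(2) Suc(2)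
        smooth_upto_0_has_partial[OF smooth_upto_0[OF Suc(3)] that]]
    by (auto simp: has_partial_def real_differentiable_def)
  moreover have "smooth_upto m U (dpart [v] G)" if "v \<in> Basis" for v
    using Suc.IH[of "dpart [v] F" "dpart [v] G"] Suc.prems that dpart_cong_open[OF assms(1)]
    by (metis smooth_upto.simps(2))
  ultimately show ?case using Suc.prems by (simp cong: continuous_on_cong)
qed

lemma smooth_on_open_cong:
  assumes "open U" "\<And>x. x \<in> U \<Longrightarrow> F x = G x" "smooth_on_open U F"
  shows "smooth_on_open U G"
  using smooth_upto_cong[OF assms(1,2)] assms(3) by (auto simp: smooth_on_open_iff)

lemma smooth_upto_0I:
  assumes "continuous_on U F" "\<And>v x. v \<in> Basis \<Longrightarrow> x \<in> U \<Longrightarrow> has_partial F v (D v x) x"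
  shows "smooth_upto 0 U F"
  using assms by (auto simp: has_partial_def real_differentiable_def)

text \<open>The derivative may be supplied as a formula \<open>D\<close> in place of
  \<open>dpart\<close>; induction on \<open>m\<close> over a family closed under \<open>D\<close>
  then proves smoothness of explicit functions.\<close>

lemma smooth_upto_SucI:
  assumes "open U" "continuous_on U F"
    "\<And>v x. v \<in> Basis \<Longrightarrow> x \<in> U \<Longrightarrow> has_partial F v (D v x) x"
    "\<And>v. v \<in> Basis \<Longrightarrow> smooth_upto m U (D v)"
  shows "smooth_upto (Suc m) U F"
proof -
  have "smooth_upto m U (dpart [v] F)" if "v \<in> Basis" for v
  proof (rule smooth_upto_cong[OF assms(1) _ assms(4)[OF that]])
    show "D v x = dpart [v] F x" if "x \<in> U" for x
      using has_partial_imp_dpart assms(3)[OF \<open>v \<in> Basis\<close> that] by metis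
  qed
  then show ?thesis using smooth_upto_0I[OF assms(2,3)] by auto
qed

lemma smooth_upto_const: "open U \<Longrightarrow> smooth_upto m U (\<lambda>_. c)"
proof (induction m arbitrary: c)
  case 0
  show ?case by (rule smooth_upto_0I[where D = "\<lambda>_ _. 0"]) (auto intro: has_partial_const)
next
  case (Suc m)
  show ?case using Suc
    by (intro smooth_upto_SucI[where D = "\<lambda>_ _. 0"]) (auto intro: has_partial_const)
qed

lemma smooth_upto_continuous: "smooth_upto m U F \<Longrightarrow> continuous_on U F"
  using smooth_upto_0 by auto

lemma smooth_upto_add:
  "open U \<Longrightarrow> smooth_upto m U F \<Longrightarrow> smooth_upto m U G \<Longrightarrow> smooth_upto m U (\<lambda>x. F x + G x)"
proof (induction m arbitrary: F G)
  case 0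
  show ?case
    by (rule smooth_upto_0I[where D = "\<lambda>v x. dpart [v] F x + dpart [v] G x"])
      (use 0 in \<open>auto intro!: continuous_on_add has_partial_add smooth_upto_0_has_partial[of U]\<close>)
next
  case (Suc m)
  show ?case
  proof (rule smooth_upto_SucI[where D = "\<lambda>v x. dpart [v] F x + dpart [v] G x"])
    show "continuous_on U (\<lambda>x. F x + G x)"
      using Suc.prems by (intro continuous_on_add) (auto dest: smooth_upto_continuous)
    show "has_partial (\<lambda>x. F x + G x) v (dpart [v] F x + dpart [v] G x) x" if "v \<in> Basis" "x \<in> U" for v x
      using Suc.prems that by (intro has_partial_add smooth_upto_0_has_partial[of U] smooth_upto_0)
    show "smooth_upto m U (\<lambda>x. dpart [v] F x + dpart [v] G x)" if "v \<in> Basis" for v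
      using Suc.prems that by (intro Suc.IH) auto
  qed (rule Suc.prems(1))
qed

lemma smooth_upto_mult:
  "open U \<Longrightarrow> smooth_upto m U F \<Longrightarrow> smooth_upto m U G \<Longrightarrow> smooth_upto m U (\<lambda>x. F x * G x)"
proof (induction m arbitrary: F G)
  case 0
  show ?case
    by (rule smooth_upto_0I[where D = "\<lambda>v x. dpart [v] F x * G x + F x * dpart [v] G x"])
      (use 0 in \<open>auto intro!: continuous_on_mult has_partial_mult smooth_upto_0_has_partial[of U]\<close>)
next
  case (Suc m)
  show ?case
  proof (rule smooth_upto_SucI[where D = "\<lambda>v x. dpart [v] F x * G x + F x * dpart [v] G x"])
    show "continuous_on U (\<lambda>x. F x * G x)"
      using Suc.prems by (intro continuous_on_mult) (auto dest: smooth_upto_continuous)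
    show "has_partial (\<lambda>x. F x * G x) v (dpart [v] F x * G x + F x * dpart [v] G x) x"
      if "v \<in> Basis" "x \<in> U" for v x
      using Suc.prems that by (intro has_partial_mult smooth_upto_0_has_partial[of U] smooth_upto_0)
    show "smooth_upto m U (\<lambda>x. dpart [v] F x * G x + F x * dpart [v] G x)" if "v \<in> Basis" for v
      using Suc.prems that smooth_upto_Suc_imp[OF Suc.prems(2)] smooth_upto_Suc_imp[OF Suc.prems(3)]
      by (intro smooth_upto_add Suc.IH) auto
  qed (rule Suc.prems(1))
qed

lemma smooth_upto_inner: "open U \<Longrightarrow> smooth_upto m U (\<lambda>x. x \<bullet> w)"
proof (cases m)
  case 0
  show ?thesis unfolding 0
    by (rule smooth_upto_0I[where D = "\<lambda>v _. v \<bullet> w"], intro continuous_intros)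
      (rule has_partial_inner)
next
  case (Suc k)
  assume "open U"
  then show ?thesis unfolding Suc
    by (intro smooth_upto_SucI[where D = "\<lambda>v _. v \<bullet> w"] has_partial_inner smooth_upto_const)
      (auto intro!: continuous_intros)
qed

text \<open>Powers of the norm are written through \<open>x \<bullet> x\<close>, whose partial
  derivatives are linear. The exponent varies in the induction because each derivative lowers it by
  one.\<close>

lemma smooth_upto_inner_self_powr:
  fixes U :: "'a::euclidean_space set"
  assumes "open U" "0 \<notin> U"
  shows "smooth_upto m U (\<lambda>x. (x \<bullet> x) powr a)"
proof (induction m arbitrary: a)
  case 0
  show ?case
    using assms
    by (intro smooth_upto_0I[where D = "\<lambda>v x. 2 * a * (x \<bullet> v) * (x \<bullet> x) powr (a - 1)"]
        has_partial_inner_self_powr) (auto intro!: continuous_intros)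
next
  case (Suc m)
  show ?case
    using assms
    by (intro smooth_upto_SucI[where D = "\<lambda>v x. 2 * a * (x \<bullet> v) * (x \<bullet> x) powr (a - 1)"]
        has_partial_inner_self_powr smooth_upto_mult smooth_upto_const smooth_upto_inner Suc)
      (auto intro!: continuous_on_powr' continuous_on_inner continuous_on_id)
qed

lemma
  assumes "open U"
  shows smooth_on_open_const: "smooth_on_open U (\<lambda>_. c)"
    and smooth_on_open_inner: "smooth_on_open U (\<lambda>x. x \<bullet> w)"
    and smooth_on_open_add: "smooth_on_open U F \<Longrightarrow> smooth_on_open U G \<Longrightarrow> smooth_on_open U (\<lambda>x. F x + G x)"
    and smooth_on_open_mult: "smooth_on_open U F \<Longrightarrow> smooth_on_open U G \<Longrightarrow> smooth_on_open U (\<lambda>x. F x * G x)"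
    and smooth_on_open_inner_self_powr: "0 \<notin> U \<Longrightarrow> smooth_on_open U (\<lambda>x. (x \<bullet> x) powr a)"
  using assms
  by (auto simp: smooth_on_open_iff intro: smooth_upto_const smooth_upto_inner smooth_upto_add
      smooth_upto_mult smooth_upto_inner_self_powr)

lemma smooth_on_open_sum:
  assumes "open U" "\<And>i. i \<in> I \<Longrightarrow> smooth_on_open U (F i)"
  shows "smooth_on_open U (\<lambda>x. \<Sum>i\<in>I. F i x)"
  using assms(2)
  by (induction I rule: infinite_finite_induct)
    (auto intro: smooth_on_open_add smooth_on_open_const assms(1))

text \<open>Telescoping along the coordinates, with the mean value theorem in each of them.\<close>
lemma smooth_on_open_has_derivative:
  fixes F :: "'a::euclidean_space \<Rightarrow> real"
  assumes U: "open U" and F: "smooth_on_open U F" and x: "x \<in> U"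
  shows "(F has_derivative (\<lambda>h. \<Sum>i\<in>Basis. (h \<bullet> i) * dpart [i] F x)) (at x)"
proof -
  have aux: "\<forall>e>0. \<exists>d>0. \<forall>h. norm h < d \<longrightarrow>
      \<bar>F (x + (\<Sum>i\<in>A. (h \<bullet> i) *\<^sub>R i)) - F x - (\<Sum>i\<in>A. (h \<bullet> i) * dpart [i] F x)\<bar> \<le> e * norm h"
    if "finite A" "A \<subseteq> Basis" for A :: "'a set"
    using that
  proof (induction A rule: finite_induct)
    case empty
    have "\<exists>d>0. \<forall>h::'a. norm h < d \<longrightarrow> (0::real) \<le> e * norm h" if "e > 0" for e
      using that by (intro exI[of _ 1]) simp
    then show ?case by simp
  next
    case (insert j A)
    show ?case
    proof (intro allI impI)
      fix e :: real assume e: "e > 0"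
      obtain d1 where d1: "d1 > 0" "\<And>h. norm h < d1 \<Longrightarrow>
          \<bar>F (x + (\<Sum>i\<in>A. (h \<bullet> i) *\<^sub>R i)) - F x - (\<Sum>i\<in>A. (h \<bullet> i) * dpart [i] F x)\<bar> \<le> e/2 * norm h"
        using insert.IH[rule_format, of "e/2"] insert.prems e by auto
      have j: "j \<in> Basis" and A: "finite A" "A \<subseteq> Basis" "j \<notin> A"
        using insert.hyps insert.prems by auto
      have "continuous_on U (dpart [j] F)"
        using smooth_on_open_continuous[OF smooth_on_open_dpart[OF F, of "[j]"]] j by simp
      then have "isCont (dpart [j] F) x"
        using continuous_on_interior x U interior_open by metis
      then obtain d2 where d2: "d2 > 0" "\<And>y. dist y x < d2 \<Longrightarrow> dist (dpart [j] F y) (dpart [j] F x) < e/2"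
        unfolding continuous_at_eps_delta using half_gt_zero[OF e] by blast
      obtain d3 where d3: "d3 > 0" "ball x d3 \<subseteq> U"
        using U x openE by blast
      \<comment> \<open>\<open>y\<close> differs from \<open>x\<close> by at most DIM('a) coordinate
        steps and the intermediate point of the mean value theorem by one more, each of length at
        most \<open>norm h\<close>.\<close>
      define B where "B = real (DIM('a)) + 1"
      have B: "B > 0" by (simp add: B_def)
      define d where "d = min d1 (min d2 d3 / B)"
      have "d > 0" using d1 d2 d3 B by (simp add: d_def)
      moreover have "\<bar>F (x + (\<Sum>i\<in>insert j A. (h \<bullet> i) *\<^sub>R i)) - F x
          - (\<Sum>i\<in>insert j A. (h \<bullet> i) * dpart [i] F x)\<bar> \<le> e * norm h" if h: "norm h < d" for h
      proof -
        define y where "y = x + (\<Sum>i\<in>A. (h \<bullet> i) *\<^sub>R i)"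
        have near: "dist (y + (t * (h \<bullet> j)) *\<^sub>R j) x < min d2 d3" if "0 \<le> t" "t \<le> 1" for t
        proof -
          have "norm (\<Sum>i\<in>A. (h \<bullet> i) *\<^sub>R i) \<le> (\<Sum>i\<in>A. norm h)"
          proof (rule sum_norm_le)
            fix i assume "i \<in> A"
            then have "i \<in> Basis" using A by auto
            then show "norm ((h \<bullet> i) *\<^sub>R i) \<le> norm h"
              using Basis_le_norm[of i h] by simp
          qed
          also have "\<dots> \<le> real DIM('a) * norm h"
            using A by (auto simp: card_mono mult_right_mono)
          finally have 1: "norm (\<Sum>i\<in>A. (h \<bullet> i) *\<^sub>R i) \<le> real DIM('a) * norm h" .
          have "norm ((t * (h \<bullet> j)) *\<^sub>R j) \<le> norm h"
            using j that Basis_le_norm[OF j, of h] mult_mono[of t 1 "\<bar>h \<bullet> j\<bar>" "norm h"]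
            by (simp add: abs_mult)
          with 1 have "norm (y + (t * (h \<bullet> j)) *\<^sub>R j - x) \<le> B * norm h"
            unfolding y_def B_def
            using norm_triangle_ineq[of "\<Sum>i\<in>A. (h \<bullet> i) *\<^sub>R i" "(t * (h \<bullet> j)) *\<^sub>R j"]
            by (simp add: algebra_simps)
          also have "\<dots> < min d2 d3"
            using h B by (auto simp: d_def field_simps)
          finally show ?thesis by (simp add: dist_norm)
        qed
        have "\<exists>z>0. z < 1 \<and> F (y + (1 * (h \<bullet> j)) *\<^sub>R j) - F (y + (0 * (h \<bullet> j)) *\<^sub>R j)
             = (1 - 0) * ((h \<bullet> j) * dpart [j] F (y + (z * (h \<bullet> j)) *\<^sub>R j))"
        proof (rule MVT2)
          fix t :: real assume t: "0 \<le> t" "t \<le> 1"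
          have "y + (t * (h \<bullet> j)) *\<^sub>R j \<in> U" using near[OF t] d3 by (auto simp: dist_commute)
          from smooth_on_open_has_partial[OF F j this]
          have "((\<lambda>t. F (y + t *\<^sub>R j)) has_real_derivative dpart [j] F (y + (t * (h \<bullet> j)) *\<^sub>R j))
              (at (t * (h \<bullet> j)))"
            by (rule has_partial_shift)
          moreover have "((\<lambda>t. t * (h \<bullet> j)) has_real_derivative h \<bullet> j) (at t)"
            by (auto intro!: derivative_eq_intros)
          ultimately have "((\<lambda>t. F (y + (t * (h \<bullet> j)) *\<^sub>R j)) has_real_derivative
              dpart [j] F (y + (t * (h \<bullet> j)) *\<^sub>R j) * (h \<bullet> j)) (at t)"
            by (rule DERIV_chain2)
          then show "((\<lambda>t. F (y + (t * (h \<bullet> j)) *\<^sub>R j)) has_real_derivative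
              (h \<bullet> j) * dpart [j] F (y + (t * (h \<bullet> j)) *\<^sub>R j)) (at t)"
            by (simp add: mult.commute)
        qed simp
        then obtain z where z: "0 < z" "z < 1"
          "F (y + (h \<bullet> j) *\<^sub>R j) - F y = (h \<bullet> j) * dpart [j] F (y + (z * (h \<bullet> j)) *\<^sub>R j)"
          by auto
        have p1: "\<bar>(h \<bullet> j) * (dpart [j] F (y + (z * (h \<bullet> j)) *\<^sub>R j) - dpart [j] F x)\<bar> \<le> e/2 * norm h"
          unfolding abs_mult
          using d2(2)[of "y + (z * (h \<bullet> j)) *\<^sub>R j"] near[of z] z Basis_le_norm[OF j, of h]
          by (subst mult.commute, intro mult_mono) (auto simp: dist_real_def)
        have p2: "\<bar>F y - F x - (\<Sum>i\<in>A. (h \<bullet> i) * dpart [i] F x)\<bar> \<le> e/2 * norm h"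
          unfolding y_def using d1(2)[of h] h by (simp add: d_def)
        have p3: "x + (\<Sum>i\<in>insert j A. (h \<bullet> i) *\<^sub>R i) = y + (h \<bullet> j) *\<^sub>R j"
          using A by (simp add: y_def algebra_simps)
        have p4: "F (y + (h \<bullet> j) *\<^sub>R j) - F x - (\<Sum>i\<in>insert j A. (h \<bullet> i) * dpart [i] F x)
            = (F y - F x - (\<Sum>i\<in>A. (h \<bullet> i) * dpart [i] F x))
              + (h \<bullet> j) * (dpart [j] F (y + (z * (h \<bullet> j)) *\<^sub>R j) - dpart [j] F x)"
          unfolding right_diff_distrib z(3)[symmetric] sum.insert[OF A(1,3)] by simp
        show ?thesis
          unfolding p3 p4 using abs_triangle_ineq[of "F y - F x - (\<Sum>i\<in>A. (h \<bullet> i) * dpart [i] F x)"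
              "(h \<bullet> j) * (dpart [j] F (y + (z * (h \<bullet> j)) *\<^sub>R j) - dpart [j] F x)"] p1 p2
          by (simp only: field_sum_of_halves flip: distrib_right)
      qed
      ultimately show "\<exists>d>0. \<forall>h. norm h < d \<longrightarrow>
        \<bar>F (x + (\<Sum>i\<in>insert j A. (h \<bullet> i) *\<^sub>R i)) - F x
          - (\<Sum>i\<in>insert j A. (h \<bullet> i) * dpart [i] F x)\<bar> \<le> e * norm h" by blast
    qed
  qed
  show ?thesis
    unfolding has_derivative_at_alt
  proof (intro conjI allI impI)
    show "bounded_linear (\<lambda>h. \<Sum>i\<in>Basis. (h \<bullet> i) * dpart [i] F x)"
      by (intro bounded_linear_sum bounded_linear_mult_const bounded_linear_inner_left)
    fix e :: real assume "0 < e"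
    then obtain d where d: "d > 0" "\<And>h. norm h < d \<Longrightarrow>
      \<bar>F (x + (\<Sum>i\<in>Basis. (h \<bullet> i) *\<^sub>R i)) - F x - (\<Sum>i\<in>Basis. (h \<bullet> i) * dpart [i] F x)\<bar> \<le> e * norm h"
      using aux[of Basis] by auto
    then show "\<exists>d>0. \<forall>y. norm (y - x) < d \<longrightarrow>
        norm (F y - F x - (\<Sum>i\<in>Basis. ((y - x) \<bullet> i) * dpart [i] F x)) \<le> e * norm (y - x)"
      using d(2)[of "y - x" for y] by (intro exI[of _ d]) (simp add: euclidean_representation)
  qed
qed

section \<open>Green identity on the sphere\<close>

lemma radext_scale: "c > 0 \<Longrightarrow> radext u (c *\<^sub>R x) = radext u x"
  by (simp add: radext_def field_simps)

lemma radext_Sn: "x \<in> Sn \<Longrightarrow> radext u x = u x"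
  by (simp add: radext_def Sn_def)

lemma sgn_in_Sn: "x \<noteq> 0 \<Longrightarrow> x /\<^sub>R norm x \<in> Sn"
  by (simp add: Sn_def)

lemma Sn_nonzero: "x \<in> Sn \<Longrightarrow> x \<noteq> 0"
  by (auto simp: Sn_def)

lemma sphere_smooth_continuous:
  assumes "sphere_smooth u"
  shows "continuous_on Sn u"
proof -
  have "continuous_on Sn (radext u)"
    using assms unfolding sphere_smooth_def
    by (rule continuous_on_subset[OF smooth_on_open_continuous]) (auto simp: Sn_def)
  then show ?thesis using continuous_on_cong[of Sn Sn u "radext u"] radext_Sn by metis
qed

lemma sphere_smooth_mult:
  assumes "sphere_smooth u" "sphere_smooth v"
  shows "sphere_smooth (\<lambda>x. u x * v x)"
  using smooth_on_open_mult[of "-{0}" "radext u" "radext v"] assms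
  by (simp add: sphere_smooth_def radext_def[abs_def] open_Compl)

text \<open>Differentiating the relation for one fixed \<open>c\<close> divides the factor by
  \<open>c\<close>, so the lemma can be applied to its own conclusion; \<open>lap_radext\<close>
  does this with the factors 1 and 1/c.\<close>

lemma dpart_scale:
  fixes F :: "'a::euclidean_space \<Rightarrow> real"
  assumes F: "smooth_on_open (-{0}) F" and hom: "\<And>x. x \<noteq> 0 \<Longrightarrow> F (c *\<^sub>R x) = K * F x"
    and c: "c > 0" and x: "x \<noteq> 0" and i: "i \<in> Basis"
  shows "dpart [i] F (c *\<^sub>R x) = K / c * dpart [i] F x"
proof -
  have p: "has_partial F i (dpart [i] F x) x"
    using smooth_on_open_has_partial[OF F i] x by simp
  have "((\<lambda>t. F (x + (t / c) *\<^sub>R i)) has_real_derivative dpart [i] F x * (1 / c)) (at 0)"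
    using p unfolding has_partial_def
    by (intro DERIV_chain2[where g = "\<lambda>t. t / c"]) (use c in \<open>auto intro!: derivative_eq_intros\<close>)
  then have "((\<lambda>t. K * F (x + (t / c) *\<^sub>R i)) has_real_derivative K * (dpart [i] F x * (1 / c))) (at 0)"
    by (rule DERIV_cmult)
  moreover have "\<forall>\<^sub>F t in nhds 0. K * F (x + (t / c) *\<^sub>R i) = F (c *\<^sub>R x + t *\<^sub>R i)"
  proof -
    have "continuous_on UNIV (\<lambda>t. x + (t / c) *\<^sub>R i)" using c by (intro continuous_intros) auto
    then have "open ((\<lambda>t. x + (t / c) *\<^sub>R i) -` (-{0}))" by (intro open_vimage) auto
    then have "\<forall>\<^sub>F t in nhds 0. t \<in> (\<lambda>t. x + (t / c) *\<^sub>R i) -` (-{0})"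
      using x by (intro eventually_nhds_in_open) auto
    then show ?thesis
      by eventually_elim (use c in \<open>simp flip: hom add: scaleR_add_right\<close>)
  qed
  ultimately have "has_partial F i (K * (dpart [i] F x * (1 / c))) (c *\<^sub>R x)"
    unfolding has_partial_def by (simp add: DERIV_cong_ev[OF refl _ refl])
  then show ?thesis using has_partial_imp_dpart by fastforce
qed

lemma dpart_dpart: "dpart [i, j] F = dpart [i] (dpart [j] F)"
  using dpart_append[of "[i]" "[j]" F] by simp

text \<open>Two derivatives of a 0-homogeneous function scale with degree -2. The factor
  \<open>x \<bullet> x\<close> is later absorbed into a radial cut-off.\<close>

lemma lap_radext:
  fixes u :: "'a::euclidean_space \<Rightarrow> real"
  assumes u: "sphere_smooth u" and x: "x \<noteq> 0"
  shows "sph_lap u (x /\<^sub>R norm x) = (x \<bullet> x) * lap (radext u) x"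
proof -
  have F: "smooth_on_open (-{0}) (radext u)" using u by (simp add: sphere_smooth_def)
  let ?c = "inverse (norm x)"
  have c: "?c > 0" using x by simp
  have 1: "dpart [i] (radext u) (?c *\<^sub>R y) = 1 / ?c * dpart [i] (radext u) y" if "y \<noteq> 0" "i \<in> Basis" for i y
    using dpart_scale[OF F _ c that] radext_scale[OF c] by (metis mult_1)
  have 2: "dpart [i,i] (radext u) (?c *\<^sub>R x) = (x \<bullet> x) * dpart [i,i] (radext u) x" if "i \<in> Basis" for i
    unfolding dpart_dpart
    using dpart_scale[OF smooth_on_open_dpart[OF F, of "[i]"] 1 c x, of i] that x
    by (simp add: power2_norm_eq_inner[symmetric] power2_eq_square field_simps)
  show ?thesis unfolding sph_lap_def lap_def by (simp add: 2 sum_distrib_left)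
qed

lemma smooth_on_open_lap:
  fixes F :: "'a::euclidean_space \<Rightarrow> real"
  assumes "open U" "smooth_on_open U F"
  shows "smooth_on_open U (lap F)"
proof -
  have "smooth_on_open U (\<lambda>x. \<Sum>i\<in>Basis. dpart [i, i] F x)"
    using assms by (intro smooth_on_open_sum smooth_on_open_dpart[of U F "[i, i]" for i]) auto
  then show ?thesis by (simp add: lap_def[abs_def])
qed

lemma sphere_smooth_sph_lap:
  fixes u :: "'a::euclidean_space \<Rightarrow> real"
  assumes u: "sphere_smooth u"
  shows "sphere_smooth (sph_lap u)"
  unfolding sphere_smooth_def
proof (rule smooth_on_open_cong)
  show "smooth_on_open (-{0}) (\<lambda>x. (x \<bullet> x) powr 1 * lap (radext u) x)"
    using u unfolding sphere_smooth_def
    by (intro smooth_on_open_mult smooth_on_open_inner_self_powr smooth_on_open_lap) auto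
  show "(x \<bullet> x) powr 1 * lap (radext u) x = radext (sph_lap u) x" if "x \<in> - {0}" for x
    using that lap_radext[OF u, of x] by (simp add: radext_def)
qed auto

text \<open>The function is constant along the ray through \<open>x\<close>. The radial direction is
  not a coordinate direction, hence the appeal to the total derivative.\<close>

lemma radext_euler:
  fixes u :: "'a::euclidean_space \<Rightarrow> real"
  assumes u: "sphere_smooth u" and x: "x \<noteq> 0"
  shows "(\<Sum>i\<in>Basis. (x \<bullet> i) * dpart [i] (radext u) x) = 0"
proof -
  have "(radext u has_derivative (\<lambda>h. \<Sum>i\<in>Basis. (h \<bullet> i) * dpart [i] (radext u) x)) (at x)"
    using u x by (intro smooth_on_open_has_derivative[of "-{0}"]) (auto simp: sphere_smooth_def)
  moreover have "((\<lambda>t::real. x + t *\<^sub>R x) has_derivative (\<lambda>t. t *\<^sub>R x)) (at 0)"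
    by (auto intro!: derivative_eq_intros)
  ultimately have "((\<lambda>t. radext u (x + t *\<^sub>R x)) has_derivative
      (\<lambda>t. \<Sum>i\<in>Basis. ((t *\<^sub>R x) \<bullet> i) * dpart [i] (radext u) x)) (at 0)"
    using has_derivative_compose[of "\<lambda>t::real. x + t *\<^sub>R x" "\<lambda>t. t *\<^sub>R x" 0 UNIV "radext u"
        "\<lambda>h. \<Sum>i\<in>Basis. (h \<bullet> i) * dpart [i] (radext u) x"] by simp
  then have 1: "((\<lambda>t. radext u (x + t *\<^sub>R x)) has_real_derivative
      (\<Sum>i\<in>Basis. (x \<bullet> i) * dpart [i] (radext u) x)) (at 0)"
    unfolding has_field_derivative_def
    by (rule back_subst[where P = "\<lambda>g. (_ has_derivative g) _"])
      (simp add: fun_eq_iff sum_distrib_left sum_distrib_right mult_ac)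
  have "\<forall>\<^sub>F t::real in nhds 0. t \<in> {-1<..}"
    by (intro eventually_nhds_in_open) auto
  then have 2: "\<forall>\<^sub>F t in nhds 0. radext u (x + t *\<^sub>R x) = radext u x"
  proof eventually_elim
    case (elim t)
    have "x + t *\<^sub>R x = (1 + t) *\<^sub>R x" by (simp add: algebra_simps)
    then show ?case using elim radext_scale[of "1 + t" u x] by simp
  qed
  have "((\<lambda>t. radext u (x + t *\<^sub>R x)) has_real_derivative 0) (at 0)"
    using DERIV_cong_ev[OF refl 2 refl] by simp
  then show ?thesis using 1 DERIV_unique by blast
qed

text \<open>By translation invariance every difference quotient has integral zero.\<close>
lemma integral_partial_eq_0:
  fixes F :: "'a::euclidean_space \<Rightarrow> real"
  assumes F': "\<And>x. has_partial F v (F' x) x" and B: "\<And>x. \<bar>F' x\<bar> \<le> B"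
    and cont: "continuous_on UNIV F" and supp: "\<And>x. norm x > R \<Longrightarrow> F x = 0"
  shows "integrable lborel F' \<and> integral\<^sup>L lborel F' = 0"
proof -
  have meas [measurable]: "F \<in> borel_measurable borel"
    using cont by (rule borel_measurable_continuous_onI)
  have "integrable lborel (\<lambda>x. indicator (cball 0 R) x *\<^sub>R F x)"
    by (intro borel_integrable_compact continuous_on_subset[OF cont]) auto
  moreover have "(\<lambda>x. indicator (cball 0 R) x *\<^sub>R F x) = F"
    using supp by (auto simp: indicator_def fun_eq_iff not_le)
  ultimately have int: "integrable lborel F" by simp
  define h where "h n = inverse (real (Suc n))" for n
  have h: "0 < h n" "h n \<le> 1" for n by (auto simp: h_def field_simps)
  have hlim: "h \<longlonglongrightarrow> 0" unfolding h_def by (rule LIMSEQ_inverse_real_of_nat)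
  define D where "D n x = (F (x + h n *\<^sub>R v) - F x) / h n" for n x
  have trans: "integrable lborel (\<lambda>x. F (x + a))" "(LINT x|lborel. F (x + a)) = integral\<^sup>L lborel F" for a
  proof -
    have "distr lborel borel ((+) a) = (lborel :: 'a measure)" by (rule lborel_distr_plus)
    then have "integrable (distr lborel borel ((+) a)) F"
        "integral\<^sup>L (distr lborel borel ((+) a)) F = integral\<^sup>L lborel F" using int by simp_all
    then show "integrable lborel (\<lambda>x. F (x + a))" "(LINT x|lborel. F (x + a)) = integral\<^sup>L lborel F"
      by (simp_all add: integrable_distr_eq integral_distr add.commute)
  qed
  have D0: "integral\<^sup>L lborel (D n) = 0" for n
    unfolding D_def using trans int by simp
  \<comment> \<open>Steps \<open>h n\<close> of length at most 1 keep all difference quotients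
    supported in one ball, where the mean value theorem bounds them by \<open>B\<close>.\<close>
  have bound: "\<bar>D n x\<bar> \<le> B * indicator (cball 0 (R + norm v)) x" for n x
  proof (cases "norm x \<le> R + norm v")
    case True
    have "\<exists>z>0. z < h n \<and> F (x + h n *\<^sub>R v) - F (x + 0 *\<^sub>R v) = (h n - 0) * F' (x + z *\<^sub>R v)"
      using h by (intro MVT2 has_partial_shift F')
    then obtain z where "F (x + h n *\<^sub>R v) - F x = h n * F' (x + z *\<^sub>R v)" by auto
    then have "D n x = F' (x + z *\<^sub>R v)" using h(1)[of n] by (simp add: D_def)
    then show ?thesis using True B by simp
  next
    case False
    have "norm (x + h n *\<^sub>R v) \<ge> norm x - norm (h n *\<^sub>R v)"
      using norm_diff_ineq[of x "h n *\<^sub>R v"] by simp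
    moreover have "norm (h n *\<^sub>R v) \<le> norm v"
      using h[of n] by (simp add: mult_left_le_one_le)
    moreover have "norm x > R" using False norm_ge_zero[of v] by linarith
    ultimately show ?thesis using False supp[of x] supp[of "x + h n *\<^sub>R v"]
      by (simp add: D_def)
  qed
  have lim: "(\<lambda>n. D n x) \<longlonglongrightarrow> F' x" for x
  proof -
    have "((\<lambda>t. (F (x + t *\<^sub>R v) - F x) / t) \<longlongrightarrow> F' x) (at 0)"
      using F'[of x] by (simp add: has_partial_def DERIV_def)
    moreover have "filterlim h (at 0) sequentially"
      using hlim h by (auto simp: filterlim_at intro!: always_eventually) (metis less_irrefl)
    ultimately show ?thesis unfolding D_def by (rule filterlim_compose)
  qed
  have Dm: "D n \<in> borel_measurable lborel" for n
    unfolding D_def by measurable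
  have F'm: "F' \<in> borel_measurable lborel"
    by (rule borel_measurable_LIMSEQ_real[OF lim Dm])
  have w: "integrable lborel (\<lambda>x::'a. B * indicator (cball 0 (R + norm v)) x)"
    using integrable_real_indicator[of "cball 0 (R + norm v)" "lborel :: 'a measure"]
      emeasure_lborel_cball_finite[of "0::'a" "R + norm v"] by (intro integrable_mult_right) simp
  have "integrable lborel F'"
    by (rule integrable_dominated_convergence[where s = D, OF F'm Dm w])
      (use lim bound in auto)
  moreover have "(\<lambda>n. integral\<^sup>L lborel (D n)) \<longlonglongrightarrow> integral\<^sup>L lborel F'"
    by (rule integral_dominated_convergence[where s = D, OF F'm Dm w])
      (use lim bound in auto)
  ultimately show ?thesis using D0 LIMSEQ_unique[OF _ tendsto_const] by simp
qed

section \<open>Green's formula by radial cut-offs\<close>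

lemma radial_measurable:
  fixes h :: "'a::euclidean_space \<Rightarrow> real"
  assumes "continuous_on Sn h"
  shows "(\<lambda>x. h (x /\<^sub>R norm x)) \<in> borel_measurable borel"
proof (rule borel_measurable_continuous_countable_exceptions[of "{0}"])
  show "continuous_on (- {0}) (\<lambda>x. h (x /\<^sub>R norm x))"
    by (rule continuous_on_compose2[OF assms]) (auto intro!: continuous_intros sgn_in_Sn)
qed auto

lemma Sn_bounded_image:
  fixes h :: "'a::euclidean_space \<Rightarrow> real"
  assumes "continuous_on Sn h"
  obtains C where "C \<ge> 0" "\<And>x. x \<in> Sn \<Longrightarrow> \<bar>h x\<bar> \<le> C"
proof -
  have "compact (h ` Sn)" using assms by (intro compact_continuous_image) (auto simp: Sn_def)
  then obtain C where "\<forall>y \<in> h ` Sn. norm y \<le> C" using compact_imp_bounded bounded_iff by blast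
  then show ?thesis using that[of "max C 0"] by force
qed

text \<open>Raw material of the cut-offs: squaring the positive part makes it C^1 while it still
  vanishes on a half-line.\<close>

lemma has_real_derivative_max_0_power2:
  "((\<lambda>a::real. (max 0 a)\<^sup>2) has_real_derivative 2 * max 0 a) (at a)"
proof -
  consider "a > 0" | "a < 0" | "a = 0" by linarith
  then show ?thesis
  proof cases
    case 1
    have "\<forall>\<^sub>F x in nhds a. x \<in> {0<..}" using 1 by (intro eventually_nhds_in_open) auto
    then have "\<forall>\<^sub>F x in nhds a. (max 0 x)\<^sup>2 = x\<^sup>2" by eventually_elim auto
    from DERIV_cong_ev[OF refl this refl] show ?thesis using 1
      by (auto intro!: derivative_eq_intros)
  next
    case 2
    have "\<forall>\<^sub>F x in nhds a. x \<in> {..<0}" using 2 by (intro eventually_nhds_in_open) auto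
    then have "\<forall>\<^sub>F x in nhds a. (max 0 x)\<^sup>2 = 0" by eventually_elim auto
    from DERIV_cong_ev[OF refl this refl] show ?thesis using 2
      by (auto intro!: derivative_eq_intros)
  next
    case 3
    have "((\<lambda>h::real. (max 0 h)\<^sup>2 / h) \<longlongrightarrow> 0) (at 0)"
    proof (rule tendsto_rabs_zero_cancel, rule real_tendsto_sandwich[where f = "\<lambda>_. 0" and h = "\<lambda>h. \<bar>h\<bar>"])
      show "\<forall>\<^sub>F h::real in at 0. \<bar>(max 0 h)\<^sup>2 / h\<bar> \<le> \<bar>h\<bar>"
        by (auto intro!: always_eventually simp: max_def power2_eq_square)
    qed (auto intro!: tendsto_eq_intros)
    then show ?thesis using 3 by (simp add: DERIV_def)
  qed
qed

text \<open>The divergence of \<theta> (w grad y - y grad w) is \<theta> (w lap y - y lap w) plus 2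
  \<theta>' times the inner product of x with the field, which the Euler relations make zero. A
  cut-off vanishing near the origin hides the singularity of the functions there.\<close>

lemma green_cutoff:
  fixes y w :: "'a::euclidean_space \<Rightarrow> real"
  assumes y: "smooth_on_open (-{0}) y" and w: "smooth_on_open (-{0}) w"
    and ey: "\<And>x. x \<noteq> 0 \<Longrightarrow> (\<Sum>i\<in>Basis. (x \<bullet> i) * dpart [i] y x) = 0"
    and ew: "\<And>x. x \<noteq> 0 \<Longrightarrow> (\<Sum>i\<in>Basis. (x \<bullet> i) * dpart [i] w x) = 0"
    and \<theta>: "\<And>t. (\<theta> has_real_derivative \<theta>' t) (at t)" and \<theta>': "continuous_on UNIV \<theta>'"
    and supp: "\<And>t. t \<le> a \<or> t \<ge> b \<Longrightarrow> \<theta> t = 0" "\<And>t. t \<le> a \<or> t \<ge> b \<Longrightarrow> \<theta>' t = 0" and a: "0 < a"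
  shows "(LINT x|lborel. \<theta> (x \<bullet> x) * (w x * lap y x - y x * lap w x)) = 0"
proof -
  define F where "F i x = \<theta> (x \<bullet> x) * (w x * dpart [i] y x - y x * dpart [i] w x)" for i x
  \<comment> \<open>The products of first derivatives of \<open>w\<close> and \<open>y\<close> have
    already cancelled here.\<close>
  define F' where "F' i x = 2 * \<theta>' (x \<bullet> x) * (x \<bullet> i) * (w x * dpart [i] y x - y x * dpart [i] w x)
     + \<theta> (x \<bullet> x) * (w x * dpart [i, i] y x - y x * dpart [i, i] w x)" for i x
  have c\<theta>: "continuous_on UNIV \<theta>" using \<theta> by (meson DERIV_isCont continuous_at_imp_continuous_on)
  have near0: "ball 0 (sqrt a) \<subseteq> {x::'a. x \<bullet> x < a}"
    using a real_sqrt_less_iff by (auto simp: norm_eq_sqrt_inner)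
  have cF: "continuous_on UNIV (F i)" and hp: "\<And>x. has_partial (F i) i (F' i x) x"
    and bd: "\<exists>B. \<forall>x. \<bar>F' i x\<bar> \<le> B" if i: "i \<in> Basis" for i
  proof -
    have s: "continuous_on (-{0}) y" "continuous_on (-{0}) w"
      "continuous_on (-{0}) (dpart [i] y)" "continuous_on (-{0}) (dpart [i] w)"
      "continuous_on (-{0}) (dpart [i, i] y)" "continuous_on (-{0}) (dpart [i, i] w)"
      using i by (auto intro!: smooth_on_open_continuous smooth_on_open_dpart y w)
    have c\<theta>2: "continuous_on S (\<lambda>x. \<theta> (x \<bullet> x))" "continuous_on S (\<lambda>x. \<theta>' (x \<bullet> x))" for S :: "'a set"
      by (auto intro!: continuous_on_compose2[OF c\<theta>] continuous_on_compose2[OF \<theta>'] continuous_intros)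
    have "continuous_on (-{0}) (F i)"
      unfolding F_def by (intro continuous_intros c\<theta>2 s)
    moreover have "continuous_on (ball 0 (sqrt a)) (F i)"
      using near0 supp(1) by (subst continuous_on_cong[OF refl, of _ _ "\<lambda>_. 0"]) (auto simp: F_def)
    ultimately have "continuous_on (-{0} \<union> ball 0 (sqrt a)) (F i)"
      by (intro continuous_on_open_Un) auto
    moreover have "-{0} \<union> ball 0 (sqrt a) = (UNIV :: 'a set)" using a by auto
    ultimately show "continuous_on UNIV (F i)" by simp
    show "has_partial (F i) i (F' i x) x" for x
    proof (cases "x = 0")
      case False
      have px: "has_partial y i (dpart [i] y x) x" "has_partial w i (dpart [i] w x) x"
        "has_partial (dpart [i] y) i (dpart [i,i] y x) x" "has_partial (dpart [i] w) i (dpart [i,i] w x) x"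
        using False i smooth_on_open_dpart[OF y, of "[i]"] smooth_on_open_dpart[OF w, of "[i]"] y w
        unfolding dpart_dpart by (auto intro!: smooth_on_open_has_partial)
      have "has_partial (\<lambda>x. \<theta> (x \<bullet> x) * (w x * dpart [i] y x + (-1) * (y x * dpart [i] w x))) i
         (\<theta>' (x \<bullet> x) * (2 * (x \<bullet> i)) * (w x * dpart [i] y x + (-1) * (y x * dpart [i] w x)) +
          \<theta> (x \<bullet> x) * ((dpart [i] w x * dpart [i] y x + w x * dpart [i,i] y x)
             + (-1) * (dpart [i] y x * dpart [i] w x + y x * dpart [i,i] w x))) x"
        by (intro has_partial_mult has_partial_add has_partial_cmult px
            has_partial_chain[OF has_partial_inner_self \<theta>])
      then show ?thesis by (simp add: F_def[abs_def] F'_def algebra_simps)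
    next
      case True
      have "has_partial (F i) i 0 x"
        by (rule has_partial_cong_open[where U = "ball 0 (sqrt a)" and F = "\<lambda>_. 0"])
          (use near0 supp(1) True a in \<open>auto simp: F_def intro: has_partial_const\<close>)
      then show ?thesis using True a supp by (simp add: F'_def)
    qed
    \<comment> \<open>A bound on a compact shell suffices, since \<open>F' i\<close> vanishes
      wherever \<open>x \<bullet> x\<close> lies outside the open interval from \<open>a\<close> to
      \<open>b\<close>.\<close>
    have "continuous_on (-{0}) (F' i)"
      unfolding F'_def by (intro continuous_intros c\<theta>2 s)
    then have "continuous_on (cball 0 (sqrt \<bar>b\<bar>) - ball 0 (sqrt a)) (F' i)"
      by (rule continuous_on_subset) (use a in auto)
    then have "bounded (F' i ` (cball 0 (sqrt \<bar>b\<bar>) - ball 0 (sqrt a)))"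
      by (intro compact_imp_bounded compact_continuous_image compact_diff) auto
    then obtain B where B: "\<And>x. x \<in> cball 0 (sqrt \<bar>b\<bar>) - ball 0 (sqrt a) \<Longrightarrow> \<bar>F' i x\<bar> \<le> B"
      unfolding bounded_iff ball_simps real_norm_def by blast
    have "\<bar>F' i x\<bar> \<le> max B 0" for x
    proof (cases "x \<in> cball 0 (sqrt \<bar>b\<bar>) - ball 0 (sqrt a)")
      case False
      then have "x \<bullet> x \<le> a \<or> x \<bullet> x \<ge> b"
        by (auto simp: norm_eq_sqrt_inner not_le)
      then show ?thesis using supp by (simp add: F'_def)
    qed (use B in force)
    then show "\<exists>B. \<forall>x. \<bar>F' i x\<bar> \<le> B" by blast
  qed
  have suppF: "F i x = 0" if "norm x > sqrt \<bar>b\<bar>" for i x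
    using that supp(1)[of "x \<bullet> x"] abs_ge_self[of b] by (auto simp: norm_eq_sqrt_inner F_def)
  have I: "integrable lborel (F' i) \<and> integral\<^sup>L lborel (F' i) = 0" if i: "i \<in> Basis" for i
  proof -
    obtain B where "\<And>x. \<bar>F' i x\<bar> \<le> B" using bd[OF i] by blast
    then show ?thesis
      using integral_partial_eq_0[of "F i" i "F' i" B "sqrt \<bar>b\<bar>"] hp[OF i] cF[OF i] suppF by blast
  qed
  have "\<theta> (x \<bullet> x) * (w x * lap y x - y x * lap w x) = (\<Sum>i\<in>Basis. F' i x)" for x
  proof (cases "x = 0")
    case True
    then show ?thesis using supp a by (simp add: F'_def)
  next
    case False
    have "(\<Sum>i\<in>Basis. F' i x) = 2 * \<theta>' (x \<bullet> x) * (w x * (\<Sum>i\<in>Basis. (x \<bullet> i) * dpart [i] y x)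
         - y x * (\<Sum>i\<in>Basis. (x \<bullet> i) * dpart [i] w x))
       + \<theta> (x \<bullet> x) * (w x * lap y x - y x * lap w x)"
      unfolding F'_def lap_def sum.distrib sum_distrib_left right_diff_distrib sum_subtractf
      by (simp add: algebra_simps)
    then show ?thesis using ey ew False by simp
  qed
  then have "(LINT x|lborel. \<theta> (x \<bullet> x) * (w x * lap y x - y x * lap w x))
     = (LINT x|lborel. (\<Sum>i\<in>Basis. F' i x))" by simp
  also have "\<dots> = (\<Sum>i\<in>Basis. integral\<^sup>L lborel (F' i))"
    using I by (intro Bochner_Integration.integral_sum) auto
  finally show ?thesis using I by simp
qed


text \<open>The field \<open>w \<nabla>y - y \<nabla>w\<close> of two 0-homogeneous functions is orthogonal to \<open>x\<close>, so radial
  cut-offs do not contribute to its divergence; they are chosen to exhaust the punctured ball.\<close>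
lemma sint_green:
  fixes Y W :: "'a::euclidean_space \<Rightarrow> real"
  assumes Y: "sphere_smooth Y" and W: "sphere_smooth W"
  shows "sint (\<lambda>y. W y * sph_lap Y y) = sint (\<lambda>y. Y y * sph_lap W y)"
proof -
  define h where "h y = W y * sph_lap Y y - Y y * sph_lap W y" for y :: 'a
  note cts = sphere_smooth_continuous[OF Y] sphere_smooth_continuous[OF W]
    sphere_smooth_continuous[OF sphere_smooth_sph_lap[OF Y]]
    sphere_smooth_continuous[OF sphere_smooth_sph_lap[OF W]]
  have ch: "continuous_on Sn h" unfolding h_def by (intro continuous_intros cts)
  \<comment> \<open>With t = |x|^2, \<open>p d\<close> vanishes unless d < t < 1, and
    \<open>q d\<close> is a C^1 cut-off with values in [0, 1] that tends to 1 on 0 < t < 1 as d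
    decreases to 0; \<open>q'\<close> is its derivative after simplifying the quotient rule.\<close>
  define p where "p d t = max 0 (t * (1 - t) - d)" for d t :: real
  define q where "q d t = (p d t)\<^sup>2 / ((p d t)\<^sup>2 + d)" for d t :: real
  define q' where "q' d t = d * (2 * p d t * (1 - 2 * t)) / ((p d t)\<^sup>2 + d)\<^sup>2" for d t :: real
  have p0: "p d t = 0" if "t \<le> d \<or> t \<ge> 1" "d > 0" for d t
  proof -
    have "t * (1 - t) \<le> d"
    proof (cases "0 \<le> t \<and> t < 1")
      case True
      then have "t * (1 - t) \<le> t" by (simp add: mult_left_le)
      then show ?thesis using that True by linarith
    next
      case False
      then have "t * (1 - t) \<le> 0" by (auto simp: mult_le_0_iff)
      then show ?thesis using that by linarith
    qed
    then show ?thesis by (simp add: p_def)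
  qed
  have dp: "((\<lambda>t. (p d t)\<^sup>2) has_real_derivative 2 * p d t * (1 - 2 * t)) (at t)" for d t
    unfolding p_def
    by (rule DERIV_chain2[OF has_real_derivative_max_0_power2]) (auto intro!: derivative_eq_intros)
  have dq: "(q d has_real_derivative q' d t) (at t)" if "d > 0" for d t
  proof -
    have pos: "(p d t)\<^sup>2 + d \<noteq> 0" using that by (smt (verit) zero_le_power2)
    have "((\<lambda>t. (p d t)\<^sup>2 / ((p d t)\<^sup>2 + d)) has_real_derivative
      (2 * p d t * (1 - 2 * t) * ((p d t)\<^sup>2 + d) - (p d t)\<^sup>2 * (2 * p d t * (1 - 2 * t) + 0))
        / (((p d t)\<^sup>2 + d) * ((p d t)\<^sup>2 + d))) (at t)"
      by (intro DERIV_divide DERIV_add dp DERIV_const pos)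
    then show ?thesis
      unfolding q_def q'_def by (rule back_subst) (simp add: power2_eq_square algebra_simps)
  qed
  have cp: "continuous_on UNIV (p d)" for d
    unfolding p_def by (intro continuous_intros)
  have cq: "continuous_on UNIV (q d)" "continuous_on UNIV (q' d)" if "d > 0" for d
  proof -
    have pos: "(p d t)\<^sup>2 + d \<noteq> 0" for t using that by (smt (verit) zero_le_power2)
    show "continuous_on UNIV (q d)" "continuous_on UNIV (q' d)"
      unfolding q_def q'_def using pos by (auto intro!: continuous_intros cp)
  qed
  have q01: "0 \<le> q d t" "q d t \<le> 1" if "d > 0" for d t
    using that by (auto simp: q_def divide_le_eq add_nonneg_pos intro!: divide_nonneg_pos)
  have q0: "q d t = 0" "q' d t = 0" if "t \<le> d \<or> t \<ge> 1" "d > 0" for d t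
    using p0[OF that] by (simp_all add: q_def q'_def)
  have sy: "smooth_on_open (-{0}) (radext Y)" "smooth_on_open (-{0}) (radext W)"
    using Y W by (simp_all add: sphere_smooth_def)
  \<comment> \<open>The extra factor t is the |x|^2 that turns Euclidean Laplacians of the
    extensions into spherical ones.\<close>
  have conv: "(t * q d t) * (radext W x * lap (radext Y) x - radext Y x * lap (radext W) x)
      = q d t * h (x /\<^sub>R norm x)" if "t = x \<bullet> x" "d > 0" for d t x
  proof (cases "x = 0")
    case True
    then show ?thesis using that q0 by simp
  next
    case False
    show ?thesis unfolding h_def lap_radext[OF Y False] lap_radext[OF W False]
      by (simp add: that(1) radext_def algebra_simps)
  qed
  define e where "e n = inverse (real (Suc n))" for n
  have e: "e n > 0" for n by (simp add: e_def)
  have z: "(LINT x|lborel. q (e n) (x \<bullet> x) * h (x /\<^sub>R norm x)) = 0" for n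
  proof -
    have "(LINT x|lborel. ((x \<bullet> x) * q (e n) (x \<bullet> x))
        * (radext W x * lap (radext Y) x - radext Y x * lap (radext W) x)) = 0"
    proof (rule green_cutoff[where \<theta> = "\<lambda>t. t * q (e n) t" and \<theta>' = "\<lambda>t. q (e n) t + t * q' (e n) t"
          and a = "e n" and b = 1])
      show "((\<lambda>t. t * q (e n) t) has_real_derivative q (e n) t + t * q' (e n) t) (at t)" for t
        using dq[OF e, of n] by (auto intro!: derivative_eq_intros)
      show "continuous_on UNIV (\<lambda>t. q (e n) t + t * q' (e n) t)"
        by (intro continuous_intros cq e)
    qed (use sy radext_euler[OF Y] radext_euler[OF W] q0 e in auto)
    then show ?thesis using conv[OF refl e] by simp
  qed
  have qlim: "(\<lambda>n. q (e n) t) \<longlonglongrightarrow> 1" if "0 < t" "t < 1" for t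
  proof -
    have elim: "e \<longlonglongrightarrow> 0" unfolding e_def by (rule LIMSEQ_inverse_real_of_nat)
    have pos: "t * (1 - t) > 0" using that by simp
    have "(\<lambda>n. p (e n) t) \<longlonglongrightarrow> max 0 (t * (1 - t) - 0)"
      unfolding p_def by (intro tendsto_intros elim)
    then have "(\<lambda>n. p (e n) t) \<longlonglongrightarrow> t * (1 - t)" using pos by (simp add: max_def)
    then have "(\<lambda>n. q (e n) t) \<longlonglongrightarrow> (t * (1 - t))\<^sup>2 / ((t * (1 - t))\<^sup>2 + 0)"
      unfolding q_def using pos by (intro tendsto_intros elim) auto
    then show ?thesis using that by simp
  qed
  obtain C where C: "C \<ge> 0" "\<And>x. x \<in> Sn \<Longrightarrow> \<bar>h x\<bar> \<le> C" using Sn_bounded_image[OF ch] by blast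
  have qm: "(\<lambda>x::'a. q (e n) (x \<bullet> x)) \<in> borel_measurable borel" for n
    by (intro borel_measurable_continuous_onI continuous_on_compose2[OF cq(1)[OF e]] continuous_intros) auto
  have "(\<lambda>n. LINT x|lborel. q (e n) (x \<bullet> x) * h (x /\<^sub>R norm x)) \<longlonglongrightarrow>
     (LINT x|lborel. indicator (ball 0 1) x * h (x /\<^sub>R norm x))"
  proof (rule integral_dominated_convergence[where w = "\<lambda>x. C * indicator (ball 0 1) x"])
    show "integrable lborel (\<lambda>x::'a. C * indicator (ball 0 1) x)"
      using integrable_real_indicator[of "ball 0 1" "lborel :: 'a measure"]
        emeasure_lborel_ball_finite[of "0::'a" 1] by (intro integrable_mult_right) simp
    have n0: "AE x in lborel. x \<noteq> (0::'a)" by (rule AE_lborel_singleton)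
    then show "AE x in lborel. (\<lambda>n. q (e n) (x \<bullet> x) * h (x /\<^sub>R norm x)) \<longlonglongrightarrow>
       indicator (ball 0 1) x * h (x /\<^sub>R norm x)"
    proof eventually_elim
      case (elim x)
      show ?case
      proof (cases "norm x < 1")
        case True
        then have "x \<bullet> x < 1" "x \<bullet> x > 0" using elim by (auto simp: norm_eq_sqrt_inner)
        then show ?thesis using True tendsto_mult_right[OF qlim, of "x \<bullet> x" "h (x /\<^sub>R norm x)"] by simp
      next
        case False
        then have "x \<bullet> x \<ge> 1" by (simp add: norm_eq_sqrt_inner)
        then show ?thesis using q0(1)[OF _ e] False by simp
      qed
    qed
    show "AE x in lborel. norm (q (e n) (x \<bullet> x) * h (x /\<^sub>R norm x)) \<le> C * indicator (ball 0 1) x" for n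
      using n0
    proof eventually_elim
      case (elim x)
      show ?case
      proof (cases "norm x < 1")
        case True
        then show ?thesis using q01[OF e, of n "x \<bullet> x"] C(2)[OF sgn_in_Sn[OF elim]]
          mult_mono[of "q (e n) (x \<bullet> x)" 1 "\<bar>h (x /\<^sub>R norm x)\<bar>" C] by (simp add: abs_mult)
      next
        case False
        then have "x \<bullet> x \<ge> 1" by (simp add: norm_eq_sqrt_inner)
        then show ?thesis using q0(1)[OF _ e] False by simp
      qed
    qed
  qed (use radial_measurable[OF ch] qm in \<open>auto intro!: borel_measurable_times borel_measurable_indicator\<close>)
  then have h0: "(LINT x|lborel. indicator (ball 0 1) x * h (x /\<^sub>R norm x)) = 0"
    using z LIMSEQ_unique[OF _ tendsto_const] by simp
  have int: "integrable lborel (\<lambda>x. indicator (ball 0 1) x * g (x /\<^sub>R norm x))"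
    if g: "continuous_on Sn g" for g :: "'a \<Rightarrow> real"
  proof -
    obtain C where C: "C \<ge> 0" "\<And>x. x \<in> Sn \<Longrightarrow> \<bar>g x\<bar> \<le> C" using Sn_bounded_image[OF g] by blast
    have "integrable lborel (\<lambda>x::'a. C * indicator (ball 0 1) x)"
      using integrable_real_indicator[of "ball 0 1" "lborel :: 'a measure"]
        emeasure_lborel_ball_finite[of "0::'a" 1] by (intro integrable_mult_right) simp
    moreover have "AE x in lborel. norm (indicator (ball 0 1) x * g (x /\<^sub>R norm x))
        \<le> norm (C * indicator (ball (0::'a) 1) x)"
      using AE_lborel_singleton[of "0::'a"]
    proof eventually_elim
      case (elim x)
      show ?case using C(1) C(2)[OF sgn_in_Sn[OF elim]] by (auto simp: indicator_def)
    qed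
    moreover have "(\<lambda>x. indicator (ball 0 1) x * g (x /\<^sub>R norm x)) \<in> borel_measurable lborel"
      using radial_measurable[OF g] by (auto intro!: borel_measurable_times borel_measurable_indicator)
    ultimately show ?thesis using Bochner_Integration.integrable_bound by blast
  qed
  have "continuous_on Sn (\<lambda>y. W y * sph_lap Y y)" "continuous_on Sn (\<lambda>y. Y y * sph_lap W y)"
    by (intro continuous_intros cts)+
  from Bochner_Integration.integral_diff[OF int[OF this(1)] int[OF this(2)]] h0
  show ?thesis
    unfolding sint_def set_lebesgue_integral_def h_def by (simp add: algebra_simps)
qed

section \<open>Gegenbauer polynomials\<close>

text \<open>Formal polynomials, so that derivatives are \<open>pderiv\<close> and a zonal function
  expands into finitely many monomials in the coordinates.\<close>

fun gegenbauer :: "real \<Rightarrow> nat \<Rightarrow> real poly" where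
  "gegenbauer l 0 = 1"
| "gegenbauer l (Suc 0) = [:0, 2 * l:]"
| "gegenbauer l (Suc (Suc k)) = smult (1 / (real k + 2))
     (smult (2 * (real k + 1 + l)) ([:0, 1:] * gegenbauer l (Suc k)) - smult (real k + 2 * l) (gegenbauer l k))"

lemma gegenbauer_rec:
  "(real k + 2) * poly (gegenbauer l (Suc (Suc k))) t =
     2 * (real k + 1 + l) * t * poly (gegenbauer l (Suc k)) t - (real k + 2 * l) * poly (gegenbauer l k) t"
  by simp

lemma gegenbauer_rec_deriv:
  "(real k + 2) * poly (pderiv (gegenbauer l (Suc (Suc k)))) t =
     2 * (real k + 1 + l) * (poly (gegenbauer l (Suc k)) t + t * poly (pderiv (gegenbauer l (Suc k))) t)
       - (real k + 2 * l) * poly (pderiv (gegenbauer l k)) t"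
proof -
  have "smult (real k + 2) (gegenbauer l (Suc (Suc k))) =
     smult (2 * (real k + 1 + l)) ([:0, 1:] * gegenbauer l (Suc k)) - smult (real k + 2 * l) (gegenbauer l k)"
    by simp
  then have "poly (pderiv (smult (real k + 2) (gegenbauer l (Suc (Suc k))))) t =
     poly (pderiv (smult (2 * (real k + 1 + l)) ([:0, 1:] * gegenbauer l (Suc k))
       - smult (real k + 2 * l) (gegenbauer l k))) t"
    by (rule arg_cong)
  then show ?thesis
    by (simp add: pderiv_smult pderiv_diff pderiv_mult pderiv_pCons del: mult_pCons_left gegenbauer.simps)
qed

text \<open>The identities support each other in the induction: the new second one comes from the
  old first one and the differentiated recurrence, the new first one from the old pair, the new
  second one and the recurrence itself.\<close>

lemma gegenbauer_deriv_identities: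
  "(real k + 1) * poly (gegenbauer l (Suc k)) t
     = t * poly (pderiv (gegenbauer l (Suc k))) t - poly (pderiv (gegenbauer l k)) t
   \<and> (real k + 2 * l) * poly (gegenbauer l k) t
     = poly (pderiv (gegenbauer l (Suc k))) t - t * poly (pderiv (gegenbauer l k)) t"
proof (induction k)
  case 0
  show ?case by (simp add: pderiv_pCons)
next
  case (Suc k)
  define c0 c1 c2 where "c0 = poly (gegenbauer l k) t" "c1 = poly (gegenbauer l (Suc k)) t"
    "c2 = poly (gegenbauer l (Suc (Suc k))) t"
  define d0 d1 d2 where "d0 = poly (pderiv (gegenbauer l k)) t" "d1 = poly (pderiv (gegenbauer l (Suc k))) t"
    "d2 = poly (pderiv (gegenbauer l (Suc (Suc k)))) t"
  have a: "(real k + 1) * c1 = t * d1 - d0" and b: "(real k + 2 * l) * c0 = d1 - t * d0"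
    using Suc by (simp_all add: c0_c1_c2_def d0_d1_d2_def)
  have r: "(real k + 2) * c2 = 2 * (real k + 1 + l) * t * c1 - (real k + 2 * l) * c0"
    unfolding c0_c1_c2_def by (rule gegenbauer_rec)
  have r': "(real k + 2) * d2 = 2 * (real k + 1 + l) * (c1 + t * d1) - (real k + 2 * l) * d0"
    unfolding c0_c1_c2_def d0_d1_d2_def by (rule gegenbauer_rec_deriv)
  have "(real k + 2 * l) * ((real k + 1) * c1) = (real k + 2 * l) * (t * d1 - d0)"
    using a by simp
  then have "(real k + 2) * (d2 - t * d1) = (real k + 2) * ((real k + 1 + 2 * l) * c1)"
    using r' by (simp add: algebra_simps)
  then have b': "d2 - t * d1 = (real k + 1 + 2 * l) * c1" by simp
  have "t * ((real k + 1) * c1) = t * (t * d1 - d0)" "t * (d2 - t * d1) = t * ((real k + 1 + 2 * l) * c1)"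
    using a b' by simp_all
  then have "(real k + 2) * c2 = t * d2 - d1" using r b by (simp add: algebra_simps)
  then show ?case using b' by (simp add: c0_c1_c2_def d0_d1_d2_def algebra_simps del: gegenbauer.simps)
qed

text \<open>Eliminating the derivative of the neighbour \<open>gegenbauer l (Suc k)\<close> from the
  two identities expresses that neighbour through degree k alone; differentiating this and using the
  second identity again leaves an equation in degree k only.\<close>

lemma gegenbauer_ode:
  "(1 - t\<^sup>2) * poly (pderiv (pderiv (gegenbauer l k))) t - (2 * l + 1) * t * poly (pderiv (gegenbauer l k)) t
     = - (real k * (real k + 2 * l)) * poly (gegenbauer l k) t"
proof -
  let ?C = "gegenbauer l k" and ?D = "pderiv (gegenbauer l k)"
  have a: "(real k + 1) * poly (gegenbauer l (Suc k)) t
      = t * poly (pderiv (gegenbauer l (Suc k))) t - poly ?D t" for t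
    using gegenbauer_deriv_identities by blast
  have b: "(real k + 2 * l) * poly ?C t = poly (pderiv (gegenbauer l (Suc k))) t - t * poly ?D t" for t
    using gegenbauer_deriv_identities by blast
  have "poly (smult (real k + 1) (gegenbauer l (Suc k))) t
      = poly ([:-1, 0, 1:] * ?D + smult (real k + 2 * l) ([:0, 1:] * ?C)) t" for t
  proof -
    have "t * ((real k + 2 * l) * poly ?C t)
        = t * (poly (pderiv (gegenbauer l (Suc k))) t - t * poly ?D t)"
      using b[of t] by simp
    then show ?thesis using a[of t] by (simp add: algebra_simps del: gegenbauer.simps)
  qed
  then have eq: "smult (real k + 1) (gegenbauer l (Suc k)) = [:-1, 0, 1:] * ?D + smult (real k + 2 * l) ([:0, 1:] * ?C)"
    by (intro poly_ext)
  have "poly (pderiv (smult (real k + 1) (gegenbauer l (Suc k)))) t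
      = 2 * t * poly ?D t + (t\<^sup>2 - 1) * poly (pderiv ?D) t + (real k + 2 * l) * (poly ?C t + t * poly ?D t)"
    unfolding eq
    by (simp only: pderiv_add pderiv_mult pderiv_smult)
      (simp add: pderiv_pCons algebra_simps power2_eq_square del: gegenbauer.simps)
  then have "(real k + 1) * poly (pderiv (gegenbauer l (Suc k))) t
      = 2 * t * poly ?D t + (t\<^sup>2 - 1) * poly (pderiv ?D) t + (real k + 2 * l) * (poly ?C t + t * poly ?D t)"
    by (simp add: pderiv_smult del: gegenbauer.simps)
  moreover have "(real k + 1) * ((real k + 2 * l) * poly ?C t)
      = (real k + 1) * (poly (pderiv (gegenbauer l (Suc k))) t - t * poly ?D t)"
    using b[of t] by simp
  ultimately show ?thesis by (simp add: algebra_simps power2_eq_square del: gegenbauer.simps)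
qed

section \<open>Generating function of the Gegenbauer polynomials\<close>

definition risefac :: "real \<Rightarrow> nat \<Rightarrow> real" where
  "risefac l j = pochhammer l j / fact j"

lemma risefac_Suc: "(real j + 1) * risefac l (Suc j) = (l + real j) * risefac l j"
proof -
  have "fact (Suc j) = (real j + 1) * fact j" by (simp add: algebra_simps)
  then have "risefac l (Suc j) = pochhammer l j * (l + real j) / ((real j + 1) * fact j)"
    by (simp only: risefac_def pochhammer_Suc)
  moreover have "real j + 1 \<noteq> 0" by linarith
  ultimately show ?thesis by (simp only: risefac_def) (simp add: mult.commute)
qed

lemma risefac_0 [simp]: "risefac l 0 = 1"
  by (simp add: risefac_def)

text \<open>By upper negation, \<open>risefac l\<close> is the coefficient sequence of (1 - z)^(-l);
  in this form the binomial series applies.\<close>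

lemma risefac_gchoose: "((- of_real l) gchoose j) * (- z) ^ j = of_real (risefac l j) * (z::complex) ^ j"
proof -
  have "(- of_real l :: complex) gchoose j = (- 1) ^ j * of_real (risefac l j)"
    by (simp add: gbinomial_pochhammer risefac_def pochhammer_of_real[symmetric])
  moreover have "(- z) ^ j = (- 1) ^ j * z ^ j" by (rule power_minus)
  ultimately have "((- of_real l) gchoose j) * (- z) ^ j
      = ((- 1) ^ j * (- 1) ^ j) * (of_real (risefac l j) * z ^ j)" by (simp only: mult_ac)
  then show ?thesis by simp
qed

lemma risefac_nonneg: "l > 0 \<Longrightarrow> risefac l j \<ge> 0"
  by (simp add: risefac_def pochhammer_nonneg)

text \<open>The ratio of consecutive terms is at most 1 + m / (j + 1), hence by Bernoulli at most
  ((j + 2) / (j + 1))^m, and these factors telescope.\<close>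

lemma risefac_le:
  assumes "0 < l" "l \<le> real m + 1"
  shows "risefac l j \<le> (real j + 1) ^ m"
proof (induction j)
  case (Suc j)
  have "(l + real j) / (real j + 1) \<le> (real m + 1 + real j) / (real j + 1)"
    using assms by (intro divide_right_mono) auto
  also have "\<dots> = 1 + real m * (1 / (real j + 1))"
    by (simp add: add_divide_distrib[symmetric] divide_simps)
  also have "\<dots> \<le> (1 + 1 / (real j + 1)) ^ m"
    by (rule Bernoulli_inequality) (simp add: field_simps)
  finally have 1: "(l + real j) / (real j + 1) \<le> (1 + 1 / (real j + 1)) ^ m" .
  have "risefac l (Suc j) = (l + real j) / (real j + 1) * risefac l j"
    using risefac_Suc[of j l] by (simp add: field_simps)
  also have "\<dots> \<le> (1 + 1 / (real j + 1)) ^ m * (real j + 1) ^ m"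
    using Suc 1 assms by (intro mult_mono risefac_nonneg) auto
  also have "\<dots> = (real (Suc j) + 1) ^ m"
    by (simp add: field_simps flip: power_mult_distrib)
  finally show ?case .
qed simp

text \<open>Factor \<open>1 - 2 t X + X\<^sup>2 = (1 - z X)(1 - z' X)\<close> with \<open>z\<close>, \<open>z'\<close> conjugate of modulus one.\<close>
lemma gegenbauer_eq_convolution:
  assumes z: "cnj z * z = 1" "Re z = t"
  shows "of_real (poly (gegenbauer l k) t) =
    (\<Sum>j\<le>k. (of_real (risefac l j) * z ^ j) * (of_real (risefac l (k - j)) * cnj z ^ (k - j)))"
proof -
  \<comment> \<open>\<open>A z\<close> is the formal series of (1 - z X)^(-l), handled through its
    first-order differential equation. The product \<open>G\<close> then solves (1 - 2 t X + X^2) G'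
    = 2 l (t - X) G, and comparing coefficients gives the Gegenbauer recurrence.\<close>
  define A where "A z = Abs_fps (\<lambda>j. of_real (risefac l j) * z ^ j)" for z :: complex
  have A: "(1 - fps_const z * fps_X) * fps_deriv (A z) = fps_const (of_real l * z) * A z" for z
  proof (rule fps_ext)
    fix n
    have r: "of_real (real (Suc n)) * of_real (risefac l (Suc n)) = (of_real ((l + real n) * risefac l n) :: complex)"
      unfolding of_real_mult[symmetric] using risefac_Suc[of n l] by (simp add: add.commute)
    have "fps_nth ((1 - fps_const z * fps_X) * fps_deriv (A z)) n
        = of_real (real (Suc n)) * of_real (risefac l (Suc n)) * z ^ Suc n - of_real (real n) * of_real (risefac l n) * z ^ Suc n"
      by (cases n) (simp_all add: A_def left_diff_distrib mult.assoc algebra_simps)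
    also have "\<dots> = fps_nth (fps_const (of_real l * z) * A z) n"
      unfolding r by (simp add: A_def algebra_simps)
    finally show "fps_nth ((1 - fps_const z * fps_X) * fps_deriv (A z)) n = fps_nth (fps_const (of_real l * z) * A z) n" .
  qed
  define G where "G = A z * A (cnj z)"
  have sum: "z + cnj z = of_real (2 * t)" using z(2) by (simp add: complex_add_cnj)
  have M: "(1 - fps_const z * fps_X) * (1 - fps_const (cnj z) * fps_X) =
      1 - fps_const (of_real (2 * t)) * fps_X + fps_X ^ 2"
  proof -
    have "(1 - fps_const z * fps_X) * (1 - fps_const (cnj z) * fps_X) =
      1 - (fps_const z + fps_const (cnj z)) * fps_X + (fps_const (cnj z) * fps_const z) * fps_X ^ 2"
      by (simp add: algebra_simps power2_eq_square)
    then show ?thesis unfolding fps_const_add fps_const_mult sum z(1) by simp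
  qed
  have "(1 - fps_const z * fps_X) * (1 - fps_const (cnj z) * fps_X) * fps_deriv G
      = (1 - fps_const (cnj z) * fps_X) * A (cnj z) * ((1 - fps_const z * fps_X) * fps_deriv (A z))
       + (1 - fps_const z * fps_X) * A z * ((1 - fps_const (cnj z) * fps_X) * fps_deriv (A (cnj z)))"
  proof -
    have "P * Q * (a * b' + a' * b) = Q * b * (P * a') + P * a * (Q * b')" for P Q a b a' b' :: "complex fps"
      by (simp add: algebra_simps)
    then show ?thesis unfolding G_def fps_deriv_mult .
  qed
  also have "\<dots> = fps_const (of_real l) * (fps_const z + fps_const (cnj z)
       - fps_const 2 * (fps_const (cnj z) * fps_const z) * fps_X) * G"
    unfolding A G_def fps_const_mult[symmetric]
    by (simp add: algebra_simps del: fps_const_mult fps_const_add flip: numeral_fps_const)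
  finally have ODE: "(1 - fps_const (of_real (2 * t)) * fps_X + fps_X ^ 2) * fps_deriv G
      = fps_const (of_real l) * (fps_const (of_real (2 * t)) - fps_const 2 * fps_X) * G"
    unfolding M fps_const_add sum fps_const_mult z(1) by simp
  have rec: "of_nat (k + 2) * fps_nth G (Suc (Suc k)) =
     of_real (2 * (real k + 1 + l) * t) * fps_nth G (Suc k) - of_real (real k + 2 * l) * fps_nth G k" for k
  proof -
    have "fps_nth ((1 - fps_const (of_real (2 * t)) * fps_X + fps_X ^ 2) * fps_deriv G) (Suc k)
       = fps_nth (fps_const (of_real l) * (fps_const (of_real (2 * t)) - fps_const 2 * fps_X) * G) (Suc k)"
      using ODE by simp
    moreover have "fps_nth ((1 - fps_const (of_real (2 * t)) * fps_X + fps_X ^ 2) * fps_deriv G) (Suc k)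
      = of_nat (k + 2) * fps_nth G (Suc (Suc k)) - of_real (2 * t) * (of_nat (Suc k) * fps_nth G (Suc k)) + of_nat k * fps_nth G k"
      by (cases k) (simp_all add: distrib_right left_diff_distrib mult.assoc power2_eq_square algebra_simps)
    moreover have "fps_nth (fps_const (of_real l) * (fps_const (of_real (2 * t)) - fps_const 2 * fps_X) * G) (Suc k)
      = of_real l * (of_real (2 * t) * fps_nth G (Suc k) - 2 * fps_nth G k)"
      by (simp add: distrib_right left_diff_distrib mult.assoc)
    ultimately show ?thesis by (simp add: algebra_simps)
  qed
  have G01: "fps_nth G 0 = 1" "fps_nth G (Suc 0) = of_real (2 * l * t)"
  proof -
    show "fps_nth G 0 = 1" by (simp add: G_def A_def)
    have "fps_nth G (Suc 0) = of_real l * (z + cnj z)"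
      by (simp add: G_def A_def fps_mult_nth risefac_def algebra_simps)
    then show "fps_nth G (Suc 0) = of_real (2 * l * t)" unfolding sum by simp
  qed
  have "of_real (poly (gegenbauer l k) t) = fps_nth G k"
  proof (induction k rule: induct_nat_012)
    case (ge2 k)
    have "(of_nat (k + 2) :: complex) * of_real (poly (gegenbauer l (Suc (Suc k))) t)
       = of_real ((real k + 2) * poly (gegenbauer l (Suc (Suc k))) t)" by (simp del: gegenbauer.simps)
    also have "\<dots> = of_nat (k + 2) * fps_nth G (Suc (Suc k))"
      unfolding gegenbauer_rec rec by (simp add: ge2 del: gegenbauer.simps)
    finally show ?case by (simp del: gegenbauer.simps of_nat_add of_nat_Suc)
  qed (simp_all add: G01)
  then show ?thesis by (simp add: G_def A_def fps_mult_nth atMost_atLeast0)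
qed

lemma unit_complex_with_Re:
  assumes "\<bar>t\<bar> \<le> 1"
  obtains z where "cnj z * z = 1" "Re z = t" "norm z = 1"
proof -
  have "t\<^sup>2 \<le> 1" using assms by (simp add: abs_square_le_1)
  then have n: "norm (Complex t (sqrt (1 - t\<^sup>2))) = 1" by (simp add: cmod_def)
  then have "cnj (Complex t (sqrt (1 - t\<^sup>2))) * Complex t (sqrt (1 - t\<^sup>2)) = 1"
    by (metis complex_norm_square mult.commute of_real_1 one_power2)
  with n show ?thesis using that by force
qed

text \<open>Each of the k + 1 terms of the convolution has modulus at most (k + 1)^(2 m) because
  \<open>z\<close> has modulus one. Uniformity in \<open>t\<close> later permits termwise
  integration over the sphere.\<close>

lemma gegenbauer_bound:
  assumes "\<bar>t\<bar> \<le> 1" "0 < l" "l \<le> real m + 1"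
  shows "\<bar>poly (gegenbauer l k) t\<bar> \<le> (real k + 1) ^ (2 * m + 1)"
proof -
  obtain z where z: "cnj z * z = 1" "Re z = t" "norm z = 1"
    using unit_complex_with_Re[OF assms(1)] .
  have "\<bar>poly (gegenbauer l k) t\<bar> = norm (of_real (poly (gegenbauer l k) t) :: complex)" by simp
  also have "\<dots> \<le> (\<Sum>j\<le>k. (real k + 1) ^ m * (real k + 1) ^ m)"
    unfolding gegenbauer_eq_convolution[OF z(1,2)]
  proof (rule sum_norm_le)
    fix j assume j: "j \<in> {..k}"
    have "risefac l j \<le> (real k + 1) ^ m" if "j \<le> k" for j
      using risefac_le[OF assms(2,3), of j] power_mono[of "real j + 1" "real k + 1" m] that by linarith
    then show "norm (of_real (risefac l j) * z ^ j * (of_real (risefac l (k - j)) * cnj z ^ (k - j)))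
        \<le> (real k + 1) ^ m * (real k + 1) ^ m"
      using j z(3) risefac_nonneg[OF assms(2)]
      by (auto simp: norm_mult norm_power intro!: mult_mono)
  qed
  also have "\<dots> = (real k + 1) ^ (2 * m + 1)" by (simp add: mult_2 power_add)
  finally show ?thesis .
qed

text \<open>Cauchy product of the binomial series for (1 - r z)^(-l) and its conjugate. The product
  of the two sums is a squared modulus, so the complex powers become a real power of |1 - r z|^2 = 1
  - 2 r t + r^2.\<close>

lemma gegenbauer_sums:
  assumes t: "\<bar>t\<bar> \<le> 1" and r: "\<bar>r\<bar> < 1"
  shows "(\<lambda>k. poly (gegenbauer l k) t * r ^ k) sums ((1 - 2 * r * t + r\<^sup>2) powr (- l))"
proof -
  obtain z where z: "cnj z * z = 1" "Re z = t" "norm z = 1"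
    using unit_complex_with_Re[OF t] .
  define a where "a z j = of_real (risefac l j) * (of_real r * z) ^ j" for z :: complex and j
  have a: "summable (\<lambda>j. norm (a z j)) \<and> (\<Sum>j. a z j) = (1 - of_real r * z) powr (- of_real l)"
    if "norm z = 1" for z
  proof -
    have eq: "a z j = (- of_real l gchoose j) * (- (of_real r * z)) ^ j" for j
      unfolding a_def risefac_gchoose ..
    have n: "norm (- (of_real r * z)) < 1" using that r by (simp add: norm_mult)
    have "(\<lambda>j. a z j) sums (1 + (- (of_real r * z))) powr (- of_real l)"
      unfolding eq by (rule gen_binomial_complex[OF n])
    moreover have "summable (\<lambda>j. norm (a z j))"
      unfolding eq
    proof (rule abs_summable_in_conv_radius)
      have "conv_radius (\<lambda>n. (- of_real l :: complex) gchoose n) \<ge> 1"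
        by (simp add: conv_radius_gchoose)
      then show "ereal (norm (- (of_real r * z))) < conv_radius (\<lambda>n. (- of_real l :: complex) gchoose n)"
        using n by (meson ereal_less(3) less_le_trans one_ereal_def less_ereal.simps(1))
    qed
    ultimately show ?thesis by (simp add: sums_unique[symmetric])
  qed
  have "(\<lambda>k. \<Sum>i\<le>k. a z i * a (cnj z) (k - i)) sums ((\<Sum>k. a z k) * (\<Sum>k. a (cnj z) k))"
    using a[of z] a[of "cnj z"] z(3) by (intro Cauchy_product_sums) auto
  moreover have "(\<Sum>i\<le>k. a z i * a (cnj z) (k - i)) = of_real (poly (gegenbauer l k) t * r ^ k)" for k
  proof -
    have "of_real (r ^ k) * (of_real (risefac l i) * z ^ i * (of_real (risefac l (k - i)) * cnj z ^ (k - i)))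
         = a z i * a (cnj z) (k - i)" if "i \<le> k" for i
    proof -
      have "(of_real (r ^ k) :: complex) = of_real r ^ i * of_real r ^ (k - i)"
        using that by (simp flip: power_add)
      then show ?thesis by (simp add: a_def power_mult_distrib mult_ac)
    qed
    then show ?thesis
      using gegenbauer_eq_convolution[OF z(1,2), of l k] by (simp add: sum_distrib_left mult.commute)
  qed
  moreover have "(\<Sum>k. a z k) * (\<Sum>k. a (cnj z) k) = of_real ((1 - 2 * r * t + r\<^sup>2) powr (- l))"
  proof -
    have "a (cnj z) k = cnj (a z k)" for k by (simp add: a_def)
    moreover have "summable (a z)" using a[of z] z(3) summable_norm_cancel by blast
    ultimately have "(\<Sum>k. a (cnj z) k) = cnj (\<Sum>k. a z k)"
      using sums_unique[of "\<lambda>k. cnj (a z k)" "cnj (suminf (a z))"] sums_cnj[of "a z" "suminf (a z)"]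
        summable_sums[of "a z"] by simp
    then have "(\<Sum>k. a z k) * (\<Sum>k. a (cnj z) k) = of_real ((norm (\<Sum>k. a z k))\<^sup>2)"
      using complex_norm_square by metis
    also have "norm (\<Sum>k. a z k) = norm (1 - of_real r * z) powr (- l)"
    proof -
      have "norm (of_real r * z) < 1" using z(3) r by (simp add: norm_mult)
      then have "1 - of_real r * z \<noteq> 0" by auto
      then have "norm ((1 - of_real r * z) powr (- of_real l)) = norm (1 - of_real r * z) powr (- l)"
        by (simp add: powr_def)
      then show ?thesis using a[of z] z(3) by simp
    qed
    also have "(norm (1 - of_real r * z) powr (- l))\<^sup>2 = (norm (1 - of_real r * z))\<^sup>2 powr (- l)"
      by (simp add: power2_eq_square powr_mult)
    also have "(norm (1 - of_real r * z))\<^sup>2 = 1 - 2 * r * t + r\<^sup>2"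
    proof -
      have "(Re z)\<^sup>2 + (Im z)\<^sup>2 = 1" using z(3) by (simp add: cmod_def)
      then have "r\<^sup>2 * (Re z)\<^sup>2 + r\<^sup>2 * (Im z)\<^sup>2 = r\<^sup>2" by (simp flip: distrib_left)
      then show ?thesis
        unfolding cmod_power2 using z(2) by (simp add: power2_eq_square algebra_simps)
    qed
    finally show ?thesis .
  qed
  ultimately have "(\<lambda>k. complex_of_real (poly (gegenbauer l k) t * r ^ k)) sums
      of_real ((1 - 2 * r * t + r\<^sup>2) powr (- l))" by simp
  then show ?thesis by (simp only: sums_of_real_iff)
qed

section \<open>Zonal polynomials and the Poisson series\<close>

definition zonal :: "real \<Rightarrow> nat \<Rightarrow> real poly" where
  "zonal l k = smult ((real k + l) / l) (gegenbauer l k)"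

lemma zonal_ode:
  "(1 - t\<^sup>2) * poly (pderiv (pderiv (zonal l k))) t - (2 * l + 1) * t * poly (pderiv (zonal l k)) t
     = - (real k * (real k + 2 * l)) * poly (zonal l k) t"
proof -
  have "(real k + l) / l * ((1 - t\<^sup>2) * poly (pderiv (pderiv (gegenbauer l k))) t
      - (2 * l + 1) * t * poly (pderiv (gegenbauer l k)) t)
     = (real k + l) / l * (- (real k * (real k + 2 * l)) * poly (gegenbauer l k) t)"
    unfolding gegenbauer_ode ..
  then show ?thesis by (simp add: zonal_def pderiv_smult right_diff_distrib mult_ac)
qed

lemma zonal_0: "l \<noteq> 0 \<Longrightarrow> zonal l 0 = 1"
  by (simp add: zonal_def)

lemma zonal_bound:
  assumes "\<bar>t\<bar> \<le> 1" "0 < l" "l \<le> real m + 1"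
  shows "\<bar>poly (zonal l k) t\<bar> \<le> (1 + 1 / l) * (real k + 1) ^ (2 * m + 2)"
proof -
  have "\<bar>poly (zonal l k) t\<bar> = (real k + l) / l * \<bar>poly (gegenbauer l k) t\<bar>"
    using assms by (simp add: zonal_def abs_mult)
  also have "\<dots> \<le> ((1 + 1 / l) * (real k + 1)) * (real k + 1) ^ (2 * m + 1)"
    using assms gegenbauer_bound[OF assms(1), of l m k]
    by (intro mult_mono) (auto simp: field_simps)
  finally show ?thesis by (simp add: mult_ac)
qed

text \<open>The factor (k + l) / l in \<open>zonal\<close> amounts to applying 1 + (r / l) d/dr to
  the generating function; the numerator collapses because 1 - 2 r t + r^2 + 2 r (t - r) = 1 -
  r^2.\<close>

lemma zonal_sums:
  assumes t: "\<bar>t\<bar> \<le> 1" and r: "\<bar>r\<bar> < 1" and l: "l > 0"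
  shows "(\<lambda>k. poly (zonal l k) t * r ^ k) sums ((1 - r\<^sup>2) * (1 - 2 * r * t + r\<^sup>2) powr (- l - 1))"
proof -
  let ?c = "\<lambda>k. poly (gegenbauer l k) t" and ?M = "1 - 2 * r * t + r\<^sup>2"
  have "?M = (1 - \<bar>r\<bar>)\<^sup>2 + 2 * (\<bar>r\<bar> - r * t)" by (simp add: power2_eq_square algebra_simps)
  moreover have "r * t \<le> \<bar>r\<bar>"
    using t mult_mono[of "\<bar>r\<bar>" "\<bar>r\<bar>" "\<bar>t\<bar>" 1] abs_ge_self[of "r * t"] by (simp add: abs_mult)
  moreover have "(1 - \<bar>r\<bar>)\<^sup>2 > 0" using r by simp
  ultimately have M: "?M > 0" by (simp only:) (intro add_pos_nonneg, auto)
  have d: "((\<lambda>r. (1 - 2 * r * t + r\<^sup>2) powr (- l)) has_real_derivative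
      - l * ?M powr (- l - 1) * (2 * r - 2 * t)) (at r)"
    by (rule DERIV_chain2[where f = "\<lambda>x. x powr (- l)" and g = "\<lambda>r. 1 - 2 * r * t + r\<^sup>2",
          OF has_real_derivative_powr[OF M]]) (auto intro!: derivative_eq_intros)
  have "(\<lambda>n. diffs ?c n * r ^ n) sums (- l * ?M powr (- l - 1) * (2 * r - 2 * t))"
    by (rule termdiffs_sums_strong[where K = 1, OF _ d]) (use gegenbauer_sums[OF t] r in auto)
  then have "(\<lambda>n. r / l * (diffs ?c n * r ^ n)) sums (r / l * (- l * ?M powr (- l - 1) * (2 * r - 2 * t)))"
    by (rule sums_mult)
  moreover have "r / l * (diffs ?c n * r ^ n) = real (Suc n) / l * ?c (Suc n) * r ^ Suc n" for n
    by (simp add: diffs_def del: gegenbauer.simps)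
  moreover have "r / l * (- l * ?M powr (- l - 1) * (2 * r - 2 * t)) = 2 * r * (t - r) * ?M powr (- l - 1)"
    using l by (simp add: field_simps)
  ultimately have "(\<lambda>n. real (Suc n) / l * ?c (Suc n) * r ^ Suc n) sums (2 * r * (t - r) * ?M powr (- l - 1))"
    by (simp only:)
  then have "(\<lambda>n. real n / l * ?c n * r ^ n) sums (2 * r * (t - r) * ?M powr (- l - 1))"
    using sums_Suc_iff[of "\<lambda>n. real n / l * ?c n * r ^ n"] by simp
  from sums_add[OF this gegenbauer_sums[OF t r]]
  have "(\<lambda>n. poly (zonal l n) t * r ^ n) sums (2 * r * (t - r) * ?M powr (- l - 1) + ?M powr (- l))"
    using l by (simp add: zonal_def field_simps)
  moreover have "?M powr (- l) = ?M * ?M powr (- l - 1)"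
    using M powr_mult_base[of ?M "- l - 1"] by simp
  ultimately show ?thesis by (simp add: power2_eq_square algebra_simps)
qed

section \<open>Surface measure and zonal functions\<close>

text \<open>The cone construction of \<open>sint\<close> as a genuine measure, for use with Fubini
  and termwise integration. The factor DIM('a) is left out, so the total mass \<open>sphvol\<close>
  is the volume of the unit ball and not the area of the sphere.\<close>

definition sphm :: "'a::euclidean_space measure" where
  "sphm = distr (restrict_space lborel (ball 0 1 - {0})) (restrict_space borel Sn) (\<lambda>x. x /\<^sub>R norm x)"

lemma Sn_borel [measurable, simp]: "Sn \<in> sets borel"
  by (simp add: Sn_def borel_closed)

lemma space_sphm [simp]: "space sphm = Sn"
  by (simp add: sphm_def)

lemma sets_sphm [measurable_cong]: "sets sphm = sets (restrict_space borel Sn)"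
  by (simp add: sphm_def)

lemma sgn_measurable:
  "(\<lambda>x::'a::euclidean_space. x /\<^sub>R norm x) \<in>
     restrict_space lborel (ball 0 1 - {0}) \<rightarrow>\<^sub>M restrict_space borel Sn"
proof (rule measurable_restrict_space2)
  have "(\<lambda>x::'a. x /\<^sub>R norm x) \<in> borel_measurable borel" by measurable
  then show "(\<lambda>x::'a. x /\<^sub>R norm x) \<in> restrict_space lborel (ball 0 1 - {0}) \<rightarrow>\<^sub>M borel"
    by (intro measurable_restrict_space1) simp
qed (auto simp: space_restrict_space intro: sgn_in_Sn)

lemma finite_measure_sphm: "finite_measure (sphm :: 'a::euclidean_space measure)"
proof -
  have "finite_measure (restrict_space lborel (ball 0 1 - {0} :: 'a set))"
  proof
    have "emeasure lborel (ball 0 1 - {0} :: 'a set) \<le> emeasure lborel (ball (0::'a) 1)"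
      by (rule emeasure_mono) auto
    also have "\<dots> < \<infinity>" by (rule emeasure_lborel_ball_finite)
    finally show "emeasure (restrict_space lborel (ball 0 1 - {0})) (space (restrict_space lborel (ball 0 1 - {0} :: 'a set))) \<noteq> \<infinity>"
      by (simp add: emeasure_restrict_space space_restrict_space)
  qed
  then show ?thesis unfolding sphm_def
    by (rule finite_measure.finite_measure_distr[OF _ sgn_measurable])
qed

interpretation sphm: finite_measure "sphm :: 'a::euclidean_space measure"
  by (rule finite_measure_sphm)

definition sphvol :: "'a::euclidean_space itself \<Rightarrow> real" where
  "sphvol _ = measure (sphm :: 'a measure) Sn"

lemma sphvol_eq: "sphvol TYPE('a::euclidean_space) = unit_ball_vol (real DIM('a))"
proof -
  have "measure (sphm :: 'a measure) Sn = measure (restrict_space lborel (ball 0 1 - {0} :: 'a set)) (ball 0 1 - {0})"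
    unfolding sphm_def
    by (subst measure_distr[OF sgn_measurable])
      (auto simp: sets_restrict_space space_restrict_space Sn_def intro!: arg_cong[where f = "measure _"] exI[of _ UNIV])
  also have "\<dots> = measure lborel (ball 0 1 - {0} :: 'a set)"
    by (rule measure_restrict_space) auto
  also have "\<dots> = measure lborel (ball 0 1 :: 'a set)"
    by (rule measure_Diff_null_set) (auto simp: null_sets_def)
  also have "\<dots> = unit_ball_vol (real DIM('a))"
    using content_ball[of 1 "0::'a"] by simp
  finally show ?thesis by (simp add: sphvol_def)
qed

lemma sphvol_pos: "sphvol TYPE('a::euclidean_space) > 0"
  by (simp add: sphvol_eq)

lemma borel_measurable_sphm_continuous:
  "continuous_on Sn h \<Longrightarrow> h \<in> borel_measurable sphm"
  unfolding measurable_cong_sets[OF sets_sphm refl]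
  by (rule borel_measurable_continuous_on_restrict)

lemma integrable_sphm_continuous:
  fixes h :: "'a::euclidean_space \<Rightarrow> real"
  assumes "continuous_on Sn h"
  shows "integrable sphm h"
proof -
  obtain C where "C \<ge> 0" "\<And>x. x \<in> Sn \<Longrightarrow> \<bar>h x\<bar> \<le> C" using Sn_bounded_image[OF assms] by blast
  then show ?thesis
    by (intro sphm.integrable_const_bound[where B = C] borel_measurable_sphm_continuous assms)
      (auto intro!: AE_I2)
qed

lemma sint_eq_integral:
  fixes h :: "'a::euclidean_space \<Rightarrow> real"
  assumes h: "h \<in> borel_measurable sphm"
  shows "sint h = real DIM('a) * integral\<^sup>L sphm h"
proof -
  have h': "h \<in> borel_measurable (restrict_space borel Sn)"
    using h by (simp add: measurable_cong_sets[OF sets_sphm refl])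
  let ?B = "ball 0 1 - {0} :: 'a set"
  have B: "?B \<inter> space lborel \<in> sets lborel" by simp
  have m: "(\<lambda>x. h (x /\<^sub>R norm x)) \<in> borel_measurable (restrict_space lborel ?B)"
    using measurable_comp[OF sgn_measurable h'] by (simp add: o_def)
  then have m1: "(\<lambda>x. indicator ?B x *\<^sub>R h (x /\<^sub>R norm x)) \<in> borel_measurable lborel"
    using borel_measurable_restrict_space_iff[OF B, of "\<lambda>x. h (x /\<^sub>R norm x)"] by simp
  \<comment> \<open>At the origin \<open>x /\<^sub>R norm x\<close> is 0, which lies off the sphere;
    the value \<open>h 0\<close> is confined to a null set.\<close>
  have eq: "(\<lambda>x. indicator (ball 0 1) x *\<^sub>R h (x /\<^sub>R norm x)) =
     (\<lambda>x. indicator ?B x *\<^sub>R h (x /\<^sub>R norm x) + indicator {0} x * h 0)"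
    by (auto simp: fun_eq_iff indicator_def)
  have m2: "(\<lambda>x. indicator (ball 0 1) x *\<^sub>R h (x /\<^sub>R norm x)) \<in> borel_measurable lborel"
    unfolding eq using m1 by (intro borel_measurable_add) auto
  have "integral\<^sup>L sphm h = (LINT x|restrict_space lborel ?B. h (x /\<^sub>R norm x))"
    unfolding sphm_def by (rule integral_distr[OF sgn_measurable h'])
  also have "\<dots> = (LINT x|lborel. indicator ?B x *\<^sub>R h (x /\<^sub>R norm x))"
    by (rule integral_restrict_space[OF B])
  also have "\<dots> = (LINT x|lborel. indicator (ball 0 1) x *\<^sub>R h (x /\<^sub>R norm x))"
    by (intro integral_cong_AE m1 m2 eventually_mono[OF AE_lborel_singleton[of "0::'a"]])
      (auto simp: indicator_def)
  finally show ?thesis by (simp add: sint_def set_lebesgue_integral_def)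
qed

text \<open>The points projecting radially to \<open>z\<close> lie on the line
  \<open>span {z}\<close>, a null set from dimension two on. This disposes of the diagonal of the
  singular kernel.\<close>

lemma AE_sphm_neq:
  fixes z :: "'a::euclidean_space"
  assumes "DIM('a) \<ge> 2" "z \<in> Sn"
  shows "AE y in sphm. y \<noteq> z"
proof -
  have "dim (span {z}) \<le> 1"
    using dim_le_card'[of "{z}"] by (simp add: dim_span)
  then have "negligible (span {z})" using assms by (intro negligible_lowdim) auto
  then have "span {z} \<in> null_sets lebesgue" by (simp only: negligible_iff_null_sets)
  moreover have "span {z} \<in> sets lborel" using closed_subspace by (simp add: borel_closed)
  ultimately have N: "span {z} \<in> null_sets lborel"
    using null_sets_completion_iff by blast
  have "AE x in lborel. x \<notin> span {z}" by (rule AE_not_in[OF N])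
  then have "AE x in lborel. x \<in> ball 0 1 - {0} \<longrightarrow> x /\<^sub>R norm x \<noteq> z"
  proof eventually_elim
    case (elim x)
    show ?case
    proof (intro impI notI)
      assume x: "x \<in> ball 0 1 - {0}" "x /\<^sub>R norm x = z"
      then have "x = norm x *\<^sub>R z" by auto
      then show False using elim by (metis span_base span_scale singletonI)
    qed
  qed
  then have "AE x in restrict_space lborel (ball 0 1 - {0}). x /\<^sub>R norm x \<noteq> z"
    by (subst AE_restrict_space_iff) auto
  then show ?thesis unfolding sphm_def
    by (subst AE_distr_iff[OF sgn_measurable]) (auto simp: sets_restrict_space space_restrict_space)
qed

section \<open>Calculus of the spherical Laplacian\<close>

lemma sphere_smooth_cong:
  assumes "\<And>x. x \<in> Sn \<Longrightarrow> u x = v x"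
  shows "sphere_smooth u \<longleftrightarrow> sphere_smooth v"
proof -
  have "radext u x = radext v x" if "x \<in> -{0}" for x
    using that assms[OF sgn_in_Sn[of x]] by (simp add: radext_def)
  then show ?thesis unfolding sphere_smooth_def
    by (metis open_Compl closed_singleton smooth_on_open_cong)
qed

lemma sph_lap_cong:
  fixes u v :: "'a::euclidean_space \<Rightarrow> real"
  assumes "\<And>x. x \<in> Sn \<Longrightarrow> u x = v x" "z \<in> Sn"
  shows "sph_lap u z = sph_lap v z"
proof -
  have "radext u x = radext v x" if "x \<in> -{0}" for x
    using that assms(1)[OF sgn_in_Sn[of x]] by (simp add: radext_def)
  then have "dpart [i,i] (radext u) z = dpart [i,i] (radext v) z" for i
    using Sn_nonzero[OF assms(2)] by (intro dpart_cong_open[of "-{0}"]) auto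
  then show ?thesis by (simp add: sph_lap_def lap_def)
qed

lemma sphere_smooth_const: "sphere_smooth (\<lambda>_. c)"
  by (auto simp: sphere_smooth_def radext_def[abs_def] intro!: smooth_on_open_const)

lemma sphere_smooth_add:
  "sphere_smooth u \<Longrightarrow> sphere_smooth v \<Longrightarrow> sphere_smooth (\<lambda>x. u x + v x)"
  using smooth_on_open_add[of "-{0}" "radext u" "radext v"]
  by (simp add: sphere_smooth_def radext_def[abs_def] open_Compl)

lemma sphere_smooth_sum:
  "(\<And>i. i \<in> I \<Longrightarrow> sphere_smooth (u i)) \<Longrightarrow> sphere_smooth (\<lambda>x. \<Sum>i\<in>I. u i x)"
  by (induction I rule: infinite_finite_induct) (auto intro: sphere_smooth_add sphere_smooth_const)

lemma radext_inner:
  "x \<noteq> 0 \<Longrightarrow> radext (\<lambda>x. x \<bullet> w) x = (x \<bullet> w) * (x \<bullet> x) powr (- 1/2)"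
  by (simp add: radext_def norm_eq_sqrt_inner powr_minus powr_half_sqrt field_simps)

lemma sphere_smooth_inner: "sphere_smooth (\<lambda>x. x \<bullet> w)"
  unfolding sphere_smooth_def
  by (rule smooth_on_open_cong[where F = "\<lambda>x. (x \<bullet> w) * (x \<bullet> x) powr (- 1/2)"])
    (auto simp: radext_inner intro!: smooth_on_open_mult smooth_on_open_inner smooth_on_open_inner_self_powr)

lemma sphere_smooth_poly:
  assumes "sphere_smooth u"
  shows "sphere_smooth (\<lambda>x. poly p (u x))"
proof (induction p)
  case (pCons a p)
  show ?case
    using sphere_smooth_add[OF sphere_smooth_const[of a] sphere_smooth_mult[OF assms pCons.IH]] by simp
qed (simp add: sphere_smooth_const)

lemma dpart_add:
  assumes "smooth_on_open U F" "smooth_on_open U G" "v \<in> Basis" "x \<in> U"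
  shows "dpart [v] (\<lambda>x. F x + G x) x = dpart [v] F x + dpart [v] G x"
  using assms by (intro has_partial_imp_dpart has_partial_add smooth_on_open_has_partial)

lemma dpart_cmult:
  assumes "smooth_on_open U F" "v \<in> Basis" "x \<in> U"
  shows "dpart [v] (\<lambda>x. c * F x) x = c * dpart [v] F x"
  using assms by (intro has_partial_imp_dpart has_partial_cmult smooth_on_open_has_partial)

lemma sph_lap_add:
  fixes u v :: "'a::euclidean_space \<Rightarrow> real"
  assumes "sphere_smooth u" "sphere_smooth v" "z \<in> Sn"
  shows "sph_lap (\<lambda>x. u x + v x) z = sph_lap u z + sph_lap v z"
proof -
  let ?U = "-{0} :: 'a set"
  have s: "smooth_on_open ?U (radext u)" "smooth_on_open ?U (radext v)"
    using assms by (simp_all add: sphere_smooth_def)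
  have "dpart [i,i] (\<lambda>x. radext u x + radext v x) z = dpart [i,i] (radext u) z + dpart [i,i] (radext v) z"
    if i: "i \<in> Basis" for i
  proof -
    have "dpart [i,i] (\<lambda>x. radext u x + radext v x) z
        = dpart [i] (\<lambda>x. dpart [i] (radext u) x + dpart [i] (radext v) x) z"
      unfolding dpart_dpart using assms(3) Sn_nonzero
      by (intro dpart_cong_open[of ?U] dpart_add[OF s i]) auto
    also have "\<dots> = dpart [i,i] (radext u) z + dpart [i,i] (radext v) z"
      unfolding dpart_dpart using assms(3) Sn_nonzero i
      by (intro dpart_add[of ?U] smooth_on_open_dpart s) auto
    finally show ?thesis .
  qed
  then have "lap (\<lambda>x. radext u x + radext v x) z = lap (radext u) z + lap (radext v) z"
    by (simp add: lap_def sum.distrib)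
  then show ?thesis by (simp add: sph_lap_def radext_def[abs_def])
qed

lemma sph_lap_cmult:
  fixes u :: "'a::euclidean_space \<Rightarrow> real"
  assumes "sphere_smooth u" "z \<in> Sn"
  shows "sph_lap (\<lambda>x. c * u x) z = c * sph_lap u z"
proof -
  let ?U = "-{0} :: 'a set"
  have s: "smooth_on_open ?U (radext u)"
    using assms by (simp_all add: sphere_smooth_def)
  have "dpart [i,i] (\<lambda>x. c * radext u x) z = c * dpart [i,i] (radext u) z"
    if i: "i \<in> Basis" for i
  proof -
    have "dpart [i,i] (\<lambda>x. c * radext u x) z = dpart [i] (\<lambda>x. c * dpart [i] (radext u) x) z"
      unfolding dpart_dpart using assms(2) Sn_nonzero
      by (intro dpart_cong_open[of ?U] dpart_cmult[OF s i]) auto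
    also have "\<dots> = c * dpart [i,i] (radext u) z"
      unfolding dpart_dpart using assms(2) Sn_nonzero i
      by (intro dpart_cmult[of ?U] smooth_on_open_dpart s) auto
    finally show ?thesis .
  qed
  then have "lap (\<lambda>x. c * radext u x) z = c * lap (radext u) z"
    by (simp add: lap_def sum_distrib_left)
  then show ?thesis by (simp add: sph_lap_def radext_def[abs_def])
qed

lemma sph_lap_const: 
  fixes z :: "'a::euclidean_space"
  shows "sph_lap (\<lambda>_. c) z = 0"
proof -
  have d: "dpart [i] (\<lambda>_::'a. b::real) = (\<lambda>_. 0)" for i b
    using has_partial_imp_dpart[OF has_partial_const] by blast
  have "dpart [i,i] (\<lambda>_::'a. c) = (\<lambda>_. 0)" for i unfolding dpart_dpart d ..
  then show ?thesis by (simp add: sph_lap_def radext_def[abs_def] lap_def)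
qed

lemma sph_lap_sum:
  fixes u :: "'i \<Rightarrow> 'a::euclidean_space \<Rightarrow> real"
  assumes "\<And>i. i \<in> I \<Longrightarrow> sphere_smooth (u i)" "z \<in> Sn"
  shows "sph_lap (\<lambda>x. \<Sum>i\<in>I. c i * u i x) z = (\<Sum>i\<in>I. c i * sph_lap (u i) z)"
  using assms(1)
proof (induction I rule: infinite_finite_induct)
  case (insert i I)
  have "sph_lap (\<lambda>x. c i * u i x + (\<Sum>i\<in>I. c i * u i x)) z
     = c i * sph_lap (u i) z + sph_lap (\<lambda>x. \<Sum>i\<in>I. c i * u i x) z"
    using insert assms(2)
    by (subst sph_lap_add) (auto intro!: sphere_smooth_mult sphere_smooth_const sphere_smooth_sum simp: sph_lap_cmult)
  then show ?case using insert by simp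
qed (simp_all add: sph_lap_const)

text \<open>At points of the sphere the 0-homogeneous extension q of x \<bullet> y has |grad q|^2 =
  1 - t^2 and Laplacian -n t, and the chain rule gives p''(t) |grad q|^2 + p'(t) lap q. With 2 l + 1
  = n this is the Gegenbauer operator.\<close>

lemma sph_lap_poly_inner:
  fixes z y :: "'a::euclidean_space"
  assumes z: "z \<in> Sn" and y: "y \<in> Sn"
  shows "sph_lap (\<lambda>x. poly p (x \<bullet> y)) z =
    (1 - (z \<bullet> y)\<^sup>2) * poly (pderiv (pderiv p)) (z \<bullet> y)
     - (real DIM('a) - 1) * (z \<bullet> y) * poly (pderiv p) (z \<bullet> y)"
proof -
  define q where "q x = (x \<bullet> y) * (x \<bullet> x) powr (- 1/2)" for x :: 'a
  \<comment> \<open>\<open>q'\<close> and \<open>q''\<close> are left in the shape that the product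
    and power rules produce, so that these rules apply by matching; simplification waits until x =
    z.\<close>
  define q' where "q' i x = (i \<bullet> y) * (x \<bullet> x) powr (- 1/2)
      + (x \<bullet> y) * (2 * (-1/2) * (x \<bullet> i) * (x \<bullet> x) powr (- 1/2 - 1))" for i x :: 'a
  define q'' where "q'' i x = (i \<bullet> y) * (2 * (- 1/2) * (x \<bullet> i) * (x \<bullet> x) powr (- 1/2 - 1))
      + ((i \<bullet> y) * (2 * (-1/2) * (x \<bullet> i) * (x \<bullet> x) powr (- 1/2 - 1))
        + (x \<bullet> y) * ((2 * (-1/2) * (i \<bullet> i)) * (x \<bullet> x) powr (- 1/2 - 1)
           + (2 * (-1/2) * (x \<bullet> i)) * (2 * (-1/2-1) * (x \<bullet> i) * (x \<bullet> x) powr (- 1/2 - 1 - 1))))" for i x :: 'a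
  have hq: "has_partial q i (q' i x) x" if "x \<noteq> 0" for i x
    unfolding q_def q'_def
    using that by (intro has_partial_mult has_partial_inner has_partial_inner_self_powr)
  have hq': "has_partial (q' i) i (q'' i x) x" if "x \<noteq> 0" for i x
    unfolding q'_def q''_def
    using that by (intro has_partial_add has_partial_mult has_partial_cmult has_partial_inner has_partial_inner_self_powr)
  have hp: "has_partial (\<lambda>x. poly r (q x)) i (poly (pderiv r) (q x) * q' i x) x" if "x \<noteq> 0" for r i x
    by (rule has_partial_chain[OF hq[OF that] poly_DERIV])
  have rad: "radext (\<lambda>x. poly p (x \<bullet> y)) x = poly p (q x)" if "x \<in> -{0}" for x
  proof -
    have "radext (\<lambda>x. poly p (x \<bullet> y)) x = poly p (radext (\<lambda>x. x \<bullet> y) x)" by (simp only: radext_def)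
    then show ?thesis using that radext_inner[of x y] by (simp add: q_def)
  qed
  have z0: "z \<noteq> 0" using Sn_nonzero[OF z] .
  have zz: "z \<bullet> z = 1" "y \<bullet> y = 1" using z y by (auto simp: Sn_def norm_eq_sqrt_inner)
  define t where "t = z \<bullet> y"
  have tt: "z \<bullet> y = t" "y \<bullet> z = t" by (simp_all add: t_def inner_commute)
  have qt: "q z = t" by (simp add: q_def zz t_def)
  have d2: "dpart [i,i] (radext (\<lambda>x. poly p (x \<bullet> y))) z
     = poly (pderiv (pderiv p)) t * (q' i z)\<^sup>2 + poly (pderiv p) t * q'' i z" for i
  proof -
    have "dpart [i,i] (radext (\<lambda>x. poly p (x \<bullet> y))) z = dpart [i,i] (\<lambda>x. poly p (q x)) z"
      using rad z0 by (intro dpart_cong_open[of "-{0}"]) auto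
    also have "\<dots> = dpart [i] (\<lambda>x. poly (pderiv p) (q x) * q' i x) z"
      unfolding dpart_dpart using z0 hp by (intro dpart_cong_open[of "-{0}"] has_partial_imp_dpart) auto
    also have "\<dots> = poly (pderiv (pderiv p)) (q z) * q' i z * q' i z + poly (pderiv p) (q z) * q'' i z"
      using z0 by (intro has_partial_imp_dpart has_partial_mult hp hq') auto
    finally show ?thesis by (simp add: qt power2_eq_square mult_ac)
  qed
  have par: "(\<Sum>i\<in>Basis. (x \<bullet> i) * (y \<bullet> i)) = x \<bullet> y" for x y :: 'a
    by (rule euclidean_inner[symmetric])
  have s1: "(\<Sum>i\<in>Basis. (q' i z)\<^sup>2) = 1 - t\<^sup>2"
  proof -
    have "(\<Sum>i\<in>Basis. (q' i z)\<^sup>2) = (\<Sum>i\<in>Basis. (y \<bullet> i) * (y \<bullet> i) - 2 * t * ((z \<bullet> i) * (y \<bullet> i)) + t\<^sup>2 * ((z \<bullet> i) * (z \<bullet> i)))"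
      by (rule sum.cong) (auto simp: q'_def zz tt inner_commute[of _ y] power2_eq_square algebra_simps)
    also have "\<dots> = 1 - t\<^sup>2"
      by (simp add: sum.distrib sum_subtractf sum_distrib_left[symmetric] par zz tt power2_eq_square)
    finally show ?thesis .
  qed
  have s2: "(\<Sum>i\<in>Basis. q'' i z) = - (real DIM('a) - 1) * t"
  proof -
    have "(\<Sum>i\<in>Basis. q'' i z) = (\<Sum>i\<in>Basis. - 2 * ((z \<bullet> i) * (y \<bullet> i)) - t + 3 * t * ((z \<bullet> i) * (z \<bullet> i)))"
      by (rule sum.cong) (auto simp: q''_def zz tt inner_commute[of _ y] inner_Basis power2_eq_square algebra_simps)
    also have "\<dots> = - (real DIM('a) - 1) * t"
      unfolding sum.distrib sum_subtractf sum_distrib_left[symmetric] par zz tt by (simp add: algebra_simps)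
    finally show ?thesis .
  qed
  show ?thesis
    unfolding sph_lap_def lap_def d2 sum.distrib sum_distrib_left[symmetric] s1 s2
    by (simp add: t_def algebra_simps)
qed

section \<open>Convolution with zonal polynomials\<close>

definition monom_list :: "'a::euclidean_space list \<Rightarrow> 'a \<Rightarrow> real" where
  "monom_list bs x = prod_list (map (\<lambda>b. x \<bullet> b) bs)"

lemma sphere_smooth_monom_list:
  fixes bs :: "'a::euclidean_space list"
  shows "sphere_smooth (monom_list bs)"
proof (induction bs)
  case Nil
  have "monom_list ([] :: 'a list) = (\<lambda>_. 1)" by (simp add: monom_list_def[abs_def])
  then show ?case by (simp add: sphere_smooth_const)
next
  case (Cons b bs)
  have "monom_list (b # bs) = (\<lambda>x. (x \<bullet> b) * monom_list bs x)" by (simp add: monom_list_def[abs_def])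
  then show ?case using Cons by (simp add: sphere_smooth_mult sphere_smooth_inner)
qed

text \<open>Lists of basis vectors keep different orderings of the same monomial apart, which
  absorbs the multinomial coefficients and lets the sum follow the induction on
  \<open>j\<close>.\<close>

lemma inner_power_eq_sum_monom_list:
  fixes x y :: "'a::euclidean_space"
  shows "(x \<bullet> y) ^ j = (\<Sum>bs | set bs \<subseteq> Basis \<and> length bs = j. monom_list bs x * monom_list bs y)"
proof (induction j)
  case 0
  have "{bs. set bs \<subseteq> (Basis :: 'a set) \<and> length bs = 0} = {[]}" by auto
  then show ?case by (simp add: monom_list_def)
next
  case (Suc j)
  let ?L = "\<lambda>j. {bs. set bs \<subseteq> (Basis :: 'a set) \<and> length bs = j}"
  have inj: "inj_on (\<lambda>(bs, b). b # bs) (?L j \<times> (Basis :: 'a set))" by (auto simp: inj_on_def)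
  have "(\<Sum>bs\<in>?L (Suc j). monom_list bs x * monom_list bs y)
     = (\<Sum>(bs, b)\<in>?L j \<times> Basis. monom_list (b # bs) x * monom_list (b # bs) y)"
    unfolding lists_length_Suc_eq sum.reindex[OF inj] by (simp add: case_prod_beta o_def)
  also have "\<dots> = (\<Sum>bs\<in>?L j. \<Sum>b\<in>Basis. (monom_list bs x * monom_list bs y) * ((x \<bullet> b) * (y \<bullet> b)))"
    unfolding sum.cartesian_product[symmetric] by (simp add: monom_list_def mult_ac)
  also have "\<dots> = (\<Sum>bs\<in>?L j. monom_list bs x * monom_list bs y) * (x \<bullet> y)"
    unfolding sum_distrib_left[symmetric] sum_distrib_right[symmetric] euclidean_inner[of x y] ..
  finally show ?case using Suc by simp
qed

text \<open>A zonal kernel \<open>poly p (z \<bullet> y)\<close> is a finite sum of products, so no differentiation under the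
  integral sign is needed.\<close>
lemma poly_inner_convolution:
  fixes v :: "'a::euclidean_space \<Rightarrow> real" and p :: "real poly"
  assumes v: "continuous_on Sn v"
  defines "F \<equiv> \<lambda>z. LINT y|sphm. poly p (z \<bullet> y) * v y"
  shows "sphere_smooth F"
    and "\<And>z. z \<in> Sn \<Longrightarrow> sph_lap F z = (LINT y|sphm. sph_lap (\<lambda>x. poly p (x \<bullet> y)) z * v y)"
proof -
  define I where "I = Sigma {..degree p} (\<lambda>j. {bs. set bs \<subseteq> (Basis :: 'a set) \<and> length bs = j})"
  have fin: "finite I" unfolding I_def by (intro finite_SigmaI) (auto intro: finite_lists_length_eq)
  have pe: "poly p (x \<bullet> y) = (\<Sum>jb\<in>I. (coeff p (fst jb) * monom_list (snd jb) y) * monom_list (snd jb) x)" for x y :: 'a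
    unfolding poly_altdef inner_power_eq_sum_monom_list I_def sum_distrib_left
    by (subst sum.Sigma) (auto simp: finite_lists_length_eq case_prod_beta mult_ac)
  define a where "a bs = (LINT y|sphm. monom_list bs y * v y)" for bs
  have int: "integrable sphm (\<lambda>y. monom_list bs y * v y)" for bs
    by (intro integrable_sphm_continuous continuous_on_mult v sphere_smooth_continuous sphere_smooth_monom_list)
  have F: "F = (\<lambda>x. \<Sum>jb\<in>I. (coeff p (fst jb) * a (snd jb)) * monom_list (snd jb) x)"
  proof
    fix x
    have "F x = (LINT y|sphm. (\<Sum>jb\<in>I. (coeff p (fst jb) * monom_list (snd jb) x) * (monom_list (snd jb) y * v y)))"
      unfolding F_def pe sum_distrib_right by (simp add: mult_ac)
    also have "\<dots> = (\<Sum>jb\<in>I. (coeff p (fst jb) * monom_list (snd jb) x) * a (snd jb))"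
      unfolding a_def
      by (subst Bochner_Integration.integral_sum) (auto intro!: integrable_mult_right int)
    finally show "F x = (\<Sum>jb\<in>I. (coeff p (fst jb) * a (snd jb)) * monom_list (snd jb) x)"
      by (simp add: mult_ac)
  qed
  show "sphere_smooth F"
    unfolding F by (intro sphere_smooth_sum sphere_smooth_mult sphere_smooth_const sphere_smooth_monom_list)
  fix z :: 'a assume z: "z \<in> Sn"
  have "sph_lap F z = (\<Sum>jb\<in>I. (coeff p (fst jb) * a (snd jb)) * sph_lap (monom_list (snd jb)) z)"
    unfolding F by (rule sph_lap_sum[OF sphere_smooth_monom_list z])
  also have "\<dots> = (LINT y|sphm. (\<Sum>jb\<in>I. (coeff p (fst jb) * sph_lap (monom_list (snd jb)) z) * (monom_list (snd jb) y * v y)))"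
  proof (subst Bochner_Integration.integral_sum)
    show "(\<Sum>jb\<in>I. (coeff p (fst jb) * a (snd jb)) * sph_lap (monom_list (snd jb)) z) =
      (\<Sum>jb\<in>I. LINT y|sphm. (coeff p (fst jb) * sph_lap (monom_list (snd jb)) z) * (monom_list (snd jb) y * v y))"
      unfolding a_def integral_mult_right_zero by (simp add: mult_ac)
  qed (intro integrable_mult_right int)
  also have "\<dots> = (LINT y|sphm. sph_lap (\<lambda>x. poly p (x \<bullet> y)) z * v y)"
    unfolding pe sph_lap_sum[OF sphere_smooth_monom_list z] sum_distrib_right
    by (simp add: mult_ac)
  finally show "sph_lap F z = (LINT y|sphm. sph_lap (\<lambda>x. poly p (x \<bullet> y)) z * v y)" .
qed

section \<open>Spherical harmonics and the Poisson kernel\<close>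

lemma inner_Sn_le_1: "z \<in> Sn \<Longrightarrow> y \<in> Sn \<Longrightarrow> \<bar>z \<bullet> y\<bar> \<le> 1"
  using Cauchy_Schwarz_ineq2[of z y] by (simp add: Sn_def)

definition zker :: "nat \<Rightarrow> 'a::euclidean_space \<Rightarrow> 'a \<Rightarrow> real" where
  "zker k x y = poly (zonal ((real DIM('a) - 2) / 2) k) (x \<bullet> y)"

definition eigval :: "'a::euclidean_space itself \<Rightarrow> nat \<Rightarrow> real" where
  "eigval T k = real k * (real k + real DIM('a) - 2)"

text \<open>Integral form of \<open>harm_proj\<close>, to be identified with it in
  \<open>harm_proj_eq_hproj\<close>. It vanishes off the sphere because \<open>harm_space\<close>
  demands this of its members. In degree 0 the zonal kernel is 1, so the division by
  \<open>sphvol\<close> yields the mean value.\<close>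

definition hproj :: "nat \<Rightarrow> ('a::euclidean_space \<Rightarrow> real) \<Rightarrow> 'a \<Rightarrow> real" where
  "hproj k v z = (if z \<in> Sn then (LINT y|sphm. zker k z y * v y) / sphvol TYPE('a) else 0)"

definition pker :: "real \<Rightarrow> 'a::euclidean_space \<Rightarrow> 'a \<Rightarrow> real" where
  "pker r x y = (1 - r\<^sup>2) * (1 - 2 * r * (x \<bullet> y) + r\<^sup>2) powr (- (real DIM('a) / 2))"

lemma zker_commute: "zker k x y = zker k y x"
  by (simp add: zker_def inner_commute)

lemma sphere_smooth_zker: "sphere_smooth (zker k z)"
proof -
  have "zker k z = (\<lambda>x. poly (zonal ((real DIM('a) - 2) / 2) k) (x \<bullet> z))"
    by (simp add: fun_eq_iff zker_def inner_commute)
  then show ?thesis by (simp add: sphere_smooth_poly sphere_smooth_inner)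
qed

lemma continuous_on_zker: "continuous_on Sn (zker k z)"
  by (rule sphere_smooth_continuous[OF sphere_smooth_zker])

lemma sph_lap_zonal:
  fixes z y :: "'a::euclidean_space"
  assumes "z \<in> Sn" "y \<in> Sn"
  shows "sph_lap (\<lambda>x. poly (zonal ((real DIM('a) - 2) / 2) k) (x \<bullet> y)) z = - eigval TYPE('a) k * zker k z y"
proof -
  have "2 * ((real DIM('a) - 2) / 2) + 1 = real DIM('a) - 1"
    "real k + 2 * ((real DIM('a) - 2) / 2) = real k + real DIM('a) - 2" by (simp_all add: field_simps)
  then show ?thesis
    unfolding sph_lap_poly_inner[OF assms] zker_def eigval_def
    using zonal_ode[of "z \<bullet> y" "(real DIM('a) - 2) / 2" k] by (simp add: field_simps)
qed

lemma sph_lap_zker: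
  fixes z y :: "'a::euclidean_space"
  assumes "z \<in> Sn" "y \<in> Sn"
  shows "sph_lap (zker k z) y = - eigval TYPE('a) k * zker k z y"
proof -
  have "zker k z = (\<lambda>x. poly (zonal ((real DIM('a) - 2) / 2) k) (x \<bullet> z))"
    by (simp add: fun_eq_iff zker_def inner_commute)
  then have "sph_lap (zker k z) y = - eigval TYPE('a) k * zker k y z"
    using sph_lap_zonal[OF assms(2,1), of k] by metis
  then show ?thesis by (metis zker_commute)
qed

lemma zker_bound:
  assumes "3 \<le> DIM('a::euclidean_space)"
  obtains A m where "A \<ge> 0" "\<And>k (z::'a) y. z \<in> Sn \<Longrightarrow> y \<in> Sn \<Longrightarrow> \<bar>zker k z y\<bar> \<le> A * (real k + 1) ^ m"
proof -
  let ?l = "(real DIM('a) - 2) / 2"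
  have l: "0 < ?l" "?l \<le> real DIM('a) + 1" using assms by auto
  have "\<bar>zker k z y\<bar> \<le> (1 + 1 / ?l) * (real k + 1) ^ (2 * DIM('a) + 2)"
    if "z \<in> Sn" "y \<in> Sn" for k and z y :: 'a
    unfolding zker_def by (rule zonal_bound[OF inner_Sn_le_1[OF that] l])
  then show ?thesis using that[of "1 + 1 / ?l" "2 * DIM('a) + 2"] l by auto
qed

lemma hproj_cong:
  "(\<And>y. y \<in> Sn \<Longrightarrow> u y = v y) \<Longrightarrow> hproj k u z = hproj k v z"
  by (auto simp: hproj_def intro!: Bochner_Integration.integral_cong)

lemma hproj_cmult: "hproj k (\<lambda>y. c * u y) z = c * hproj k u z"
  by (simp add: hproj_def mult.left_commute[of _ c])

lemma hproj_in_harm_space: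
  fixes v :: "'a::euclidean_space \<Rightarrow> real"
  assumes v: "continuous_on Sn v"
  shows "hproj k v \<in> harm_space k"
proof -
  let ?p = "zonal ((real DIM('a) - 2) / 2) k"
  define F where "F z = (LINT y|sphm. poly ?p (z \<bullet> y) * v y)" for z
  note F = poly_inner_convolution(1)[OF v, where p = ?p, folded F_def]
    poly_inner_convolution(2)[OF v, where p = ?p, folded F_def]
  have eq: "hproj k v z = (1 / sphvol TYPE('a)) * F z" if "z \<in> Sn" for z
    using that by (simp add: hproj_def F_def zker_def)
  have "sphere_smooth (\<lambda>z. (1 / sphvol TYPE('a)) * F z)"
    by (intro sphere_smooth_mult sphere_smooth_const F)
  then have sm: "sphere_smooth (hproj k v)" 
    using sphere_smooth_cong[of "hproj k v" "\<lambda>z. (1 / sphvol TYPE('a)) * F z", OF eq] by simp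
  have "- sph_lap (hproj k v) z = real k * (real k + real DIM('a) - 2) * hproj k v z" if z: "z \<in> Sn" for z
  proof -
    have "sph_lap (hproj k v) z = sph_lap (\<lambda>z. (1 / sphvol TYPE('a)) * F z) z"
      by (rule sph_lap_cong[OF eq z])
    also have "\<dots> = (1 / sphvol TYPE('a)) * sph_lap F z" by (rule sph_lap_cmult[OF F(1) z])
    also have "sph_lap F z = (LINT y|sphm. - eigval TYPE('a) k * (zker k z y * v y))"
      unfolding F(2)[OF z]
      by (intro Bochner_Integration.integral_cong) (simp_all add: sph_lap_zonal z)
    also have "\<dots> = - eigval TYPE('a) k * F z" by (simp add: F_def zker_def)
    finally show ?thesis using eq[OF z] by (simp add: eigval_def)
  qed
  then show ?thesis using sm by (simp add: harm_space_def hproj_def)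
qed

text \<open>Green's identity moves the Laplacian onto the zonal kernel, an eigenfunction. Both the
  orthogonality of different degrees and the decay in the degree come from this relation.\<close>

lemma hproj_sph_lap:
  fixes v :: "'a::euclidean_space \<Rightarrow> real"
  assumes v: "sphere_smooth v" and z: "z \<in> Sn"
  shows "hproj j (sph_lap v) z = - eigval TYPE('a) j * hproj j v z"
proof -
  have c: "continuous_on Sn v" "continuous_on Sn (sph_lap v)" "continuous_on Sn (sph_lap (zker j z))"
    by (intro sphere_smooth_continuous v sphere_smooth_sph_lap sphere_smooth_zker)+
  have "sint (\<lambda>y. zker j z y * sph_lap v y) = sint (\<lambda>y. v y * sph_lap (zker j z) y)"
    by (rule sint_green[OF v sphere_smooth_zker])
  then have "(LINT y|sphm. zker j z y * sph_lap v y) = (LINT y|sphm. v y * sph_lap (zker j z) y)"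
    using sint_eq_integral[of "\<lambda>y. zker j z y * sph_lap v y"]
      sint_eq_integral[of "\<lambda>y. v y * sph_lap (zker j z) y"]
      borel_measurable_sphm_continuous[OF continuous_on_mult[OF continuous_on_zker c(2), of j z]]
      borel_measurable_sphm_continuous[OF continuous_on_mult[OF c(1) c(3)]] by simp
  also have "\<dots> = (LINT y|sphm. - eigval TYPE('a) j * (zker j z y * v y))"
    by (intro Bochner_Integration.integral_cong) (simp_all add: sph_lap_zker z mult_ac)
  finally show ?thesis using z by (simp add: hproj_def)
qed

lemma eigval_inj:
  assumes "3 \<le> DIM('a::euclidean_space)" "j \<noteq> k"
  shows "eigval TYPE('a) j \<noteq> eigval TYPE('a) k"
proof -
  have "eigval TYPE('a) j - eigval TYPE('a) k = (real j - real k) * (real j + real k + real DIM('a) - 2)"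
    by (simp add: eigval_def algebra_simps)
  then show ?thesis using assms by auto
qed

text \<open>Projecting the Laplacian of \<open>Y\<close> in two ways gives two different eigenvalues
  times the same number.\<close>

lemma hproj_orthogonal:
  fixes Y :: "'a::euclidean_space \<Rightarrow> real"
  assumes dim: "3 \<le> DIM('a)" and Y: "Y \<in> harm_space k" and "j \<noteq> k" and z: "z \<in> Sn"
  shows "hproj j Y z = 0"
proof -
  have sm: "sphere_smooth Y" using Y by (simp add: harm_space_def)
  have "hproj j (sph_lap Y) z = hproj j (\<lambda>y. - eigval TYPE('a) k * Y y) z"
    using Y by (intro hproj_cong) (auto simp: harm_space_def eigval_def)
  then have "- eigval TYPE('a) j * hproj j Y z = - eigval TYPE('a) k * hproj j Y z"
    unfolding hproj_sph_lap[OF sm z] hproj_cmult .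
  then show ?thesis using eigval_inj[OF dim \<open>j \<noteq> k\<close>] by simp
qed

lemma summable_power_mult_geometric:
  fixes x :: real
  assumes "\<bar>x\<bar> < 1"
  shows "summable (\<lambda>n. (real n + 1) ^ m * \<bar>x\<bar> ^ n)"
proof -
  have 1: "summable (\<lambda>n. real n ^ m * x ^ n)" if "norm x < 1" for x :: real and m
    using that
  proof (induction m arbitrary: x)
    case 0
    then show ?case by (simp add: summable_geometric)
  next
    case (Suc m)
    have "summable (\<lambda>n. diffs (\<lambda>n. real n ^ m) n * x ^ n)"
      by (rule termdiff_converges[of _ 1]) (use Suc in auto)
    then have "summable (\<lambda>n. x * (diffs (\<lambda>n. real n ^ m) n * x ^ n))" by (rule summable_mult)
    then have "summable (\<lambda>n. real (Suc n) ^ Suc m * x ^ Suc n)"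
      by (simp add: diffs_def mult_ac)
    then show ?case by (subst (asm) summable_Suc_iff)
  qed
  have "summable (\<lambda>n. diffs (\<lambda>n. real n ^ m) n * \<bar>x\<bar> ^ n)"
    by (rule termdiff_converges[of _ 1]) (use 1 assms in auto)
  then have "summable (\<lambda>n. (real n + 1) ^ Suc m * \<bar>x\<bar> ^ n)"
    by (simp add: diffs_def mult_ac add.commute)
  then show ?thesis
    by (rule summable_comparison_test'[where N = 0]) (auto simp: mult_right_mono mult_le_cancel_right1 intro!: mult_right_mono)
qed

section \<open>The Poisson kernel as an approximate identity\<close>

lemma pker_base_pos:
  fixes z y :: "'a::euclidean_space"
  assumes "z \<in> Sn" "y \<in> Sn" "0 \<le> r" "r < 1"
  shows "1 - 2 * r * (z \<bullet> y) + r\<^sup>2 > 0"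
proof -
  have "1 - 2 * r * (z \<bullet> y) + r\<^sup>2 = (1 - r)\<^sup>2 + 2 * r * (1 - z \<bullet> y)"
    by (simp add: power2_eq_square algebra_simps)
  moreover have "(1 - r)\<^sup>2 > 0" using assms by simp
  moreover have "2 * r * (1 - z \<bullet> y) \<ge> 0" using inner_Sn_le_1[OF assms(1,2)] assms by simp
  ultimately show ?thesis by linarith
qed

lemma pker_nonneg: "0 \<le> r \<Longrightarrow> r < 1 \<Longrightarrow> pker r z y \<ge> 0"
  by (simp add: pker_def abs_square_le_1)

lemma continuous_on_pker:
  fixes z :: "'a::euclidean_space"
  assumes "z \<in> Sn" "0 \<le> r" "r < 1"
  shows "continuous_on Sn (pker r z)"
proof -
  have "\<forall>y\<in>Sn. 1 - 2 * r * (z \<bullet> y) + r\<^sup>2 \<noteq> 0"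
    using pker_base_pos[OF assms(1) _ assms(2,3)] by (metis less_irrefl)
  then show ?thesis unfolding pker_def by (intro continuous_intros) auto
qed

lemma sphm_integral_sums:
  fixes f :: "nat \<Rightarrow> 'a::euclidean_space \<Rightarrow> real"
  assumes c: "\<And>k. continuous_on Sn (f k)" and B: "summable B"
    and bd: "\<And>k y. y \<in> Sn \<Longrightarrow> norm (f k y) \<le> B k"
  shows "(\<lambda>k. integral\<^sup>L sphm (f k)) sums (LINT y|sphm. (\<Sum>k. f k y))"
proof (rule sums_integral)
  show "integrable sphm (f k)" for k by (rule integrable_sphm_continuous[OF c])
  show "AE y in sphm. summable (\<lambda>k. norm (f k y))"
    by (rule AE_I2, rule summable_comparison_test'[OF B, of 0]) (use bd in auto)
  have "norm (LINT y|sphm. norm (f k y)) \<le> sphvol TYPE('a) * B k" for k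
  proof -
    have "(LINT y|sphm. norm (f k y)) \<le> (LINT y|(sphm :: 'a measure). B k)"
      by (rule integral_mono[OF integrable_norm[OF integrable_sphm_continuous[OF c]]])
        (use bd in \<open>auto simp only: space_sphm sphm.integrable_const\<close>)
    then show ?thesis by (simp add: sphvol_def)
  qed
  then show "summable (\<lambda>k. LINT y|sphm. norm (f k y))"
    by (rule summable_comparison_test'[OF summable_mult[OF B], where N = 0])
qed

text \<open>Termwise integration of the zonal series: the geometric factor beats the polynomial
  bound on the kernels. Poisson integrals are thereby the Abel means of the harmonic
  expansion.\<close>

lemma hproj_sums_poisson:
  fixes v :: "'a::euclidean_space \<Rightarrow> real"
  assumes dim: "3 \<le> DIM('a)" and v: "continuous_on Sn v" and z: "z \<in> Sn" and r: "0 \<le> r" "r < 1"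
  shows "(\<lambda>k. hproj k v z * r ^ k) sums ((LINT y|sphm. pker r z y * v y) / sphvol TYPE('a))"
proof -
  let ?l = "(real DIM('a) - 2) / 2"
  define f where "f k y = zker k z y * r ^ k * v y" for k y
  have cf: "continuous_on Sn (f k)" for k
    unfolding f_def by (intro continuous_intros continuous_on_zker v)
  obtain A m where A: "A \<ge> 0" "\<And>k (z::'a) y. z \<in> Sn \<Longrightarrow> y \<in> Sn \<Longrightarrow> \<bar>zker k z y\<bar> \<le> A * (real k + 1) ^ m"
    using zker_bound[OF dim] by blast
  obtain C where C: "C \<ge> 0" "\<And>x. x \<in> Sn \<Longrightarrow> \<bar>v x\<bar> \<le> C" using Sn_bounded_image[OF v] by blast
  have bd: "norm (f k y) \<le> A * C * ((real k + 1) ^ m * r ^ k)" if "y \<in> Sn" for k y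
  proof -
    have "norm (f k y) = \<bar>zker k z y\<bar> * r ^ k * \<bar>v y\<bar>" using r by (simp add: f_def abs_mult)
    also have "\<dots> \<le> (A * (real k + 1) ^ m) * r ^ k * C"
      using A(2)[OF z that, of k] C(2)[OF that] r A C by (intro mult_mono) auto
    finally show ?thesis by (simp add: mult_ac)
  qed
  have sm: "summable (\<lambda>k. A * C * ((real k + 1) ^ m * r ^ k))"
    using summable_power_mult_geometric[of r m] r by (intro summable_mult) simp
  have "(\<lambda>k. integral\<^sup>L sphm (f k)) sums (LINT y|sphm. (\<Sum>k. f k y))"
    by (rule sphm_integral_sums[OF cf sm bd])
  moreover have "(\<Sum>k. f k y) = pker r z y * v y" if "y \<in> Sn" for y
  proof -
    have l: "- ?l - 1 = - (real DIM('a) / 2)" "?l > 0" using dim by (simp_all add: field_simps)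
    have "(\<lambda>k. zker k z y * r ^ k) sums pker r z y"
      unfolding zker_def pker_def l(1)[symmetric]
      by (rule zonal_sums[OF inner_Sn_le_1[OF z that]]) (use r l in auto)
    from sums_mult2[OF this, of "v y"] show ?thesis by (simp add: f_def sums_iff)
  qed
  then have "(LINT y|sphm. (\<Sum>k. f k y)) = (LINT y|sphm. pker r z y * v y)"
    by (intro Bochner_Integration.integral_cong) auto
  ultimately have "(\<lambda>k. integral\<^sup>L sphm (f k) / sphvol TYPE('a)) sums ((LINT y|sphm. pker r z y * v y) / sphvol TYPE('a))"
    by (metis sums_divide)
  moreover have "integral\<^sup>L sphm (f k) / sphvol TYPE('a) = hproj k v z * r ^ k" for k
  proof -
    have "integral\<^sup>L sphm (f k) = (LINT y|sphm. r ^ k * (zker k z y * v y))"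
      by (intro Bochner_Integration.integral_cong) (simp_all add: f_def mult_ac)
    then show ?thesis using z by (simp add: hproj_def)
  qed
  ultimately show ?thesis by simp
qed

text \<open>The mass is read off from the expansion of the constant 1, which is harmonic of degree
  0, so every other term of its Poisson series vanishes.\<close>

lemma integral_pker:
  fixes z :: "'a::euclidean_space"
  assumes dim: "3 \<le> DIM('a)" and z: "z \<in> Sn" and r: "0 \<le> r" "r < 1"
  shows "(LINT y|sphm. pker r z y) = sphvol TYPE('a)"
proof -
  \<comment> \<open>The constant 1 has to be cut off outside the sphere to belong to
    \<open>harm_space 0\<close>.\<close>
  let ?Y = "\<lambda>x::'a. if x \<in> Sn then 1 else 0 :: real"
  have "sphere_smooth ?Y" using sphere_smooth_cong[of ?Y "\<lambda>_. 1"] sphere_smooth_const by auto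
  moreover have "sph_lap ?Y y = 0" if "y \<in> Sn" for y
    using sph_lap_cong[of ?Y "\<lambda>_. 1" y] that sph_lap_const[of 1 y] by auto
  ultimately have Y: "?Y \<in> harm_space 0" by (auto simp: harm_space_def)
  have h1: "hproj j (\<lambda>_. 1) z = (if j = 0 then 1 else 0)" for j
  proof (cases "j = 0")
    case True
    have "zker 0 z y = 1" for y using dim by (simp add: zker_def zonal_0)
    then show ?thesis using True z sphvol_pos[where 'a = 'a] by (simp add: hproj_def) (simp add: sphvol_def)
  next
    case False
    have "hproj j (\<lambda>_. 1) z = hproj j ?Y z" by (rule hproj_cong) auto
    then show ?thesis using hproj_orthogonal[OF dim Y False z] False by simp
  qed
  have "(\<lambda>k. hproj k (\<lambda>_. 1) z * r ^ k) sums ((LINT y|sphm. pker r z y * 1) / sphvol TYPE('a))"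
    by (rule hproj_sums_poisson[OF dim continuous_on_const z r])
  moreover have "(\<lambda>k. hproj k (\<lambda>_. 1) z * r ^ k) sums 1"
  proof -
    have "(\<lambda>k. hproj k (\<lambda>_. 1) z * r ^ k) = (\<lambda>k. if k = 0 then 1 else 0)"
      by (auto simp: h1)
    then show ?thesis using sums_single[of 0 "\<lambda>_. 1 :: real"] by simp
  qed
  ultimately have "(LINT y|sphm. pker r z y) / sphvol TYPE('a) = 1" using sums_unique2 by fastforce
  then show ?thesis using sphvol_pos[where 'a = 'a] by simp
qed

lemma poisson_tendsto:
  fixes v :: "'a::euclidean_space \<Rightarrow> real"
  assumes dim: "3 \<le> DIM('a)" and v: "continuous_on Sn v" and z: "z \<in> Sn"
  shows "((\<lambda>r. (LINT y|sphm. pker r z y * v y) / sphvol TYPE('a)) \<longlongrightarrow> v z) (at_left 1)"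
proof (rule tendstoI)
  fix e :: real assume e: "e > 0"
  let ?V = "sphvol TYPE('a)"
  have V: "?V > 0" by (rule sphvol_pos)
  obtain C where C: "C \<ge> 0" "\<And>x. x \<in> Sn \<Longrightarrow> \<bar>v x\<bar> \<le> C" using Sn_bounded_image[OF v] by blast
  obtain d where d: "d > 0" "\<And>y. y \<in> Sn \<Longrightarrow> dist y z < d \<Longrightarrow> dist (v y) (v z) < e / 2"
    using v z half_gt_zero[OF e] unfolding continuous_on_iff by meson
  \<comment> \<open>Bound for the far part: if |y - z| \<ge> d and r \<ge> 1/2, then 1 - 2 r (z
    \<bullet> y) + r^2 = (1 - r)^2 + r |y - z|^2 \<ge> d^2 / 2, while |v y - v z| \<le> 2 C.\<close>
  define K where "K = 2 * C * (d\<^sup>2 / 2) powr (- (real DIM('a) / 2))"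
  have bound: "dist ((LINT y|sphm. pker r z y * v y) / ?V) (v z) \<le> e / 2 + K * (1 - r\<^sup>2)"
    if r: "1/2 \<le> r" "r < 1" for r
  proof -
    have r': "0 \<le> r" using r by simp
    have r2: "1 - r\<^sup>2 \<ge> 0" using r by (simp add: abs_square_le_1)
    have pt: "\<bar>pker r z y * (v y - v z)\<bar> \<le> e / 2 * pker r z y + K * (1 - r\<^sup>2)" if y: "y \<in> Sn" for y
    proof (cases "dist y z < d")
      case True
      have "pker r z y * \<bar>v y - v z\<bar> \<le> pker r z y * (e / 2)"
        using d(2)[OF y True] pker_nonneg[OF r' r(2), of z y]
        by (intro mult_left_mono) (auto simp: dist_real_def)
      moreover have "K * (1 - r\<^sup>2) \<ge> 0" using C r2 by (simp add: K_def)
      ultimately show ?thesis using pker_nonneg[OF r' r(2), of z y] by (simp add: abs_mult mult.commute)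
    next
      case False
      have "(dist y z)\<^sup>2 = 2 - 2 * (z \<bullet> y)"
        using y z unfolding dist_norm power2_norm_eq_inner
        by (simp add: Sn_def norm_eq_1 inner_diff_left inner_diff_right inner_commute)
      moreover have "d\<^sup>2 \<le> (dist y z)\<^sup>2" using False d by (intro power_mono) auto
      ultimately have D: "d\<^sup>2 \<le> 2 - 2 * (z \<bullet> y)" by simp
      have "d\<^sup>2 / 2 \<le> r * d\<^sup>2" using r mult_right_mono[of "1/2" r "d\<^sup>2"] by simp
      also have "\<dots> \<le> r * (2 - 2 * (z \<bullet> y))" using D r' by (rule mult_left_mono)
      also have "\<dots> \<le> (1 - r)\<^sup>2 + r * (2 - 2 * (z \<bullet> y))" by simp
      also have "\<dots> = 1 - 2 * r * (z \<bullet> y) + r\<^sup>2" by (simp add: power2_eq_square algebra_simps)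
      finally have "(1 - 2 * r * (z \<bullet> y) + r\<^sup>2) powr (- (real DIM('a) / 2)) \<le> (d\<^sup>2 / 2) powr (- (real DIM('a) / 2))"
        using d(1) by (intro powr_mono2') auto
      then have p: "pker r z y \<le> (1 - r\<^sup>2) * (d\<^sup>2 / 2) powr (- (real DIM('a) / 2))"
        unfolding pker_def using r2 by (rule mult_left_mono)
      have "\<bar>v y - v z\<bar> \<le> 2 * C" using C(2)[OF y] C(2)[OF z] by linarith
      then have "\<bar>pker r z y * (v y - v z)\<bar> \<le> ((1 - r\<^sup>2) * (d\<^sup>2 / 2) powr (- (real DIM('a) / 2))) * (2 * C)"
        unfolding abs_mult using p pker_nonneg[OF r' r(2), of z y] r2 by (intro mult_mono) auto
      also have "\<dots> = K * (1 - r\<^sup>2)" by (simp add: K_def mult_ac)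
      finally show ?thesis using e pker_nonneg[OF r' r(2), of z y] by (simp add: add_increasing)
    qed
    note cp = continuous_on_pker[OF z r' r(2)]
    have i1: "integrable sphm (pker r z)" "integrable sphm (\<lambda>y. pker r z y * v y)"
      by (intro integrable_sphm_continuous continuous_on_mult cp v)+
    have "(LINT y|sphm. pker r z y * (v y - v z)) = (LINT y|sphm. pker r z y * v y - pker r z y * v z)"
      by (simp add: algebra_simps)
    also have "\<dots> = (LINT y|sphm. pker r z y * v y) - ?V * v z"
      using i1 integral_pker[OF dim z r' r(2)] by (subst Bochner_Integration.integral_diff) auto
    finally have eq: "(LINT y|sphm. pker r z y * v y) - ?V * v z = (LINT y|sphm. pker r z y * (v y - v z))" ..
    have "\<bar>LINT y|sphm. pker r z y * (v y - v z)\<bar> \<le> (LINT y|sphm. \<bar>pker r z y * (v y - v z)\<bar>)"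
      by (rule integral_abs_bound)
    also have "\<dots> \<le> (LINT y|sphm. e / 2 * pker r z y + K * (1 - r\<^sup>2))"
    proof (rule integral_mono)
      show "integrable sphm (\<lambda>y. \<bar>pker r z y * (v y - v z)\<bar>)"
        by (intro integrable_sphm_continuous continuous_intros cp v)
      show "integrable sphm (\<lambda>y. e / 2 * pker r z y + K * (1 - r\<^sup>2))"
        by (intro integrable_sphm_continuous continuous_intros cp)
    qed (use pt in simp)
    also have "\<dots> = e / 2 * ?V + K * (1 - r\<^sup>2) * ?V"
      using i1(1) integral_pker[OF dim z r' r(2)]
      by (subst Bochner_Integration.integral_add) (auto simp: sphvol_def)
    finally have "\<bar>(LINT y|sphm. pker r z y * v y) - ?V * v z\<bar> \<le> (e / 2 + K * (1 - r\<^sup>2)) * ?V"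
      unfolding eq by (simp add: algebra_simps)
    moreover have "(LINT y|sphm. pker r z y * v y) / ?V - v z = ((LINT y|sphm. pker r z y * v y) - ?V * v z) / ?V"
      using V by (simp add: field_simps)
    ultimately show ?thesis
      using V by (simp add: dist_real_def abs_divide pos_divide_le_eq)
  qed
  have "((\<lambda>r. K * (1 - r\<^sup>2)) \<longlongrightarrow> K * (1 - 1\<^sup>2)) (at_left (1::real))" by (intro tendsto_intros)
  then have "((\<lambda>r. K * (1 - r\<^sup>2)) \<longlongrightarrow> 0) (at_left (1::real))" by simp
  then have "\<forall>\<^sub>F r in at_left 1. K * (1 - r\<^sup>2) < e / 2"
    using e by (intro order_tendstoD) auto
  moreover have "\<forall>\<^sub>F r::real in at_left 1. r \<in> {1/2<..<1}"
    by (rule eventually_at_left_real) simp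
  ultimately show "\<forall>\<^sub>F r in at_left 1. dist ((LINT y|sphm. pker r z y * v y) / ?V) (v z) < e"
  proof eventually_elim
    case (elim r)
    then show ?case using bound[of r] by auto
  qed
qed

text \<open>By orthogonality the Poisson integral of \<open>Y\<close> at \<open>z\<close> is
  \<open>hproj k Y z * r ^ k\<close>; as r tends to 1 it also tends to \<open>Y z\<close>. This is
  the reproducing property of the zonal kernel.\<close>

lemma hproj_harm_space:
  fixes Y :: "'a::euclidean_space \<Rightarrow> real"
  assumes dim: "3 \<le> DIM('a)" and Y: "Y \<in> harm_space k" and z: "z \<in> Sn"
  shows "hproj k Y z = Y z"
proof -
  have c: "continuous_on Sn Y" using Y sphere_smooth_continuous by (auto simp: harm_space_def)
  have eq: "(LINT y|sphm. pker r z y * Y y) / sphvol TYPE('a) = hproj k Y z * r ^ k"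
    if "r \<in> {0<..<1}" for r
  proof -
    have "(\<lambda>j. hproj j Y z * r ^ j) = (\<lambda>j. if j = k then hproj k Y z * r ^ k else 0)"
      using hproj_orthogonal[OF dim Y _ z] by auto
    then have "(\<lambda>j. hproj j Y z * r ^ j) sums (hproj k Y z * r ^ k)"
      using sums_single[of k "\<lambda>_. hproj k Y z * r ^ k"] by simp
    then show ?thesis using hproj_sums_poisson[OF dim c z, of r] that sums_unique2 by fastforce
  qed
  have "((\<lambda>r. hproj k Y z * r ^ k) \<longlongrightarrow> hproj k Y z * 1 ^ k) (at_left (1::real))"
    by (intro tendsto_intros)
  moreover have "\<forall>\<^sub>F r::real in at_left 1. r \<in> {0<..<1}"
    by (rule eventually_at_left_real) simp
  then have "\<forall>\<^sub>F r in at_left 1. (LINT y|sphm. pker r z y * Y y) / sphvol TYPE('a) = hproj k Y z * r ^ k"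
    by eventually_elim (rule eq)
  then have "((\<lambda>r. hproj k Y z * r ^ k) \<longlongrightarrow> Y z) (at_left 1)"
    using poisson_tendsto[OF dim c z] by (rule Lim_transform_eventually[rotated])
  ultimately show ?thesis using tendsto_unique[OF trivial_limit_at_left_real] by fastforce
qed

section \<open>Identification of the spectral projections\<close>

lemma sphm_Fubini:
  fixes K :: "'a::euclidean_space \<Rightarrow> 'a \<Rightarrow> real"
  assumes m: "case_prod K \<in> borel_measurable (sphm \<Otimes>\<^sub>M sphm)"
    and B: "\<And>x y. x \<in> Sn \<Longrightarrow> y \<in> Sn \<Longrightarrow> \<bar>K x y\<bar> \<le> B"
  shows "(LINT x|sphm. LINT y|sphm. K x y) = (LINT y|sphm. LINT x|sphm. K x y)"
proof -
  interpret pair_sigma_finite "sphm :: 'a measure" "sphm :: 'a measure" ..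
  interpret P: finite_measure "(sphm :: 'a measure) \<Otimes>\<^sub>M (sphm :: 'a measure)"
    by (rule finite_measure_pair_measure) (rule finite_measure_sphm)+
  have "integrable (sphm \<Otimes>\<^sub>M sphm) (case_prod K)"
    by (rule P.integrable_const_bound[where B = B]) (use m B in \<open>auto intro!: AE_I2 simp: space_pair_measure\<close>)
  from Fubini_integral[OF this] show ?thesis ..
qed

lemma measurable_id_sphm [measurable]: "(\<lambda>x. x) \<in> borel_measurable sphm"
  by (intro borel_measurable_sphm_continuous continuous_on_id)

lemma measurable_inner_sphm:
  "(\<lambda>(x, y). x \<bullet> y) \<in> borel_measurable (sphm \<Otimes>\<^sub>M (sphm :: 'a::euclidean_space measure))"
proof -
  have "(\<lambda>pr. fst pr) \<in> borel_measurable (sphm \<Otimes>\<^sub>M (sphm :: 'a measure))"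
    "(\<lambda>pr. snd pr) \<in> borel_measurable (sphm \<Otimes>\<^sub>M (sphm :: 'a measure))"
    using measurable_compose[OF measurable_fst measurable_id_sphm]
      measurable_compose[OF measurable_snd measurable_id_sphm] by auto
  then show ?thesis unfolding case_prod_beta by (rule borel_measurable_inner)
qed

lemma hproj_self_adjoint:
  fixes u v :: "'a::euclidean_space \<Rightarrow> real"
  assumes dim: "3 \<le> DIM('a)" and u: "continuous_on Sn u" and v: "continuous_on Sn v"
  shows "(LINT z|sphm. hproj k u z * v z) = (LINT z|sphm. u z * hproj k v z)"
proof -
  let ?V = "sphvol TYPE('a)"
  obtain A m where A: "A \<ge> 0" "\<And>k (z::'a) y. z \<in> Sn \<Longrightarrow> y \<in> Sn \<Longrightarrow> \<bar>zker k z y\<bar> \<le> A * (real k + 1) ^ m"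
    using zker_bound[OF dim] by blast
  obtain C where C: "C \<ge> 0" "\<And>x. x \<in> Sn \<Longrightarrow> \<bar>u x\<bar> \<le> C" using Sn_bounded_image[OF u] by blast
  obtain D where D: "D \<ge> 0" "\<And>x. x \<in> Sn \<Longrightarrow> \<bar>v x\<bar> \<le> D" using Sn_bounded_image[OF v] by blast
  have [measurable]: "u \<in> borel_measurable sphm" "v \<in> borel_measurable sphm"
    using u v by (auto intro: borel_measurable_sphm_continuous)
  have zm: "(\<lambda>pr. zker k (fst pr) (snd pr)) \<in> borel_measurable (sphm \<Otimes>\<^sub>M (sphm :: 'a measure))"
  proof -
    have "poly (zonal ((real DIM('a) - 2) / 2) k) \<in> borel_measurable borel"
      by (intro borel_measurable_continuous_onI continuous_on_poly continuous_on_id)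
    from measurable_compose[OF measurable_inner_sphm this] show ?thesis
      by (simp add: zker_def case_prod_beta)
  qed
  have Km: "case_prod (\<lambda>x y. zker k x y * u y * v x) \<in> borel_measurable (sphm \<Otimes>\<^sub>M (sphm :: 'a measure))"
    unfolding case_prod_beta
    by (intro borel_measurable_times zm) measurable
  have "(LINT z|sphm. hproj k u z * v z) = (LINT z|sphm. (LINT y|sphm. zker k z y * u y * v z) / ?V)"
    by (intro Bochner_Integration.integral_cong) (auto simp: hproj_def)
  also have "\<dots> = (LINT z|sphm. LINT y|sphm. zker k z y * u y * v z) / ?V" by simp
  also have "\<dots> = (LINT y|sphm. LINT z|sphm. zker k z y * u y * v z) / ?V"
  proof (subst sphm_Fubini[OF Km])
    fix x y :: 'a assume xy: "x \<in> Sn" "y \<in> Sn"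
    show "\<bar>zker k x y * u y * v x\<bar> \<le> A * (real k + 1) ^ m * C * D"
      unfolding abs_mult using A(2)[OF xy, of k] C(2)[OF xy(2)] D(2)[OF xy(1)] A(1) C(1) D(1)
      by (intro mult_mono) auto
  qed simp
  also have "\<dots> = (LINT y|sphm. (LINT z|sphm. u y * (zker k y z * v z)) / ?V)"
    by (simp add: zker_commute[of k _ "_ :: 'a"] mult_ac)
  also have "\<dots> = (LINT y|sphm. u y * hproj k v y)"
    by (intro Bochner_Integration.integral_cong) (auto simp: hproj_def)
  finally show ?thesis .
qed

text \<open>Existence uses that \<open>hproj k\<close> is symmetric and fixes the members of
  \<open>harm_space k\<close>. For uniqueness, testing against the zonal kernel at \<open>z\<close>
  reproduces the value at \<open>z\<close>, so the orthogonality condition determines the function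
  pointwise.\<close>

lemma harm_proj_eq_hproj:
  fixes v :: "'a::euclidean_space \<Rightarrow> real"
  assumes dim: "3 \<le> DIM('a)" and v: "continuous_on Sn v"
  shows "harm_proj k v = hproj k v"
  unfolding harm_proj_def
proof (rule the_equality)
  have hc: "continuous_on Sn Y" if "Y \<in> harm_space k" for Y :: "'a \<Rightarrow> real"
    using that sphere_smooth_continuous by (auto simp: harm_space_def)
  have N: "real DIM('a) \<noteq> 0" using dim by simp
  have sint0: "sint (\<lambda>y. (v y - Y y) * Z y) = 0 \<longleftrightarrow> (LINT y|sphm. v y * Z y) = (LINT y|sphm. Y y * Z y)"
    if "Y \<in> harm_space k" "Z \<in> harm_space k" for Y Z :: "'a \<Rightarrow> real"
  proof -
    have "sint (\<lambda>y. (v y - Y y) * Z y) = real DIM('a) * (LINT y|sphm. v y * Z y - Y y * Z y)"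
      by (subst sint_eq_integral)
        (auto intro!: borel_measurable_sphm_continuous continuous_intros v hc[OF that(1)] hc[OF that(2)]
          simp: left_diff_distrib)
    also have "\<dots> = real DIM('a) * ((LINT y|sphm. v y * Z y) - (LINT y|sphm. Y y * Z y))"
      by (subst Bochner_Integration.integral_diff)
        (auto intro!: integrable_sphm_continuous continuous_intros v hc[OF that(1)] hc[OF that(2)])
    finally show ?thesis using N by simp
  qed
  have H: "hproj k v \<in> harm_space k" by (rule hproj_in_harm_space[OF v])
  have repr: "(LINT y|sphm. v y * Z y) = (LINT y|sphm. hproj k v y * Z y)"
    if Z: "Z \<in> harm_space k" for Z :: "'a \<Rightarrow> real"
  proof -
    have "(LINT y|sphm. hproj k v y * Z y) = (LINT y|sphm. v y * hproj k Z y)"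
      by (rule hproj_self_adjoint[OF dim v hc[OF Z]])
    also have "\<dots> = (LINT y|sphm. v y * Z y)"
      by (intro Bochner_Integration.integral_cong) (auto simp: hproj_harm_space[OF dim Z])
    finally show ?thesis ..
  qed
  show "hproj k v \<in> harm_space k \<and> (\<forall>Z\<in>harm_space k. sint (\<lambda>y. (v y - hproj k v y) * Z y) = 0)"
    using H repr sint0[OF H] by auto
  fix Y assume "Y \<in> harm_space k \<and> (\<forall>Z\<in>harm_space k. sint (\<lambda>y. (v y - Y y) * Z y) = 0)"
  then have Y: "Y \<in> harm_space k" and
    o: "\<And>Z. Z \<in> harm_space k \<Longrightarrow> (LINT y|sphm. v y * Z y) = (LINT y|sphm. Y y * Z y)"
    using sint0 by auto
  show "Y = hproj k v"
  proof
    fix z :: 'a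
    show "Y z = hproj k v z"
    proof (cases "z \<in> Sn")
      case z: True
      define Z where "Z y = (if y \<in> Sn then zker k z y else 0)" for y
      have eq: "Z y = zker k z y" if "y \<in> Sn" for y using that by (simp add: Z_def)
      have "sphere_smooth Z" using sphere_smooth_cong[of Z "zker k z"] eq sphere_smooth_zker by blast
      moreover have "- sph_lap Z y = real k * (real k + real DIM('a) - 2) * Z y" if "y \<in> Sn" for y
        using sph_lap_cong[of Z "zker k z", OF eq that] sph_lap_zker[OF z that, of k] eq[OF that] by (simp add: eigval_def)
      ultimately have Z: "Z \<in> harm_space k" by (auto simp: harm_space_def Z_def)
      have hZ: "hproj k w z = (LINT y|sphm. w y * Z y) / sphvol TYPE('a)" for w
        using z by (auto simp: hproj_def Z_def mult.commute intro!: Bochner_Integration.integral_cong)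
      have "Y z = hproj k Y z" by (rule hproj_harm_space[OF dim Y z, symmetric])
      then show ?thesis using o[OF Z] by (simp add: hZ)
    next
      case False
      then show ?thesis using Y by (simp add: harm_space_def hproj_def)
    qed
  qed
qed

text \<open>Each application of the Laplacian gains one power of \<open>k\<close>.\<close>
lemma hproj_decay:
  fixes v :: "'a::euclidean_space \<Rightarrow> real"
  assumes dim: "3 \<le> DIM('a)" and v: "sphere_smooth v"
  shows "\<exists>C\<ge>0. \<forall>k. \<forall>z\<in>Sn. \<bar>hproj k v z\<bar> * (real k + 1) ^ p \<le> C"
proof -
  obtain A m where A: "A \<ge> 0" "\<And>k (z::'a) y. z \<in> Sn \<Longrightarrow> y \<in> Sn \<Longrightarrow> \<bar>zker k z y\<bar> \<le> A * (real k + 1) ^ m"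
    using zker_bound[OF dim] by blast
  \<comment> \<open>The factor (k + 1)^m from the bound on the zonal kernel stays on the right
    throughout the induction and is paid for once at the end, by taking q = p + m.\<close>
  have "\<exists>C\<ge>0. \<forall>k. \<forall>z\<in>Sn. \<bar>hproj k v z\<bar> * (real k + 1) ^ q \<le> C * (real k + 1) ^ m" for q
    using v
  proof (induction q arbitrary: v)
    case 0
    have c: "continuous_on Sn v" by (rule sphere_smooth_continuous[OF 0])
    obtain C where C: "C \<ge> 0" "\<And>x. x \<in> Sn \<Longrightarrow> \<bar>v x\<bar> \<le> C" using Sn_bounded_image[OF c] by blast
    have "\<bar>hproj k v z\<bar> \<le> A * C * (real k + 1) ^ m" if z: "z \<in> Sn" for k z
    proof -
      have "\<bar>LINT y|sphm. zker k z y * v y\<bar> \<le> (LINT y|sphm. \<bar>zker k z y * v y\<bar>)"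
        by (rule integral_abs_bound)
      also have "\<dots> \<le> (LINT y|(sphm::'a measure). A * C * (real k + 1) ^ m)"
      proof (rule integral_mono)
        show "integrable sphm (\<lambda>y. \<bar>zker k z y * v y\<bar>)"
          by (intro integrable_sphm_continuous continuous_intros continuous_on_zker c)
        fix y :: 'a assume "y \<in> space sphm"
        then have y: "y \<in> Sn" by simp
        have "\<bar>zker k z y * v y\<bar> \<le> (A * (real k + 1) ^ m) * C"
          unfolding abs_mult using A(2)[OF z y, of k] C(2)[OF y] A(1) C(1) by (intro mult_mono) auto
        then show "\<bar>zker k z y * v y\<bar> \<le> A * C * (real k + 1) ^ m" by (simp add: mult_ac)
      qed simp
      finally have "\<bar>LINT y|sphm. zker k z y * v y\<bar> \<le> A * C * (real k + 1) ^ m * sphvol TYPE('a)"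
        by (simp add: sphvol_def mult_ac)
      then show ?thesis using z sphvol_pos[where 'a = 'a] by (simp add: hproj_def pos_divide_le_eq)
    qed
    then show ?case using A(1) C(1) by (intro exI[of _ "A * C"]) simp
  next
    case (Suc q)
    obtain C where C: "C \<ge> 0" "\<And>k z. z \<in> Sn \<Longrightarrow> \<bar>hproj k (sph_lap v) z\<bar> * (real k + 1) ^ q \<le> C * (real k + 1) ^ m"
      using Suc.IH[OF sphere_smooth_sph_lap[OF Suc.prems]] by blast
    obtain C' where C': "C' \<ge> 0" "\<And>k z. z \<in> Sn \<Longrightarrow> \<bar>hproj k v z\<bar> * (real k + 1) ^ q \<le> C' * (real k + 1) ^ m"
      using Suc.IH[OF Suc.prems] by blast
    have "\<bar>hproj k v z\<bar> * (real k + 1) ^ Suc q \<le> (C + C') * (real k + 1) ^ m" if z: "z \<in> Sn" for k z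
    \<comment> \<open>Degree 0 has eigenvalue 0, but there k + 1 = 1; from degree 1 on the
      eigenvalue is at least k + 1.\<close>
    proof (cases "k = 0")
      case True
      then show ?thesis using C'(2)[OF z, of 0] C(1) by simp
    next
      case False
      have "real k + 1 \<le> 1 * (real k + real DIM('a) - 2)" using dim by simp
      also have "\<dots> \<le> eigval TYPE('a) k"
        unfolding eigval_def using False dim by (intro mult_right_mono) auto
      finally have e: "real k + 1 \<le> eigval TYPE('a) k" .
      then have "\<bar>hproj k v z\<bar> * (real k + 1) \<le> \<bar>hproj k v z\<bar> * eigval TYPE('a) k"
        by (intro mult_left_mono) auto
      also have "\<dots> = \<bar>hproj k (sph_lap v) z\<bar>"
        using e by (simp add: hproj_sph_lap[OF Suc.prems z] abs_mult mult.commute)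
      finally have "\<bar>hproj k v z\<bar> * (real k + 1) * (real k + 1) ^ q \<le> \<bar>hproj k (sph_lap v) z\<bar> * (real k + 1) ^ q"
        by (intro mult_right_mono) auto
      also have "\<dots> \<le> C * (real k + 1) ^ m" by (rule C(2)[OF z])
      also have "\<dots> \<le> (C + C') * (real k + 1) ^ m" using C'(1) by (intro mult_right_mono) auto
      finally show ?thesis by (simp add: mult_ac)
    qed
    then show ?case using C(1) C'(1) by (intro exI[of _ "C + C'"]) auto
  qed
  from this[of "p + m"] obtain C where C: "C \<ge> 0"
    "\<And>k z. z \<in> Sn \<Longrightarrow> \<bar>hproj k v z\<bar> * (real k + 1) ^ (p + m) \<le> C * (real k + 1) ^ m" by blast
  have "\<bar>hproj k v z\<bar> * (real k + 1) ^ p \<le> C" if "z \<in> Sn" for k z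
  proof -
    have "(\<bar>hproj k v z\<bar> * (real k + 1) ^ p) * (real k + 1) ^ m \<le> C * (real k + 1) ^ m"
      using C(2)[OF that, of k] by (simp add: power_add mult_ac)
    moreover have "(real k + 1) ^ m > 0" by simp
    ultimately show ?thesis by (rule mult_right_le_imp_le)
  qed
  then show ?thesis using C(1) by blast
qed

section \<open>Pointwise convergence of the harmonic expansion\<close>

lemma summable_inverse_squares_shift: "summable (\<lambda>k. 1 / (real k + 1)\<^sup>2)"
proof -
  have "summable (\<lambda>n. 1 / (real (Suc n))\<^sup>2)"
    by (subst summable_Suc_iff) (rule inverse_power_summable[of 2, unfolded inverse_eq_divide, simplified])
  then show ?thesis by (simp add: add.commute)
qed

text \<open>Decay two orders beyond the growth of \<mu> leaves a multiple of 1 / (k + 1)^2. The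
  majorant is independent of \<open>z\<close>, as the Weierstrass test requires.\<close>

lemma hproj_weighted_summable:
  fixes v :: "'a::euclidean_space \<Rightarrow> real"
  assumes dim: "3 \<le> DIM('a)" and v: "sphere_smooth v" and \<mu>: "\<And>k. \<bar>\<mu> k\<bar> \<le> M * (real k + 1) ^ q"
  obtains b where "summable b" "\<And>k z. z \<in> Sn \<Longrightarrow> \<bar>\<mu> k * hproj k v z\<bar> \<le> b k"
proof -
  obtain C where C: "C \<ge> 0" "\<And>k z. z \<in> Sn \<Longrightarrow> \<bar>hproj k v z\<bar> * (real k + 1) ^ (q + 2) \<le> C"
    using hproj_decay[OF dim v, of "q + 2"] by blast
  have M: "M \<ge> 0" using \<mu>[of 0] by simp
  have "\<bar>\<mu> k * hproj k v z\<bar> \<le> M * C * (1 / (real k + 1)\<^sup>2)" if "z \<in> Sn" for k z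
  proof -
    have "\<bar>\<mu> k * hproj k v z\<bar> * (real k + 1)\<^sup>2 \<le> (M * (real k + 1) ^ q * \<bar>hproj k v z\<bar>) * (real k + 1)\<^sup>2"
      unfolding abs_mult using \<mu>[of k] by (intro mult_right_mono) auto
    also have "\<dots> = M * (\<bar>hproj k v z\<bar> * (real k + 1) ^ (q + 2))"
      by (simp add: power_add power2_eq_square mult_ac)
    also have "\<dots> \<le> M * C" using C(2)[OF that] M by (rule mult_left_mono)
    finally show ?thesis by (simp add: pos_le_divide_eq)
  qed
  then show ?thesis
    using that[of "\<lambda>k. M * C * (1 / (real k + 1)\<^sup>2)"] summable_mult[OF summable_inverse_squares_shift] by blast
qed

text \<open>The sum exists by decay. Uniform convergence on 0 \<le> r \<le> 1 makes the power series
  continuous up to r = 1, which identifies the sum with the limit of the Poisson integrals, that is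
  with \<open>v z\<close>.\<close>

lemma hproj_sums:
  fixes v :: "'a::euclidean_space \<Rightarrow> real"
  assumes dim: "3 \<le> DIM('a)" and v: "sphere_smooth v" and z: "z \<in> Sn"
  shows "(\<lambda>k. hproj k v z) sums v z"
proof -
  have c: "continuous_on Sn v" by (rule sphere_smooth_continuous[OF v])
  obtain b where b: "summable b" "\<And>k z. z \<in> Sn \<Longrightarrow> \<bar>1 * hproj k v z\<bar> \<le> b k"
    using hproj_weighted_summable[OF dim v, of "\<lambda>_. 1" 1 0] by auto
  have bd: "\<bar>hproj k v z\<bar> \<le> b k" for k using b(2)[OF z, of k] by simp
  have "summable (\<lambda>k. hproj k v z)"
    by (rule summable_comparison_test'[OF b(1), of 0]) (use bd in auto)
  moreover have "(\<Sum>k. hproj k v z) = v z"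
  proof -
    have "uniform_limit {0..1} (\<lambda>n r. \<Sum>k<n. hproj k v z * r ^ k) (\<lambda>r. \<Sum>k. hproj k v z * r ^ k) sequentially"
    proof (rule Weierstrass_m_test[OF _ b(1)])
      fix n and r :: real assume "r \<in> {0..1}"
      then have "r ^ n \<le> 1" "0 \<le> r ^ n" by (auto intro: power_le_one)
      then show "norm (hproj n v z * r ^ n) \<le> b n"
        using bd[of n] mult_mono[of "\<bar>hproj n v z\<bar>" "b n" "r ^ n" 1] by (simp add: abs_mult)
    qed
    then have "continuous_on {0..1} (\<lambda>r. \<Sum>k. hproj k v z * r ^ k)"
      by (rule uniform_limit_theorem[rotated]) (auto intro!: always_eventually continuous_intros)
    then have "((\<lambda>r. \<Sum>k. hproj k v z * r ^ k) \<longlongrightarrow> (\<Sum>k. hproj k v z * 1 ^ k)) (at 1 within {0..1})"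
      unfolding continuous_on_def by (rule bspec) simp
    then have 1: "((\<lambda>r. \<Sum>k. hproj k v z * r ^ k) \<longlongrightarrow> (\<Sum>k. hproj k v z)) (at_left (1::real))"
      by (simp add: at_within_Icc_at_left)
    have "\<forall>\<^sub>F r::real in at_left 1. r \<in> {0<..<1}"
      by (rule eventually_at_left_real) simp
    then have "\<forall>\<^sub>F r in at_left 1. (LINT y|sphm. pker r z y * v y) / sphvol TYPE('a) = (\<Sum>k. hproj k v z * r ^ k)"
      by eventually_elim (use hproj_sums_poisson[OF dim c z] in \<open>auto simp: sums_iff\<close>)
    then have "((\<lambda>r. \<Sum>k. hproj k v z * r ^ k) \<longlongrightarrow> v z) (at_left 1)"
      using poisson_tendsto[OF dim c z] by (rule Lim_transform_eventually[rotated])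
    with 1 show ?thesis using tendsto_unique[OF trivial_limit_at_left_real] by blast
  qed
  ultimately show ?thesis by (simp add: sums_iff)
qed

section \<open>The Riesz potential\<close>

definition beta_weight :: "real \<Rightarrow> real \<Rightarrow> real \<Rightarrow> real" where
  "beta_weight a b r = indicator {0..1} r * (r powr (a - 1) * (1 - r) powr (b - 1))"

lemma beta_weight_nonneg: "beta_weight a b r \<ge> 0"
  by (simp add: beta_weight_def)

text \<open>Since \<open>0 powr x\<close> is 0 for every \<open>x\<close>, the weight is 0 at r = 1
  whatever \<open>b\<close> is; thus the Poisson kernel matters only for r < 1, where it is
  continuous.\<close>

lemma beta_weight_eq_0: "r \<notin> {0..<1} \<Longrightarrow> beta_weight a b r = 0"
  by (cases "r = 1") (auto simp: beta_weight_def indicator_def)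

lemma beta_weight_measurable [measurable]: "beta_weight a b \<in> borel_measurable borel"
  unfolding beta_weight_def by measurable

lemma Beta_real_pos: "a > 0 \<Longrightarrow> b > 0 \<Longrightarrow> Beta a b > (0::real)"
  by (simp add: Beta_def Gamma_real_pos)

lemma has_bochner_integral_beta_weight:
  assumes "a > 0" "b > 0"
  shows "has_bochner_integral lborel (beta_weight a b) (Beta a b)"
proof (rule has_bochner_integral_nn_integral)
  have eq: "beta_weight a b = (\<lambda>t. if t \<in> {0..1} then t powr (a - 1) * (1 - t) powr (b - 1) else 0)"
    by (auto simp: beta_weight_def fun_eq_iff)
  have I: "(beta_weight a b has_integral Beta a b) UNIV"
    unfolding eq has_integral_restrict_UNIV by (rule has_integral_Beta_real[OF assms])
  then show "(\<integral>\<^sup>+x. beta_weight a b x \<partial>lborel) = ennreal (Beta a b)"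
    by (intro nn_integral_has_integral_lborel) (auto simp: beta_weight_nonneg)
  show "Beta a b \<ge> 0" using Beta_real_pos[OF assms] by simp
qed (auto simp: beta_weight_nonneg)

lemma beta_weight_mult_power: "beta_weight a b r * r ^ k = beta_weight (a + real k) b r"
proof (cases "r = 0")
  case True
  then show ?thesis by (simp add: beta_weight_def)
next
  case False
  show ?thesis
  proof (cases "r \<in> {0..1}")
    case True
    then have "r powr (a + real k - 1) = r powr (a - 1) * r ^ k"
      using False by (simp add: powr_realpow[symmetric] powr_add[symmetric] algebra_simps)
    then show ?thesis by (simp add: beta_weight_def mult_ac)
  qed (simp add: beta_weight_def)
qed

lemma norm_diff_Sn_power2:
  "z \<in> Sn \<Longrightarrow> y \<in> Sn \<Longrightarrow> (norm (z - y))\<^sup>2 = 2 - 2 * (z \<bullet> y)"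
  unfolding power2_norm_eq_inner
  by (simp add: Sn_def norm_eq_1 inner_diff_left inner_diff_right inner_commute)

text \<open>The substitution \<open>y = D r / (1 - 2 r t + r\<^sup>2)\<close> with \<open>D = 2 - 2 t\<close> turns the integral into a Beta
  integral.\<close>
lemma riesz_kernel_eq_poisson_integral:
  fixes z y :: "'a::euclidean_space"
  assumes s: "0 < s" "2 * s < real DIM('a) - 1" and z: "z \<in> Sn" and y: "y \<in> Sn" and ne: "z \<noteq> y"
  defines "b \<equiv> (real DIM('a) - 1) / 2 - s"
  shows "(LINT r|lborel. beta_weight b (2 * s) r * pker r z y)
    = Beta b (s + 1/2) / norm (z - y) powr (real DIM('a) - 1 - 2 * s)"
proof -
  define D where "D = (norm (z - y))\<^sup>2"
  define t where "t = z \<bullet> y"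
  have "D > 0" using ne by (simp add: D_def)
  moreover have "D = 2 - 2 * t" using norm_diff_Sn_power2[OF z y] by (simp add: D_def t_def)
  ultimately have D: "D > 0" "D = 2 - 2 * t" by blast+
  have b: "b > 0" using s by (simp add: b_def)
  define m where "m r = 1 - 2 * r * t + r\<^sup>2" for r
  have meq: "m r = (1 - r)\<^sup>2 + D * r" for r by (simp add: m_def D(2) power2_eq_square algebra_simps)
  have m: "m r > 0" if "r \<in> {0..1}" for r
  proof (cases "r = 0")
    case False
    then have "D * r > 0" using that D by simp
    then show ?thesis unfolding meq by (smt (verit) zero_le_power2)
  qed (simp add: m_def)
  \<comment> \<open>\<open>g\<close> increases from 0 to 1 on the unit interval, and 1 - g r = (1 -
    r)^2 / m r. The square explains the second Beta parameter s + 1/2: its exponent s - 1/2 doubles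
    to 2 s - 1.\<close>
  define g where "g r = D * r / m r" for r
  define g' where "g' r = D * (1 - r\<^sup>2) / (m r)\<^sup>2" for r
  have g01: "g 0 = 0" "g 1 = 1" using D by (simp_all add: g_def meq)
  have bw: "set_integrable lborel {g 0..g 1} (beta_weight b (s + 1/2))"
  proof -
    have "integrable lborel (beta_weight b (s + 1/2))"
      using has_bochner_integral_beta_weight[of b "s + 1/2"] b s by (auto simp: has_bochner_integral_iff)
    then show ?thesis unfolding set_integrable_def by (intro integrable_mult_indicator) auto
  qed
  have "(LBINT x. beta_weight b (s + 1/2) x * indicator {g 0..g 1} x)
      = (LBINT x. beta_weight b (s + 1/2) (g x) * g' x * indicator {0..1} x)"
  proof (rule integral_substitution(2)[where g = g and g' = g' and a = 0 and b = 1, OF bw])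
    fix r :: real assume r: "r \<in> {0..1}"
    have "m r \<noteq> 0" using m[OF r] by simp
    moreover have "(m has_real_derivative 2 * r - 2 * t) (at r)"
      unfolding m_def by (auto intro!: derivative_eq_intros)
    ultimately have "(g has_real_derivative (D * m r - D * r * (2 * r - 2 * t)) / (m r * m r)) (at r)"
      unfolding g_def by (auto intro!: derivative_eq_intros)
    then show "(g has_real_derivative g' r) (at r)"
      by (rule back_subst) (simp add: g'_def power2_eq_square m_def algebra_simps)
    show "g' r \<ge> 0" using r D by (auto simp: g'_def abs_square_le_1)
  next
    have "\<forall>r\<in>{0..1}. (m r)\<^sup>2 \<noteq> 0" using m by force
    moreover have "continuous_on {0..1} m" unfolding m_def by (intro continuous_intros)
    ultimately show "continuous_on {0..1} g'"
      unfolding g'_def by (intro continuous_intros)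
  qed simp
  moreover have "beta_weight b (s + 1/2) x * indicator {g 0..g 1} x = beta_weight b (s + 1/2) x" for x
    by (simp add: g01 beta_weight_def indicator_def)
  moreover have "beta_weight b (s + 1/2) (g r) * g' r * indicator {0..1} r
      = D powr b * (beta_weight b (2 * s) r * pker r z y)" for r
  proof (cases "r \<in> {0<..<1}")
    case r: True
    then have mr: "m r > 0" using m by simp
    have g1: "1 - g r = (1 - r)\<^sup>2 / m r" using mr by (simp add: g_def meq field_simps)
    have gin: "g r \<in> {0..1}"
    proof -
      have "g r \<ge> 0" using mr D r by (simp add: g_def)
      moreover have "1 - g r \<ge> 0" unfolding g1 using mr by simp
      ultimately show ?thesis by simp
    qed
    have dv: "(y / m r) powr a = y powr a * m r powr (- a)" if "y \<ge> 0" for y a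
      using that mr by (simp add: powr_divide powr_minus_divide)
    have e1: "g r powr (b - 1) = D powr (b - 1) * r powr (b - 1) * m r powr (- (b - 1))"
      unfolding g_def using D r by (subst dv) (simp_all add: powr_mult)
    have e2: "(1 - g r) powr (s + 1/2 - 1) = (1 - r) powr (2 * s - 1) * m r powr (- (s - 1/2))"
    proof -
      have "((1 - r)\<^sup>2) powr (s - 1/2) = (1 - r) powr (2 * s - 1)"
        using r powr_powr[of "1 - r" 2 "s - 1/2"] by (simp add: powr_numeral right_diff_distrib)
      then show ?thesis unfolding g1 by (subst dv) simp_all
    qed
    have e3: "g' r = D * (1 - r\<^sup>2) * m r powr (- 2)"
      using mr by (simp add: g'_def powr_minus powr_numeral divide_inverse)
    have e4: "m r powr (- (b - 1)) * m r powr (- (s - 1/2)) * m r powr (- 2) = m r powr (- (real DIM('a) / 2))"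
      unfolding powr_add[symmetric] by (rule arg_cong[where f = "\<lambda>x. m r powr x"]) (simp add: b_def field_simps)
    have e5: "D powr b = D powr (b - 1) * D" using D by (simp add: powr_diff)
    have "beta_weight b (s + 1/2) (g r) * g' r * indicator {0..1} r
        = (D powr (b - 1) * D) * (r powr (b - 1) * (1 - r) powr (2 * s - 1)) * ((1 - r\<^sup>2) *
           (m r powr (- (b - 1)) * m r powr (- (s - 1/2)) * m r powr (- 2)))"
      using gin r unfolding beta_weight_def e1 e2 e3 by (simp add: mult_ac)
    also have "\<dots> = D powr b * (beta_weight b (2 * s) r * pker r z y)"
      unfolding e4 e5[symmetric] using r by (simp add: beta_weight_def pker_def m_def t_def mult_ac)
    finally show ?thesis .
  next
    case False
    then consider "r = 0" | "r = 1" | "r \<notin> {0..1}" by force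
    then show ?thesis
    proof cases
      case 1
      then show ?thesis by (simp add: beta_weight_def g01)
    next
      case 2
      then show ?thesis by (simp add: beta_weight_def g01)
    next
      case 3
      then show ?thesis by (simp add: beta_weight_def)
    qed
  qed
  ultimately have "integral\<^sup>L lborel (beta_weight b (s + 1/2))
      = D powr b * (LINT r|lborel. beta_weight b (2 * s) r * pker r z y)" by simp
  moreover have "integral\<^sup>L lborel (beta_weight b (s + 1/2)) = Beta b (s + 1/2)"
    using has_bochner_integral_beta_weight[of b "s + 1/2"] b s by (auto simp: has_bochner_integral_iff)
  moreover have "D powr b = norm (z - y) powr (real DIM('a) - 1 - 2 * s)"
  proof -
    have "D powr b = (norm (z - y) powr 2) powr b" using ne by (simp add: D_def powr_numeral)
    also have "\<dots> = norm (z - y) powr (2 * b)" by (rule powr_powr)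
    also have "2 * b = real DIM('a) - 1 - 2 * s" by (simp add: b_def field_simps)
    finally show ?thesis .
  qed
  ultimately show ?thesis using ne by (simp add: field_simps)
qed

lemma measurable_pker:
  fixes z :: "'a::euclidean_space"
  shows "(\<lambda>pr. pker (fst pr) z (snd pr)) \<in> borel_measurable (lborel \<Otimes>\<^sub>M sphm)"
proof -
  have [measurable]: "(\<lambda>pr. snd pr) \<in> borel_measurable (lborel \<Otimes>\<^sub>M (sphm :: 'a measure))"
    using measurable_compose[OF measurable_snd measurable_id_sphm] by auto
  have [measurable]: "(\<lambda>pr. fst pr) \<in> borel_measurable (lborel \<Otimes>\<^sub>M (sphm :: 'a measure))"
    by simp
  show ?thesis unfolding pker_def by measurable
qed

text \<open>Fubini for weight times Poisson kernel: the constant mass of the kernel bounds the inner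
  integral by a multiple of the weight. Integrability of the singular integrand near the diagonal is
  inherited from the double integral.\<close>

lemma riesz_potential_eq:
  fixes h :: "'a::euclidean_space \<Rightarrow> real"
  assumes dim: "3 \<le> DIM('a)" and s: "0 < s" "2 * s < real DIM('a) - 1" and z: "z \<in> Sn"
    and h: "continuous_on Sn h"
  defines "b \<equiv> (real DIM('a) - 1) / 2 - s"
  shows "integrable sphm (\<lambda>y. h y / norm (z - y) powr (real DIM('a) - 1 - 2 * s))" (is ?A)
    and "Beta b (s + 1/2) * (LINT y|sphm. h y / norm (z - y) powr (real DIM('a) - 1 - 2 * s))
      = (LINT r|lborel. beta_weight b (2 * s) r * (LINT y|sphm. pker r z y * h y))" (is ?B)
proof -
  interpret pair_sigma_finite "lborel :: real measure" "sphm :: 'a measure" ..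
  have b: "b > 0" using s by (simp add: b_def)
  let ?w = "beta_weight b (2 * s)"
  define K where "K r y = ?w r * (pker r z y * h y)" for r y
  obtain C where C: "C \<ge> 0" "\<And>x. x \<in> Sn \<Longrightarrow> \<bar>h x\<bar> \<le> C" using Sn_bounded_image[OF h] by blast
  have hm [measurable]: "h \<in> borel_measurable sphm" by (rule borel_measurable_sphm_continuous[OF h])
  have Km: "(\<lambda>pr. K (fst pr) (snd pr)) \<in> borel_measurable (lborel \<Otimes>\<^sub>M sphm)"
    unfolding K_def by (intro borel_measurable_times measurable_pker) measurable
  have iw: "integrable lborel ?w"
    using has_bochner_integral_beta_weight[of b "2 * s"] b s by (auto simp: has_bochner_integral_iff)
  have iK: "integrable sphm (K r)" for r
  proof (cases "r \<in> {0..<1}")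
    case True
    then show ?thesis unfolding K_def
      by (intro integrable_sphm_continuous continuous_intros continuous_on_pker z h) auto
  next
    case False
    then have "K r = (\<lambda>_. 0)" by (simp add: K_def[abs_def] beta_weight_eq_0)
    then show ?thesis by simp
  qed
  have nK: "(LINT y|sphm. norm (K r y)) \<le> C * sphvol TYPE('a) * ?w r" for r
  proof (cases "r \<in> {0..<1}")
    case True
    have "(LINT y|sphm. norm (K r y)) \<le> (LINT y|sphm. (?w r * C) * pker r z y)"
    proof (rule integral_mono[OF integrable_norm[OF iK]])
      show "integrable sphm (\<lambda>y. (?w r * C) * pker r z y)"
        using True by (intro integrable_sphm_continuous continuous_intros continuous_on_pker z) auto
      fix y assume "y \<in> space (sphm :: 'a measure)"
      then have "\<bar>h y\<bar> \<le> C" using C by simp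
      then have "?w r * (pker r z y * \<bar>h y\<bar>) \<le> ?w r * (pker r z y * C)"
        using True pker_nonneg[of r z y] beta_weight_nonneg by (intro mult_left_mono) auto
      then show "norm (K r y) \<le> (?w r * C) * pker r z y"
        using True pker_nonneg[of r z y] beta_weight_nonneg[of b "2 * s" r]
        by (simp add: K_def abs_mult mult_ac)
    qed
    also have "\<dots> = C * sphvol TYPE('a) * ?w r"
      using True integral_pker[OF dim z, of r] by simp
    finally show ?thesis .
  qed (simp add: K_def beta_weight_eq_0)
  have I: "integrable (lborel \<Otimes>\<^sub>M sphm) (\<lambda>pr. K (fst pr) (snd pr))"
  proof (rule Fubini_integrable[OF Km])
    show "integrable lborel (\<lambda>r. LINT y|sphm. norm (K (fst (r, y)) (snd (r, y))))"
    proof (rule Bochner_Integration.integrable_bound[where f = "\<lambda>r. C * sphvol TYPE('a) * ?w r"])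
      show "integrable lborel (\<lambda>r. C * sphvol TYPE('a) * ?w r)" using iw by simp
      show "(\<lambda>r. LINT y|sphm. norm (K (fst (r, y)) (snd (r, y)))) \<in> borel_measurable lborel"
        using Km by (intro sphm.borel_measurable_lebesgue_integral) (auto simp: case_prod_beta)
      have "norm (LINT y|sphm. norm (K r y)) \<le> norm (C * sphvol TYPE('a) * ?w r)" for r
        using nK[of r] by simp
      then show "AE r in lborel. norm (LINT y|sphm. norm (K (fst (r, y)) (snd (r, y)))) \<le> norm (C * sphvol TYPE('a) * ?w r)"
        by simp
    qed
  qed (simp add: iK)
  then have I': "integrable (lborel \<Otimes>\<^sub>M sphm) (case_prod K)" by (simp add: case_prod_unfold)
  have inner: "(LINT r|lborel. K r y) = Beta b (s + 1/2) * (h y / norm (z - y) powr (real DIM('a) - 1 - 2 * s))"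
    if "y \<in> Sn" "y \<noteq> z" for y
  proof -
    have "(LINT r|lborel. K r y) = (LINT r|lborel. h y * (?w r * pker r z y))"
      by (simp add: K_def mult_ac)
    also have "\<dots> = h y * (LINT r|lborel. ?w r * pker r z y)" by simp
    finally show ?thesis
      using riesz_kernel_eq_poisson_integral[OF s z that(1)] that(2) by (simp add: b_def)
  qed
  have ae: "AE y in sphm. (LINT r|lborel. K r y)
      = Beta b (s + 1/2) * (h y / norm (z - y) powr (real DIM('a) - 1 - 2 * s))"
    using AE_sphm_neq[OF _ z] dim AE_space by (auto elim!: eventually_elim2 simp: inner)
  have km: "(\<lambda>y. h y / norm (z - y) powr (real DIM('a) - 1 - 2 * s)) \<in> borel_measurable sphm"
  proof -
    have [measurable]: "(\<lambda>y. z - y) \<in> borel_measurable sphm" by measurable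
    show ?thesis by measurable
  qed
  have i2: "integrable sphm (\<lambda>y. LINT r|lborel. K r y)" by (rule integrable_snd[OF I'])
  have Bn: "Beta b (s + 1/2) \<noteq> 0"
    using Beta_real_pos[of b "s + 1/2"] b s by simp
  have "integrable sphm (\<lambda>y. Beta b (s + 1/2) * (h y / norm (z - y) powr (real DIM('a) - 1 - 2 * s)))"
    by (rule integrable_cong_AE_imp[OF i2]) (use km ae in auto)
  then show ?A using Bn by (simp only: integrable_mult_left_iff simp_thms)
  have "Beta b (s + 1/2) * (LINT y|sphm. h y / norm (z - y) powr (real DIM('a) - 1 - 2 * s))
     = (LINT y|sphm. LINT r|lborel. K r y)"
    unfolding integral_mult_right_zero[symmetric]
    using km ae i2 by (intro integral_cong_AE) auto
  also have "\<dots> = (LINT r|lborel. LINT y|sphm. K r y)" by (rule Fubini_integral[OF I'])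
  finally show ?B by (simp add: K_def)
qed

section \<open>Multipliers of the operator and inversion by the potential\<close>

definition Ps_mult :: "real \<Rightarrow> real \<Rightarrow> nat \<Rightarrow> real" where
  "Ps_mult b s k = Gamma (b + real k + 2 * s) / Gamma (b + real k)"

lemma Ps_mult_pos: "b > 0 \<Longrightarrow> s > 0 \<Longrightarrow> Ps_mult b s k > 0"
  unfolding Ps_mult_def by (intro divide_pos_pos Gamma_real_pos) auto

lemma Beta_Ps_mult: 
  assumes "b > 0" "s > 0"
  shows "Beta (b + real k) (2 * s) * Ps_mult b s k = Gamma (2 * s)"
proof -
  have "Gamma (b + real k) > 0" "Gamma (b + real k + 2 * s) > 0"
    using assms by (auto intro!: Gamma_real_pos)
  then show ?thesis by (simp add: Beta_def Ps_mult_def)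
qed

text \<open>The ratio of consecutive multipliers is 1 + 2 s / (b + k), which for suitable q is at
  most ((k + 2) / (k + 1))^q by Bernoulli; these factors telescope.\<close>

lemma Ps_mult_bound:
  assumes b: "b > 0" and s: "s > 0"
  obtains M q where "\<And>k. \<bar>Ps_mult b s k\<bar> \<le> M * (real k + 1) ^ q"
proof -
  \<comment> \<open>The inequality 2 s (k + 1) \<le> q (b + k) is secured separately for the
    coefficient of k, by \<open>q1\<close>, and for the constant term, by \<open>q2\<close>.\<close>
  obtain q1 :: nat where q1: "2 * s \<le> real q1" using real_arch_simple by blast
  obtain q2 :: nat where q2: "2 * s / b \<le> real q2" using real_arch_simple by blast
  define q where "q = max q1 q2"
  have q: "2 * s \<le> real q" using q1 by (simp add: q_def)
  have "2 * s \<le> real q2 * b" using q2 b by (simp add: field_simps)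
  also have "\<dots> \<le> real q * b" using b by (intro mult_right_mono) (simp_all add: q_def)
  finally have q': "2 * s \<le> real q * b" .
  have "Ps_mult b s k \<le> Ps_mult b s 0 * (real k + 1) ^ q" for k
  proof (induction k)
    case (Suc k)
    have bk: "b + real k > 0" "b + real k + 2 * s > 0" using b s by auto
    have "Gamma (b + real k + 1) = (b + real k) * Gamma (b + real k)"
      "Gamma (b + real k + 2 * s + 1) = (b + real k + 2 * s) * Gamma (b + real k + 2 * s)"
      using bk by (auto intro!: Gamma_plus1 elim!: nonpos_Ints_cases)
    then have "Ps_mult b s (Suc k) = (b + real k + 2 * s) / (b + real k) * Ps_mult b s k"
      by (simp add: Ps_mult_def add_ac)
    also have "\<dots> \<le> (1 + 1 / (real k + 1)) ^ q * (Ps_mult b s 0 * (real k + 1) ^ q)"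
    proof (intro mult_mono Suc)
      have "2 * s * real k \<le> real q * real k" using q by (rule mult_right_mono) simp
      then have "2 * s * (real k + 1) \<le> real q * (b + real k)" using q' by (simp add: algebra_simps)
      then have "2 * s / (b + real k) \<le> real q / (real k + 1)"
        using bk by (simp add: divide_le_eq pos_le_divide_eq mult_ac)
      then have "(b + real k + 2 * s) / (b + real k) \<le> 1 + real q * (1 / (real k + 1))"
        using bk by (simp add: add_divide_distrib)
      also have "\<dots> \<le> (1 + 1 / (real k + 1)) ^ q"
        by (rule Bernoulli_inequality) (simp add: field_simps)
      finally show "(b + real k + 2 * s) / (b + real k) \<le> (1 + 1 / (real k + 1)) ^ q" .
      show "0 \<le> Ps_mult b s k" using Ps_mult_pos[OF b s] by (simp add: less_imp_le)
    qed simp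
    also have "\<dots> = Ps_mult b s 0 * ((1 + 1 / (real k + 1)) * (real k + 1)) ^ q"
      by (simp add: power_mult_distrib mult_ac)
    also have "(1 + 1 / (real k + 1)) * (real k + 1) = real (Suc k) + 1" by (simp add: field_simps)
    finally show ?case .
  qed simp
  then show ?thesis using that[of "Ps_mult b s 0" q] Ps_mult_pos[OF b s] by (simp add: less_imp_le)
qed

lemma Ps_eq:
  fixes v :: "'a::euclidean_space \<Rightarrow> real"
  assumes dim: "3 \<le> DIM('a)" and v: "continuous_on Sn v"
  shows "Ps s v z = (\<Sum>k. Ps_mult ((real DIM('a) - 1) / 2 - s) s k * hproj k v z)"
proof -
  \<comment> \<open>k (k + n - 1) + ((n - 1) / 2)^2 is a perfect square, hence \<open>Bk\<close> is
    linear in k and the Gamma arguments become b + k + 2 s and b + k with b = n/2 - s.\<close>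
  have B: "Bk TYPE('a) k = real k + (real DIM('a) - 2) / 2" for k
  proof -
    have "real k * (real k + (real DIM('a) - 1) - 1) + ((real DIM('a) - 1 - 1) / 2)\<^sup>2
        = (real k + (real DIM('a) - 2) / 2)\<^sup>2"
      by (simp add: power2_eq_square field_simps)
    then show ?thesis unfolding Bk_def Let_def using dim by simp
  qed
  have c: "Bk TYPE('a) k + 1/2 + s = (real DIM('a) - 1) / 2 - s + real k + 2 * s"
    "Bk TYPE('a) k + 1/2 - s = (real DIM('a) - 1) / 2 - s + real k" for k
    unfolding B by (simp_all add: field_simps)
  show ?thesis unfolding Ps_def Ps_mult_def harm_proj_eq_hproj[OF dim v] c ..
qed

text \<open>Uniform convergence of the series gives continuity, so that the potential of
  \<open>Ps s v\<close> makes sense, and lets \<open>hproj j\<close> pass to the terms, of which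
  only degree j survives.\<close>

lemma Ps_properties:
  fixes v :: "'a::euclidean_space \<Rightarrow> real"
  assumes dim: "3 \<le> DIM('a)" and s: "0 < s" "2 * s < real DIM('a) - 1" and v: "sphere_smooth v"
  defines "b \<equiv> (real DIM('a) - 1) / 2 - s"
  shows "continuous_on Sn (Ps s v)"
    and "\<And>j z. z \<in> Sn \<Longrightarrow> hproj j (Ps s v) z = Ps_mult b s j * hproj j v z"
proof -
  have b: "b > 0" using s by (simp add: b_def)
  have cv: "continuous_on Sn v" by (rule sphere_smooth_continuous[OF v])
  define a where "a k z = Ps_mult b s k * hproj k v z" for k z
  have P: "Ps s v z = (\<Sum>k. a k z)" for z unfolding a_def b_def by (rule Ps_eq[OF dim cv])
  obtain M q where "\<And>k. \<bar>Ps_mult b s k\<bar> \<le> M * (real k + 1) ^ q" using Ps_mult_bound[OF b s(1)] by blast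
  then obtain B where B: "summable B" "\<And>k z. z \<in> Sn \<Longrightarrow> \<bar>a k z\<bar> \<le> B k"
    unfolding a_def using hproj_weighted_summable[OF dim v] by blast
  have hc: "continuous_on Sn (hproj k v)" for k
    using hproj_in_harm_space[OF cv, of k] sphere_smooth_continuous by (auto simp: harm_space_def)
  have ac: "continuous_on Sn (a k)" for k unfolding a_def by (intro continuous_intros hc)
  have "uniform_limit Sn (\<lambda>n z. \<Sum>k<n. a k z) (\<lambda>z. \<Sum>k. a k z) sequentially"
    by (rule Weierstrass_m_test[OF _ B(1)]) (use B(2) in auto)
  then have "continuous_on Sn (\<lambda>z. \<Sum>k. a k z)"
    by (rule uniform_limit_theorem[rotated]) (auto intro!: always_eventually continuous_on_sum ac)
  then show "continuous_on Sn (Ps s v)" by (simp add: P[abs_def])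
  fix j and z :: 'a assume z: "z \<in> Sn"
  obtain Z where Z: "Z \<ge> 0" "\<And>x. x \<in> Sn \<Longrightarrow> \<bar>zker j z x\<bar> \<le> Z"
    using Sn_bounded_image[OF continuous_on_zker] by blast
  define f where "f k y = zker j z y * a k y" for k y
  have fb: "norm (f k y) \<le> Z * B k" if "y \<in> Sn" for k y
    unfolding f_def real_norm_def abs_mult using Z(2)[OF that] B(2)[OF that, of k] Z(1)
    by (intro mult_mono) auto
  have fc: "continuous_on Sn (f k)" for k
    unfolding f_def by (intro continuous_on_mult continuous_on_zker ac)
  have "(\<lambda>k. integral\<^sup>L sphm (f k)) sums (LINT y|sphm. (\<Sum>k. f k y))"
    by (rule sphm_integral_sums[OF fc summable_mult[OF B(1)] fb])
  moreover have "integral\<^sup>L sphm (f k) = (if k = j then sphvol TYPE('a) * a j z else 0)" for k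
  proof -
    have "hproj j (a k) z = Ps_mult b s k * hproj j (hproj k v) z"
      unfolding a_def by (rule hproj_cmult)
    also have "\<dots> = (if k = j then a j z else 0)"
      using hproj_orthogonal[OF dim hproj_in_harm_space[OF cv, of k], of j z]
        hproj_harm_space[OF dim hproj_in_harm_space[OF cv, of k] z] z by (auto simp: a_def)
    finally have "integral\<^sup>L sphm (f k) / sphvol TYPE('a) = (if k = j then a j z else 0)"
      using z by (simp add: hproj_def f_def[abs_def])
    then show ?thesis using sphvol_pos[where 'a = 'a] by (auto simp: field_simps split: if_splits)
  qed
  ultimately have "(\<lambda>k. if k = j then sphvol TYPE('a) * a j z else 0) sums (LINT y|sphm. (\<Sum>k. f k y))"
    by simp
  then have "(LINT y|sphm. (\<Sum>k. f k y)) = sphvol TYPE('a) * a j z"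
    using sums_single[of j "\<lambda>_. sphvol TYPE('a) * a j z"] sums_unique2 by blast
  moreover have "(LINT y|sphm. (\<Sum>k. f k y)) = (LINT y|sphm. zker j z y * Ps s v y)"
  proof (rule Bochner_Integration.integral_cong[OF refl])
    fix y assume "y \<in> space (sphm :: 'a measure)"
    then have "summable (\<lambda>k. a k y)"
      by (intro summable_comparison_test'[OF B(1), of 0]) (use B(2) in auto)
    then show "(\<Sum>k. f k y) = zker j z y * Ps s v y"
      unfolding f_def P by (rule suminf_mult)
  qed
  ultimately show "hproj j (Ps s v) z = Ps_mult b s j * hproj j v z"
    using z sphvol_pos[where 'a = 'a] by (simp add: hproj_def[of j "Ps s v"] a_def)
qed

text \<open>Legendre duplication turns Gamma(s) Gamma(s + 1/2) into Gamma(2 s) and accounts for the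
  factor 2^(2 s) in \<open>cns\<close>; its sqrt(pi), together with the area 2 pi^((n+1)/2) /
  Gamma((n+1)/2) of the sphere, accounts for the power of pi.\<close>

lemma cns_normalisation:
  assumes "0 < s" "2 * s < real DIM('a::euclidean_space) - 1"
  defines "b \<equiv> (real DIM('a) - 1) / 2 - s"
  shows "cns (real DIM('a) - 1) s * (real DIM('a) * sphvol TYPE('a)) * Gamma (2 * s) = Beta b (s + 1/2)"
proof -
  define N where "N = real DIM('a)"
  have N: "N > 1" using assms by (simp add: N_def)
  have b: "b > 0" "b = (N - 1) / 2 - s" using assms by (simp_all add: b_def N_def)
  have pos: "Gamma b > 0" "Gamma s > 0" "Gamma (s + 1/2) > 0" "Gamma (2 * s) > 0" "Gamma (N / 2) > 0"
    using b assms N by (auto intro!: Gamma_real_pos)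
  have dup: "Gamma s * Gamma (s + 1/2) = 2 powr (1 - 2 * s) * sqrt pi * Gamma (2 * s)"
  proof -
    have "complex_of_real s \<notin> \<int>\<^sub>\<le>\<^sub>0" "complex_of_real (s + 1/2) \<notin> \<int>\<^sub>\<le>\<^sub>0"
      unfolding of_real_in_nonpos_Ints_iff using assms(1) by (auto elim!: nonpos_Ints_cases)
    then have "complex_of_real s \<notin> \<int>\<^sub>\<le>\<^sub>0" "complex_of_real s + 1/2 \<notin> \<int>\<^sub>\<le>\<^sub>0" by simp_all
    from Gamma_legendre_duplication[OF this]
    have "complex_of_real (Gamma s * Gamma (s + 1/2))
        = complex_of_real (exp ((1 - 2 * s) * ln 2) * sqrt pi * Gamma (2 * s))"
      by (simp flip: Gamma_complex_of_real exp_of_real)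
    then show ?thesis by (simp only: of_real_eq_iff) (simp add: powr_def)
  qed
  have vol: "N * sphvol TYPE('a) = 2 * pi powr (N / 2) / Gamma (N / 2)"
  proof -
    have G: "Gamma (N / 2 + 1) = N / 2 * Gamma (N / 2)"
      using N by (intro Gamma_plus1) (auto elim!: nonpos_Ints_cases)
    show ?thesis unfolding sphvol_eq unit_ball_vol_def N_def[symmetric] G using N pos by (simp add: field_simps)
  qed
  have Be: "Beta b (s + 1/2) = Gamma b * Gamma (s + 1/2) / Gamma (N / 2)"
    unfolding Beta_def b(2) by (simp add: field_simps)
  have c: "cns (N - 1) s = Gamma b / (pi powr ((N - 1) / 2) * 2 powr (2 * s) * Gamma s)"
    unfolding cns_def b(2) ..
  have p1: "pi powr (N / 2) = pi powr ((N - 1) / 2) * sqrt pi"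
    by (simp add: powr_half_sqrt[symmetric] powr_add[symmetric] diff_divide_distrib)
  have p2: "2 powr (1 - 2 * s) * 2 powr (2 * s) = (2::real)" by (simp flip: powr_add)
  have "2 * sqrt pi * Gamma (2 * s) = 2 powr (2 * s) * (Gamma s * Gamma (s + 1/2))"
    unfolding dup using p2 by (simp add: mult_ac)
  then have "Gamma b * (2 * sqrt pi * Gamma (2 * s)) / (2 powr (2 * s) * Gamma s * Gamma (N / 2))
      = Gamma b * Gamma (s + 1/2) / Gamma (N / 2)"
    using pos by (simp add: field_simps)
  then show ?thesis
    unfolding N_def[symmetric] vol c Be p1 using pos by (simp add: field_simps)
qed

text \<open>For fixed r the inner integral is a Poisson series with coefficients
  \<open>Ps_mult b s k * hproj k v z\<close>; integration over r replaces r^k by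
  \<open>Beta (b + real k) (2 * s)\<close>, which cancels the multiplier up to Gamma(2 s). What
  remains is the pointwise expansion of \<open>v\<close>.\<close>

lemma riesz_potential_Ps:
  fixes v :: "'a::euclidean_space \<Rightarrow> real"
  assumes dim: "3 \<le> DIM('a)" and s: "0 < s" "2 * s < real DIM('a) - 1" and v: "sphere_smooth v"
    and z: "z \<in> Sn"
  shows "cns (real DIM('a) - 1) s * (real DIM('a) *
     (LINT y|sphm. Ps s v y / norm (z - y) powr (real DIM('a) - 1 - 2 * s))) = v z"
proof -
  define b where "b = (real DIM('a) - 1) / 2 - s"
  have b: "b > 0" using s by (simp add: b_def)
  let ?V = "sphvol TYPE('a)" and ?w = "beta_weight b (2 * s)"
  have V: "?V > 0" by (rule sphvol_pos)
  note P = Ps_properties[OF dim s v, folded b_def]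
  obtain M q where "\<And>k. \<bar>Ps_mult b s k\<bar> \<le> M * (real k + 1) ^ q" using Ps_mult_bound[OF b s(1)] by blast
  then obtain B where B: "summable B" "\<And>k z. z \<in> Sn \<Longrightarrow> \<bar>Ps_mult b s k * hproj k v z\<bar> \<le> B k"
    using hproj_weighted_summable[OF dim v] by blast
  define a where "a k = Ps_mult b s k * hproj k v z" for k
  have aB: "\<bar>a k\<bar> \<le> B k" for k using B(2)[OF z] by (simp add: a_def)
  have hb: "has_bochner_integral lborel (\<lambda>r. ?w r * r ^ k) (Beta (b + real k) (2 * s))" for k
    unfolding beta_weight_mult_power using b s by (intro has_bochner_integral_beta_weight) auto
  define f where "f k r = a k * (?w r * r ^ k)" for k r
  have fi: "integrable lborel (f k)" "integral\<^sup>L lborel (f k) = a k * Beta (b + real k) (2 * s)" for k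
    using hb[of k] unfolding f_def by (simp_all add: has_bochner_integral_iff)
  have fb: "norm (f k r) \<le> B k * ?w r" for k r
  proof (cases "r \<in> {0..1}")
    case True
    then have "r ^ k \<le> 1" "0 \<le> r ^ k" by (auto intro: power_le_one)
    then have "?w r * r ^ k \<le> ?w r * 1" using beta_weight_nonneg by (intro mult_left_mono) auto
    then show ?thesis unfolding f_def real_norm_def abs_mult
      using aB[of k] beta_weight_nonneg[of b "2 * s" r] \<open>0 \<le> r ^ k\<close> by (intro mult_mono) auto
  qed (simp add: f_def beta_weight_def)
  have wI: "integrable lborel ?w" using hb[of 0] by (simp add: has_bochner_integral_iff)
  have "(\<lambda>k. integral\<^sup>L lborel (f k)) sums (LINT r|lborel. (\<Sum>k. f k r))"
  proof (rule sums_integral[OF fi(1)])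
    show "AE r in lborel. summable (\<lambda>k. norm (f k r))"
      by (rule AE_I2, rule summable_comparison_test'[OF summable_mult2[OF B(1)], where N = 0]) (use fb in auto)
    have "norm (LINT r|lborel. norm (f k r)) \<le> B k * integral\<^sup>L lborel ?w" for k
    proof -
      have "(LINT r|lborel. norm (f k r)) \<le> (LINT r|lborel. B k * ?w r)"
        by (rule integral_mono[OF integrable_norm[OF fi(1)]]) (use wI fb in auto)
      then show ?thesis by simp
    qed
    then show "summable (\<lambda>k. LINT r|lborel. norm (f k r))"
      by (rule summable_comparison_test'[OF summable_mult2[OF B(1)], where N = 0])
  qed
  moreover have "(\<lambda>k. integral\<^sup>L lborel (f k)) sums (Gamma (2 * s) * v z)"
  proof -
    have "integral\<^sup>L lborel (f k) = Gamma (2 * s) * hproj k v z" for k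
      unfolding fi(2) a_def Beta_Ps_mult[OF b s(1), of k, symmetric] by (simp add: mult_ac)
    then show ?thesis using sums_mult[OF hproj_sums[OF dim v z]] by simp
  qed
  ultimately have 1: "(LINT r|lborel. (\<Sum>k. f k r)) = Gamma (2 * s) * v z" by (rule sums_unique2)
  have 2: "?w r * (LINT y|sphm. pker r z y * Ps s v y) = ?V * (\<Sum>k. f k r)" for r
  proof (cases "r \<in> {0..<1}")
    case True
    then have "(\<lambda>k. hproj k (Ps s v) z * r ^ k) sums ((LINT y|sphm. pker r z y * Ps s v y) / ?V)"
      by (intro hproj_sums_poisson[OF dim P(1) z]) auto
    from sums_mult[OF this, of "?w r"]
    have "(\<lambda>k. f k r) sums (?w r * ((LINT y|sphm. pker r z y * Ps s v y) / ?V))"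
      unfolding P(2)[OF z] f_def a_def by (simp add: mult_ac)
    then show ?thesis using V by (simp add: sums_iff)
  next
    case False
    then show ?thesis by (simp add: f_def beta_weight_eq_0)
  qed
  have "Beta b (s + 1/2) * (LINT y|sphm. Ps s v y / norm (z - y) powr (real DIM('a) - 1 - 2 * s))
      = ?V * (Gamma (2 * s) * v z)"
    using riesz_potential_eq(2)[OF dim s z P(1)] unfolding b_def[symmetric] 2
    by (simp add: 1)
  moreover have "Beta b (s + 1/2) = cns (real DIM('a) - 1) s * (real DIM('a) * ?V) * Gamma (2 * s)"
    unfolding b_def by (rule cns_normalisation[OF s, symmetric])
  ultimately have "(?V * Gamma (2 * s)) * (cns (real DIM('a) - 1) s * (real DIM('a) *
     (LINT y|sphm. Ps s v y / norm (z - y) powr (real DIM('a) - 1 - 2 * s)))) = (?V * Gamma (2 * s)) * v z"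
    by (simp add: mult_ac)
  moreover have "Gamma (2 * s) > 0" using s by (intro Gamma_real_pos) simp
  then have "?V * Gamma (2 * s) \<noteq> 0" using V by simp
  ultimately show ?thesis using mult_left_cancel by blast
qed

text \<open>Fubini for the singular kernel itself. Absolute integrability holds because the
  potential of the constant 1 is the same finite number at every point of the sphere.\<close>

lemma riesz_potential_symmetric:
  fixes h g :: "'a::euclidean_space \<Rightarrow> real"
  assumes dim: "3 \<le> DIM('a)" and s: "0 < s" "2 * s < real DIM('a) - 1"
    and h: "continuous_on Sn h" and g: "continuous_on Sn g"
  defines "p \<equiv> real DIM('a) - 1 - 2 * s"
  shows "(LINT z|sphm. (LINT y|sphm. h y / norm (z - y) powr p) * g z)
    = (LINT y|sphm. h y * (LINT z|sphm. g z / norm (y - z) powr p))"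
proof -
  interpret pair_sigma_finite "sphm :: 'a measure" "sphm :: 'a measure" ..
  define b where "b = (real DIM('a) - 1) / 2 - s"
  have b: "b > 0" using s by (simp add: b_def)
  define K where "K z y = h y / norm (z - y) powr p * g z" for z y
  obtain C where C: "C \<ge> 0" "\<And>x. x \<in> Sn \<Longrightarrow> \<bar>h x\<bar> \<le> C" using Sn_bounded_image[OF h] by blast
  obtain D where D: "D \<ge> 0" "\<And>x. x \<in> Sn \<Longrightarrow> \<bar>g x\<bar> \<le> D" using Sn_bounded_image[OF g] by blast
  have [measurable]: "h \<in> borel_measurable sphm" "g \<in> borel_measurable sphm"
    using h g by (auto intro: borel_measurable_sphm_continuous)
  have Km: "(\<lambda>pr. K (fst pr) (snd pr)) \<in> borel_measurable (sphm \<Otimes>\<^sub>M sphm)"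
  proof -
    have [measurable]: "(\<lambda>pr. fst pr) \<in> borel_measurable (sphm \<Otimes>\<^sub>M (sphm :: 'a measure))"
      "(\<lambda>pr. snd pr) \<in> borel_measurable (sphm \<Otimes>\<^sub>M (sphm :: 'a measure))"
      using measurable_compose[OF measurable_fst measurable_id_sphm]
        measurable_compose[OF measurable_snd measurable_id_sphm] by auto
    show ?thesis unfolding K_def by measurable
  qed
  have iK: "integrable sphm (K z)" if "z \<in> Sn" for z
    unfolding K_def p_def by (intro integrable_mult_left riesz_potential_eq(1)[OF dim s that h])
  \<comment> \<open>Value of the potential of 1: the Poisson kernel has mass \<open>sphvol\<close>
    for each r < 1, so only the integral of the weight is left.\<close>
  define E where "E = sphvol TYPE('a) * Beta b (2 * s) / Beta b (s + 1/2)"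
  have k1: "(LINT y|sphm. 1 / norm (z - y) powr p) = E" if z: "z \<in> Sn" for z :: 'a
  proof -
    have "Beta b (s + 1/2) * (LINT y|sphm. 1 / norm (z - y) powr p)
        = (LINT r|lborel. beta_weight b (2 * s) r * (LINT y|sphm. pker r z y * 1))"
      unfolding b_def p_def by (rule riesz_potential_eq(2)[OF dim s z continuous_on_const])
    also have "\<dots> = (LINT r|lborel. beta_weight b (2 * s) r * sphvol TYPE('a))"
    proof (rule Bochner_Integration.integral_cong[OF refl])
      fix r :: real
      show "beta_weight b (2 * s) r * (LINT y|sphm. pker r z y * 1) = beta_weight b (2 * s) r * sphvol TYPE('a)"
      proof (cases "r \<in> {0..<1}")
        case True
        then show ?thesis using integral_pker[OF dim z, of r] by simp
      next
        case False
        then show ?thesis by (simp add: beta_weight_eq_0)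
      qed
    qed
    also have "\<dots> = Beta b (2 * s) * sphvol TYPE('a)"
      using has_bochner_integral_beta_weight[of b "2 * s"] b s by (simp add: has_bochner_integral_iff)
    finally show ?thesis
      using Beta_real_pos[of b "s + 1/2"] b s by (simp add: E_def field_simps)
  qed
  have nK: "(LINT y|sphm. norm (K z y)) \<le> C * D * E" if z: "z \<in> Sn" for z
  proof -
    have "(LINT y|sphm. norm (K z y)) \<le> (LINT y|sphm. (C * D) * (1 / norm (z - y) powr p))"
    proof (rule integral_mono[OF integrable_norm[OF iK[OF z]]])
      show "integrable sphm (\<lambda>y. (C * D) * (1 / norm (z - y) powr p))"
        unfolding p_def by (intro integrable_mult_right riesz_potential_eq(1)[OF dim s z] continuous_on_const)
      fix y assume "y \<in> space (sphm :: 'a measure)"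
      then have "\<bar>h y\<bar> * \<bar>g z\<bar> \<le> C * D" using C D z by (intro mult_mono) auto
      then have "\<bar>h y\<bar> * \<bar>g z\<bar> * (1 / norm (z - y) powr p) \<le> C * D * (1 / norm (z - y) powr p)"
        by (intro mult_right_mono) auto
      then show "norm (K z y) \<le> (C * D) * (1 / norm (z - y) powr p)"
        by (simp add: K_def abs_mult)
    qed
    then show ?thesis unfolding integral_mult_right_zero k1[OF z] .
  qed
  have "integrable (sphm \<Otimes>\<^sub>M sphm) (\<lambda>pr. K (fst pr) (snd pr))"
  proof (rule Fubini_integrable[OF Km])
    show "integrable sphm (\<lambda>z. LINT y|sphm. norm (K (fst (z, y)) (snd (z, y))))"
    proof (rule sphm.integrable_const_bound[where B = "C * D * E"])
      show "(\<lambda>z. LINT y|sphm. norm (K (fst (z, y)) (snd (z, y)))) \<in> borel_measurable sphm"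
        using Km by (intro sphm.borel_measurable_lebesgue_integral) (auto simp: case_prod_beta)
      show "AE z in sphm. norm (LINT y|sphm. norm (K (fst (z, y)) (snd (z, y)))) \<le> C * D * E"
        by (rule AE_I2) (use nK in simp)
    qed
  qed (auto intro!: AE_I2 iK)
  then have "integrable (sphm \<Otimes>\<^sub>M sphm) (case_prod K)" by (simp add: case_prod_unfold)
  from Fubini_integral[OF this]
  have "(LINT z|sphm. LINT y|sphm. K z y) = (LINT y|sphm. LINT z|sphm. K z y)" ..
  moreover have "(LINT z|sphm. K z y) = h y * (LINT z|sphm. g z / norm (y - z) powr p)" for y
    unfolding integral_mult_right_zero[symmetric]
    by (rule Bochner_Integration.integral_cong) (simp_all add: K_def norm_minus_commute[of _ y])
  moreover have "(LINT y|sphm. K z y) = (LINT y|sphm. h y / norm (z - y) powr p) * g z" for z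
    unfolding K_def by (rule integral_mult_left_zero)
  ultimately show ?thesis by (simp only:)
qed

section \<open>Passage to the conformal metric\<close>

theorem theorem3p4:
  fixes \<phi> :: "'a::euclidean_space \<Rightarrow> real" and s :: real and f :: "real \<Rightarrow> real"
  assumes "DIM('a) \<ge> 4"
    and "0 < 2 * s" and "2 * s < real DIM('a) - 1"
    and "sphere_smooth \<phi>" and "\<forall>\<zeta>\<in>Sn. \<phi> \<zeta> > 0"
    and "continuous_on UNIV f"
  shows "(\<forall>u. continuous_on Sn u \<and> (\<forall>\<zeta>\<in>Sn. u \<zeta> \<ge> 0) \<and> solI s \<phi> f u
              \<longrightarrow> weak_solD s \<phi> f u)
       \<and> ((\<forall>\<zeta>\<in>Sn. \<forall>t\<ge>0. f t + Rg s \<phi> \<zeta> * t \<ge> 0) \<longrightarrow>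
          (\<forall>u. sphere_smooth u \<and> (\<forall>\<zeta>\<in>Sn. u \<zeta> \<ge> 0) \<and> solD s \<phi> f u \<longrightarrow> solI s \<phi> f u))"
proof -
  define n where "n = real DIM('a) - 1"
  have dim: "3 \<le> DIM('a)" and s: "0 < s" "2 * s < real DIM('a) - 1" using assms by auto
  have ns: "n - 2 * s > 0" using s by (simp add: n_def)
  have \<phi>: "continuous_on Sn \<phi>" "\<And>\<zeta>. \<zeta> \<in> Sn \<Longrightarrow> \<phi> \<zeta> > 0"
    using assms sphere_smooth_continuous by auto
  have cpow: "continuous_on Sn (\<lambda>y. \<phi> y powr e)" for e
    using \<phi> by (intro continuous_on_powr continuous_on_const) force+
  \<comment> \<open>\<open>e\<close> is the exponent in the conformal law of P_s. The volume density
    carries \<open>e + 1\<close>, so one factor \<phi> is spare: in (I) the kernel cancels it, in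
    the weak form of (D) it joins \<open>u\<close> on the left and the test function on the
    right.\<close>
  define e where "e = (n + 2 * s) / (n - 2 * s)"
  have e1: "2 * n / (n - 2 * s) = e + 1" "- (n + 2 * s) / (n - 2 * s) = - e"
    using ns by (simp_all add: e_def field_simps)
  have Rg: "Rg s \<phi> \<zeta> = \<phi> \<zeta> powr (- e) * Ps s \<phi> \<zeta>" for \<zeta>
    unfolding Rg_def Pg_def Let_def n_def[symmetric] e1 by simp
  have cP: "continuous_on Sn (Ps s v)" if "sphere_smooth v" for v :: "'a \<Rightarrow> real"
    by (rule Ps_properties(1)[OF dim s that])
  have cR: "continuous_on Sn (Rg s \<phi>)"
    unfolding Rg[abs_def] by (intro continuous_on_mult cpow cP assms(4))
  \<comment> \<open>Density of the right-hand side with respect to the round metric: (I) says that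
    \<phi> u is the Riesz potential of \<open>h u\<close>, and (D) that \<open>h u\<close> is P_s
    (\<phi> u).\<close>
  define h where "h u y = \<phi> y powr e * (f (u y) + Rg s \<phi> y * u y)" for u y
  have ch: "continuous_on Sn (h u)" if "continuous_on Sn u" for u
    unfolding h_def
    by (intro continuous_on_mult continuous_on_add cpow cR that continuous_on_compose2[OF assms(6) that]) auto
  have solI: "solI s \<phi> f u \<longleftrightarrow> (\<forall>\<zeta>\<in>Sn. \<phi> \<zeta> * u \<zeta> = cns n s * (real DIM('a) *
      (LINT y|sphm. h u y / norm (\<zeta> - y) powr (n - 2 * s))))" if u: "continuous_on Sn u" for u
  proof -
    have "(u \<zeta> = cns n s * vint s \<phi> (\<lambda>y. (f (u y) + Rg s \<phi> y * u y) / Kern s \<phi> \<zeta> y)) \<longleftrightarrow>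
      (\<phi> \<zeta> * u \<zeta> = cns n s * (real DIM('a) * (LINT y|sphm. h u y / norm (\<zeta> - y) powr (n - 2 * s))))"
      if \<zeta>: "\<zeta> \<in> Sn" for \<zeta>
    proof -
      define k where "k y = \<phi> y powr (e + 1) * ((f (u y) + Rg s \<phi> y * u y) / (\<phi> \<zeta> * \<phi> y * norm (\<zeta> - y) powr (n - 2 * s)))" for y
      have keq: "k y = (1 / \<phi> \<zeta>) * (h u y / norm (\<zeta> - y) powr (n - 2 * s))" if "y \<in> Sn" for y
        using \<phi>(2)[OF that] by (simp add: k_def h_def powr_add)
      have I: "integrable sphm (\<lambda>y. (1 / \<phi> \<zeta>) * (h u y / norm (\<zeta> - y) powr (n - 2 * s)))"
        unfolding n_def by (intro integrable_mult_right riesz_potential_eq(1)[OF dim s \<zeta> ch[OF u]])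
      have km: "k \<in> borel_measurable sphm"
        using borel_measurable_integrable[OF I] keq by (subst measurable_cong[of sphm]) auto
      have "vint s \<phi> (\<lambda>y. (f (u y) + Rg s \<phi> y * u y) / Kern s \<phi> \<zeta> y) = sint k"
        unfolding vint_def Kern_def Let_def n_def[symmetric] e1 k_def ..
      also have "\<dots> = real DIM('a) * integral\<^sup>L sphm k" by (rule sint_eq_integral[OF km])
      also have "integral\<^sup>L sphm k = (LINT y|sphm. (1 / \<phi> \<zeta>) * (h u y / norm (\<zeta> - y) powr (n - 2 * s)))"
        using keq by (intro Bochner_Integration.integral_cong) auto
      also have "\<dots> = (1 / \<phi> \<zeta>) * (LINT y|sphm. h u y / norm (\<zeta> - y) powr (n - 2 * s))"
        by (rule integral_mult_right_zero)
      finally have "vint s \<phi> (\<lambda>y. (f (u y) + Rg s \<phi> y * u y) / Kern s \<phi> \<zeta> y)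
        = real DIM('a) * ((1 / \<phi> \<zeta>) * (LINT y|sphm. h u y / norm (\<zeta> - y) powr (n - 2 * s)))" .
      then show ?thesis using \<phi>(2)[OF \<zeta>] by (simp only:) (simp add: field_simps)
    qed
    then show ?thesis unfolding solI_def n_def[symmetric] by blast
  qed
  have key: "cns n s * (real DIM('a) * (LINT y|sphm. Ps s v y / norm (\<zeta> - y) powr (n - 2 * s))) = v \<zeta>"
    if "sphere_smooth v" "\<zeta> \<in> Sn" for v and \<zeta> :: 'a
    unfolding n_def by (rule riesz_potential_Ps[OF dim s that])
  have "weak_solD s \<phi> f u" if u: "continuous_on Sn u" and sol: "solI s \<phi> f u" for u
    unfolding weak_solD_def
  proof (intro allI impI)
    fix \<psi> :: "'a \<Rightarrow> real" assume \<psi>: "sphere_smooth \<psi>"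
    define v where "v y = \<phi> y * \<psi> y" for y
    have v: "sphere_smooth v" unfolding v_def by (rule sphere_smooth_mult[OF assms(4) \<psi>])
    have c\<psi>: "continuous_on Sn \<psi>" by (rule sphere_smooth_continuous[OF \<psi>])
    let ?l = "\<lambda>y. \<phi> y powr (e + 1) * (u y * (\<phi> y powr (- e) * Ps s v y))"
    let ?r = "\<lambda>y. \<phi> y powr (e + 1) * ((f (u y) + Rg s \<phi> y * u y) * \<psi> y)"
    have "continuous_on Sn ?l" by (intro continuous_on_mult cpow cP v u)
    moreover have "continuous_on Sn ?r"
      by (intro continuous_on_mult continuous_on_add cpow u c\<psi> cR continuous_on_compose2[OF assms(6) u]) auto
    ultimately have m: "?l \<in> borel_measurable sphm" "?r \<in> borel_measurable sphm"
      by (auto intro: borel_measurable_sphm_continuous)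
    have leq: "?l y = (\<phi> y * u y) * Ps s v y" if "y \<in> Sn" for y
      using \<phi>(2)[OF that] by (simp add: powr_add powr_minus field_simps)
    have req: "?r y = h u y * v y" if "y \<in> Sn" for y
      using \<phi>(2)[OF that] by (simp add: powr_add h_def v_def mult_ac)
    have "vint s \<phi> (\<lambda>y. u y * Pg s \<phi> \<psi> y) = sint ?l"
      unfolding vint_def Pg_def Let_def n_def[symmetric] e1 v_def ..
    also have "\<dots> = real DIM('a) * integral\<^sup>L sphm ?l" by (rule sint_eq_integral[OF m(1)])
    \<comment> \<open>(I) replaces \<phi> u by the potential of \<open>h u\<close>; by symmetry of
      the kernel the potential then falls on \<open>Ps s v\<close>, from which it recovers
      \<open>v\<close>.\<close>
    also have "integral\<^sup>L sphm ?l = (LINT \<zeta>|sphm. (cns n s * real DIM('a)) *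
        ((LINT y|sphm. h u y / norm (\<zeta> - y) powr (n - 2 * s)) * Ps s v \<zeta>))"
    proof (rule Bochner_Integration.integral_cong[OF refl])
      fix \<zeta> assume "\<zeta> \<in> space (sphm :: 'a measure)"
      then have \<zeta>: "\<zeta> \<in> Sn" by simp
      show "?l \<zeta> = (cns n s * real DIM('a)) *
        ((LINT y|sphm. h u y / norm (\<zeta> - y) powr (n - 2 * s)) * Ps s v \<zeta>)"
        unfolding leq[OF \<zeta>] using sol \<zeta> by (simp add: solI[OF u])
    qed
    also have "\<dots> = (cns n s * real DIM('a)) *
        (LINT \<zeta>|sphm. (LINT y|sphm. h u y / norm (\<zeta> - y) powr (n - 2 * s)) * Ps s v \<zeta>)"
      by simp
    also have "\<dots> = (cns n s * real DIM('a)) *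
        (LINT y|sphm. h u y * (LINT \<zeta>|sphm. Ps s v \<zeta> / norm (y - \<zeta>) powr (n - 2 * s)))"
      unfolding n_def by (subst riesz_potential_symmetric[OF dim s ch[OF u] cP[OF v]]) simp
    also have "\<dots> = (LINT y|sphm. h u y * (cns n s * (real DIM('a) * (LINT \<zeta>|sphm. Ps s v \<zeta> / norm (y - \<zeta>) powr (n - 2 * s)))))"
      unfolding integral_mult_right_zero[symmetric] by (simp add: mult_ac)
    also have "\<dots> = integral\<^sup>L sphm ?r"
      by (rule Bochner_Integration.integral_cong[OF refl]) (simp only: space_sphm key[OF v] req)
    also have "real DIM('a) * integral\<^sup>L sphm ?r = sint ?r" by (rule sint_eq_integral[OF m(2), symmetric])
    also have "\<dots> = vint s \<phi> (\<lambda>y. (f (u y) + Rg s \<phi> y * u y) * \<psi> y)"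
      unfolding vint_def Let_def n_def[symmetric] e1 ..
    finally show "vint s \<phi> (\<lambda>y. u y * Pg s \<phi> \<psi> y) = vint s \<phi> (\<lambda>y. (f (u y) + Rg s \<phi> y * u y) * \<psi> y)" .
  qed
  moreover have "solI s \<phi> f u" if u: "sphere_smooth u" and sol: "solD s \<phi> f u" for u
  proof -
    define v where "v y = \<phi> y * u y" for y
    have v: "sphere_smooth v" unfolding v_def by (rule sphere_smooth_mult[OF assms(4) u])
    have eq: "h u y = Ps s v y" if y: "y \<in> Sn" for y
    proof -
      have "Pg s \<phi> u y - Rg s \<phi> y * u y = f (u y)" using sol y by (simp add: solD_def)
      moreover have "Pg s \<phi> u y = \<phi> y powr (- e) * Ps s v y"
        unfolding Pg_def Let_def n_def[symmetric] e1 v_def ..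
      ultimately have "f (u y) + Rg s \<phi> y * u y = \<phi> y powr (- e) * Ps s v y" by simp
      then show ?thesis using \<phi>(2)[OF y] by (simp add: h_def powr_minus field_simps)
    qed
    have "\<phi> \<zeta> * u \<zeta> = cns n s * (real DIM('a) * (LINT y|sphm. h u y / norm (\<zeta> - y) powr (n - 2 * s)))"
      if \<zeta>: "\<zeta> \<in> Sn" for \<zeta>
    proof -
      have "(LINT y|sphm. h u y / norm (\<zeta> - y) powr (n - 2 * s))
          = (LINT y|sphm. Ps s v y / norm (\<zeta> - y) powr (n - 2 * s))"
        by (rule Bochner_Integration.integral_cong[OF refl]) (simp add: eq)
      then show ?thesis using key[OF v \<zeta>] by (simp add: v_def)
    qed
    then show ?thesis using solI[OF sphere_smooth_continuous[OF u]] by blast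
  qed
  ultimately show ?thesis by blast
qed

end
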